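(* Let $b\ge5$ be an integer, let $\tau,u\in\{0,1,\dots,b-1\}$ and $$D_1=\{0,1,\dots,b-1\}\setminus\{\tau\},\qquad D_2=\{0,1,\dots,b-1\}\setminus\{u\}.$$ Then the pair $(D_1,D_2)$ is non-degenerate if and only if both $\{\tau,u\}\cap\{0,b-1\}=\varnothing$ and $\tau+u=b-1$. When $(D_1,D_2)$ is non-degenerate, the family of matrices $\{A_i\}_{i=0}^{b-1}$ associated with $(D_1,D_2)$ (with projective Möbius maps $f_i=[F(A_i)]$) does not have generalized heteroclinic connections of depth $2$; consequently there is $P\in\mathrm{GL}_2(\mathbb R)$ such that $B_i=PA_iP^{-1}$ is a positive matrix for every $0\le i\le b-1$, and, with $T$ and $\boldsymbol v$ the infinite matrix and vector associated with the positive family $\{B_i\}_{i=0}^{b-1}$ and uniform weights $w_i=1/b$, we have for Lebesgue-a.e. $t\in\mathbb R/\mathbb Z$ $$\dim_{\mathrm H}\big((K_1+t)\cap K_2\big)=\frac1{\log b}\sum_{n=0}^\infty\big(T^n\boldsymbol v\big)_0 .$$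
   Context: $\mathbb N_0=\{0,1,2,\dots\}$. A matrix is positive if all its entries are $>0$. $\dim_{\mathrm H}$ is Hausdorff dimension. Powers use the convention $0^0=1$. For $D_j\subset\{0,\dots,b-1\}$ ($j=1,2$) let $K_j=\{\sum_{n=1}^\infty d_nb^{-n}\mid d_n\in D_j\}\subset\mathbb R/\mathbb Z$. The associated $2\times2$ matrices $A_0,\dots,A_{b-1}$ have entries $$A_i(j,k)=\#\big((D_1+i+j)\cap(D_2+kb)\big),\qquad 0\le j,k\le1,$$ (row $j$, column $k$, sets taken in $\mathbb Z$). The pair $(D_1,D_2)$ is degenerate if some $A_i$, $0\le i\le b-1$, is singular; otherwise it is non-degenerate. $\mathrm{PGL}_2(\mathbb R)=\mathrm{GL}_2(\mathbb R)/\sim$, where $A\sim B$ iff $A=tB$ for some $t\in\mathbb R\setminus\{0\}$. The class $[M]$ of $M=\begin{pmatrix}\alpha&\beta\\ \gamma&\delta\end{pmatrix}$ is identified with the Möbius transformation $x\mapsto\frac{\alpha x+\beta}{\gamma x+\delta}$ of the Riemann sphere, which preserves $\widehat{\mathbb R}=\mathbb R\cup\{\widehat\infty\}$; for $f=[M]$ put $f^{\top}=[M^{\top}]$. Define $$F\begin{pmatrix}p&q\\ r&s\end{pmatrix}=\frac12\begin{pmatrix}p-q-r+s&p+q-r-s\\ p-q+r-s&p+q+r+s\end{pmatrix}.$$ If $f(\widehat\infty)=\widehat\infty$, set $f'(\widehat\infty):=\frac{d}{dz}\frac1{f(1/z)}\big|_{z=0}$. Generalized heteroclinic connections of depth $2$: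 let $I$ be the index set, $\mathcal F_2=\{f_i\mid i\in I\}\cup\{f_i\circ f_j\mid i,j\in I\}$, $\mathrm{Attr}_2=\{a\in\widehat{\mathbb R}\mid\exists f\in\mathcal F_2: f(a)=a,|f'(a)|\le1\}$, $\mathrm{Rep}_2=\{b\in\widehat{\mathbb R}\mid\exists f\in\mathcal F_2: f(b)=b,|f'(b)|\ge1\}$. The family has a generalized heteroclinic connection of depth $2$ if there are $h\in\{\mathrm{id}\}\cup\mathcal F_2$ and $a\in\mathrm{Attr}_2$ with $h(a)\in\mathrm{Rep}_2$. $T$ and $\boldsymbol v$ associated with a finite family $\{B_i\}_{i\in I}$ of invertible positive $2\times2$ matrices and a probability vector $(w_i)_{i\in I}$: let $g_i=[F(B_i)]$. For $x,c\in\mathbb C$, $|x|\le1$, let $v(x;c)$ be the sequence indexed by $\mathbb N_0$ with $(v(x;c))_0=c$, $(v(x;c))_n=-\frac{(-x)^n}n$ for $n\ge1$. Then $\boldsymbol v=\sum_iw_i\,v\big(g_i(0);\tfrac12\log(\det F(B_i)/g_i'(0))\big)$ (the argument of the logarithm is positive), and $T=(b_{k,n})_{k,n\in\mathbb N_0}$ with $b_{k,0}=0$ for $k\ge0$, $b_{0,n}=\sum_iw_i(g_i^{\top}(0))^n$ for $n\ge1$, and for $k,n\ge1$ $$b_{k,n}=\sum_iw_i\sum_{\ell=1}^{\min\{k,n\}}\binom n\ell\binom{k-1}{\ell-1}(g_i^{\top}(0))^{n-\ell}(-g_i(0))^{k-\ell}(g_i'(0))^{\ell}.$$ $T$ acts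 by $(Tu)_k=\sum_{n\ge0}b_{k,n}u_n$; it is a well-defined linear operator on the linear span $V$ of all $v(x;c)$, $|x|\le 1$, so $T^n\boldsymbol v$ makes sense, and $(\cdot)_0$ is the $0$-th coordinate. *)

theory Defs
  imports "HOL-Analysis.Analysis"
begin

section \<open>The circle $\mathbb R/\mathbb Z$\<close>

quotient_type circle = real / "\<lambda>x y :: real. x - y \<in> \<int>"
  morphisms rep_circle to_circle
proof (rule equivpI)
  show "reflp (\<lambda>x y :: real. x - y \<in> \<int>)"
    by (auto simp: reflp_def)
  show "symp (\<lambda>x y :: real. x - y \<in> \<int>)"
    by (auto simp: symp_def) (metis Ints_minus minus_diff_eq)
  show "transp (\<lambda>x y :: real. x - y \<in> \<int>)"
    by (auto simp: transp_def) (metis Ints_add diff_add_cancel add_diff_eq)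
qed

instantiation circle :: ab_group_add
begin

lift_definition zero_circle :: circle is 0 .

lift_definition plus_circle :: "circle \<Rightarrow> circle \<Rightarrow> circle" is "(+)"
  by (metis Ints_add add_diff_add)

lift_definition uminus_circle :: "circle \<Rightarrow> circle" is uminus
  by (metis Ints_minus minus_diff_minus)

lift_definition minus_circle :: "circle \<Rightarrow> circle \<Rightarrow> circle" is "(-)"
proof -
  fix a b c d :: real
  assume "a - b \<in> \<int>" "c - d \<in> \<int>"
  then have "(a - b) - (c - d) \<in> \<int>" by (rule Ints_diff)
  then show "(a - c) - (b - d) \<in> \<int>" by (simp add: algebra_simps)
qed

instance by standard (transfer; simp)+

end

text \<open>The metric: distance of \<open>x - y\<close> to the nearest integer.\<close>

lemma infdist_Ints_add_int:
  fixes x n :: real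
  assumes "n \<in> \<int>"
  shows "infdist (x + n) \<int> = infdist x \<int>"
proof -
  have le: "infdist (y + m) \<int> \<le> infdist y \<int>" if "m \<in> \<int>" for y m :: real
  proof -
    have "infdist (y + m) \<int> \<le> dist y a" if "a \<in> \<int>" for a
      using infdist_le[of "a + m" \<int> "y + m"] that \<open>m \<in> \<int>\<close> by (simp add: dist_real_def)
    moreover have "(\<int> :: real set) \<noteq> {}" using Ints_0 by blast
    ultimately show ?thesis by (auto simp: infdist_def[of y] intro!: cINF_greatest)
  qed
  show ?thesis
    using le[OF assms, of x] le[OF Ints_minus[OF assms], of "x + n"] by simp
qed

lemma infdist_Ints_triangle:
  "infdist (x + y) \<int> \<le> infdist x \<int> + infdist (y :: real) \<int>"
proof -
  have "(\<int> :: real set) \<noteq> {}" using Ints_0 by blast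
  then obtain m where m: "m \<in> \<int>" "infdist y \<int> = dist y m"
    using infdist_attains_inf[OF closed_Ints] by blast
  have "infdist (x + y) \<int> \<le> infdist (x + m) \<int> + dist (x + y) (x + m)"
    by (rule infdist_triangle)
  then show ?thesis using m by (simp add: infdist_Ints_add_int)
qed

lemma infdist_Ints_minus: "infdist (- x) \<int> = infdist (x :: real) \<int>"
proof -
  have le: "infdist (- y) \<int> \<le> infdist y \<int>" for y :: real
  proof -
    have "(\<int> :: real set) \<noteq> {}" using Ints_0 by blast
    then obtain m where m: "m \<in> \<int>" "infdist y \<int> = dist y m"
      using infdist_attains_inf[OF closed_Ints] by blast
    then show ?thesis
      using infdist_le[of "- m" \<int> "- y"] by (simp add: dist_minus)
  qed
  show ?thesis using le[of x] le[of "- x"] by simp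
qed

instantiation circle :: metric_space
begin

lift_definition dist_circle :: "circle \<Rightarrow> circle \<Rightarrow> real" is "\<lambda>x y. infdist (x - y) \<int>"
proof -
  fix a b c d :: real
  assume "a - b \<in> \<int>" "c - d \<in> \<int>"
  then have "(a - b) - (c - d) \<in> \<int>" by (rule Ints_diff)
  from infdist_Ints_add_int[OF this, of "b - d"]
  show "infdist (a - c) \<int> = infdist (b - d) \<int>" by (simp add: algebra_simps)
qed

definition uniformity_circle :: "(circle \<times> circle) filter"
  where "uniformity_circle = (INF e\<in>{0<..}. principal {(x, y). dist x y < e})"

definition open_circle :: "circle set \<Rightarrow> bool"
  where "open_circle U \<longleftrightarrow> (\<forall>x\<in>U. \<forall>\<^sub>F (x', y) in uniformity. x' = x \<longrightarrow> y \<in> U)"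

instance
proof
  show "uniformity = (INF e\<in>{0<..}. principal {(x :: circle, y). dist x y < e})"
    by (rule uniformity_circle_def)
  show "open U \<longleftrightarrow> (\<forall>x\<in>U. \<forall>\<^sub>F (x', y) in uniformity. x' = x \<longrightarrow> y \<in> U)" for U :: "circle set"
    by (rule open_circle_def)
  show "dist x y = 0 \<longleftrightarrow> x = y" for x y :: circle
  proof transfer
    have "(\<int> :: real set) \<noteq> {}" using Ints_0 by blast
    then show "(infdist (x - y) \<int> = 0) = (x - y \<in> \<int>)" for x y :: real
      using in_closed_iff_infdist_zero[OF closed_Ints] by blast
  qed
  show "dist x y \<le> dist x z + dist y z" for x y z :: circle
  proof transfer
    fix x y z :: real
    show "infdist (x - y) \<int> \<le> infdist (x - z) \<int> + infdist (y - z) \<int>"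
      using infdist_Ints_triangle[of "x - z" "z - y"] infdist_Ints_minus[of "y - z"] by simp
  qed
qed

end

lemma dist_to_circle_le: "dist (to_circle x) (to_circle y) \<le> dist x y"
  using infdist_le[of 0 \<int> "x - y"] by (simp add: dist_circle.abs_eq dist_real_def)

lemma continuous_on_to_circle: "continuous_on S to_circle"
  unfolding continuous_on_iff using dist_to_circle_le le_less_trans by blast

definition circle_lebesgue :: "circle measure"
  where "circle_lebesgue = distr (restrict_space lborel {0..<1}) borel to_circle"

lemma measurable_to_circle: "to_circle \<in> restrict_space lborel {0..<1} \<rightarrow>\<^sub>M borel"
  by (intro measurable_restrict_space1)
     (simp add: borel_measurable_continuous_onI continuous_on_to_circle)

lemma emeasure_circle_lebesgue_UNIV: "emeasure circle_lebesgue UNIV = 1"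
  unfolding circle_lebesgue_def
  by (subst emeasure_distr[OF measurable_to_circle])
     (auto simp: space_restrict_space emeasure_restrict_space)


section \<open>Hausdorff dimension\<close>

text \<open>The gauge \<open>diam(U)\<^sup>s\<close>, with the usual conventions that the empty set contributes \<open>0\<close> and that
  every nonempty set contributes \<open>1\<close> if \<open>s = 0\<close> (note that \<open>0 powr 0 = 0\<close>).\<close>

definition hausdorff_gauge :: "real \<Rightarrow> 'a::metric_space set \<Rightarrow> ennreal"
  where "hausdorff_gauge s U =
    (if U = {} then 0 else if s = 0 then 1 else ennreal (diameter U powr s))"

text \<open>Boundedness is required explicitly because \<^term>\<open>diameter\<close> is real-valued and carries no
  information on unbounded sets.\<close>

definition hausdorff_premeasure :: "real \<Rightarrow> real \<Rightarrow> 'a::metric_space set \<Rightarrow> ennreal"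
  where "hausdorff_premeasure s \<delta> S =
    Inf {(\<Sum>n. hausdorff_gauge s (U n)) | U :: nat \<Rightarrow> 'a set.
      S \<subseteq> (\<Union>n. U n) \<and> (\<forall>n. bounded (U n) \<and> diameter (U n) \<le> \<delta>)}"

definition hausdorff_measure :: "real \<Rightarrow> 'a::metric_space set \<Rightarrow> ennreal"
  where "hausdorff_measure s S = (SUP \<delta>\<in>{0<..}. hausdorff_premeasure s \<delta> S)"

definition hausdorff_dim :: "'a::metric_space set \<Rightarrow> ereal"
  where "hausdorff_dim S = (INF s\<in>{s. 0 \<le> s \<and> hausdorff_measure s S = 0}. ereal s)"


section \<open>Digit sets and their matrices\<close>

definition digit_set :: "int \<Rightarrow> int set \<Rightarrow> circle set"
  where "digit_set b D =
    {to_circle (\<Sum>n. real_of_int (d (Suc n)) / real_of_int b ^ Suc n) | d :: nat \<Rightarrow> int.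
      \<forall>n\<ge>1. d n \<in> D}"

definition digit_count :: "int \<Rightarrow> int set \<Rightarrow> int set \<Rightarrow> int \<Rightarrow> int \<Rightarrow> int \<Rightarrow> nat"
  where "digit_count b D1 D2 i j k =
    card ((\<lambda>d. d + i + j) ` D1 \<inter> (\<lambda>d. d + k * b) ` D2)"

text \<open>Rows and columns are numbered \<open>0, 1\<close> in the mathematical convention, whereas the two elements
  of the index type \<^typ>\<open>2\<close> are used as first and second index.\<close>

definition digit_matrix :: "int \<Rightarrow> int set \<Rightarrow> int set \<Rightarrow> int \<Rightarrow> real^2^2"
  where "digit_matrix b D1 D2 i = vector
    [vector [real (digit_count b D1 D2 i 0 0), real (digit_count b D1 D2 i 0 1)],
     vector [real (digit_count b D1 D2 i 1 0), real (digit_count b D1 D2 i 1 1)]]"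

definition degenerate :: "int \<Rightarrow> int set \<Rightarrow> int set \<Rightarrow> bool"
  where "degenerate b D1 D2 \<longleftrightarrow> (\<exists>i\<in>{0..b-1}. \<not> invertible (digit_matrix b D1 D2 i))"

definition positive_matrix :: "real^2^2 \<Rightarrow> bool"
  where "positive_matrix M \<longleftrightarrow> (\<forall>j k. M $ j $ k > 0)"

definition F_map :: "real^2^2 \<Rightarrow> real^2^2"
  where "F_map M =
    (let p = M $ 1 $ 1; q = M $ 1 $ 2; r = M $ 2 $ 1; s = M $ 2 $ 2
     in (1/2) *\<^sub>R vector [vector [p - q - r + s, p + q - r - s],
                       vector [p - q + r - s, p + q + r + s]])"


section \<open>Moebius transformations of the Riemann sphere\<close>

datatype riemann_sphere = Fin complex | Infty

definition extended_reals :: "riemann_sphere set"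
  where "extended_reals = insert Infty (Fin ` \<real>)"

text \<open>The action of the class of an invertible matrix; it only depends on the matrix up to a nonzero
  scalar, so elements of the projective group are given by representatives. In particular the
  transpose of the class of \<open>M\<close> is \<open>mobius (transpose M)\<close>.\<close>

fun mobius :: "real^2^2 \<Rightarrow> riemann_sphere \<Rightarrow> riemann_sphere" where
  "mobius M (Fin z) =
    (let num = of_real (M $ 1 $ 1) * z + of_real (M $ 1 $ 2);
         den = of_real (M $ 2 $ 1) * z + of_real (M $ 2 $ 2)
     in if den = 0 then Infty else Fin (num / den))"
| "mobius M Infty =
    (if M $ 2 $ 1 = 0 then Infty else Fin (of_real (M $ 1 $ 1) / of_real (M $ 2 $ 1)))"

fun sphere_inverse :: "riemann_sphere \<Rightarrow> riemann_sphere" where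
  "sphere_inverse (Fin z) = (if z = 0 then Infty else Fin (1 / z))"
| "sphere_inverse Infty = Fin 0"

text \<open>The affine coordinate; the value at infinity is irrelevant.\<close>

fun coord :: "riemann_sphere \<Rightarrow> complex" where
  "coord (Fin z) = z"
| "coord Infty = 0"

text \<open>\<open>sphere_deriv f a\<close> is the derivative of \<open>f\<close> at \<open>a\<close>; it is meaningful if \<open>a\<close> and \<open>f a\<close> are
  both finite, or both infinite. In the latter case it is the derivative of \<open>1 / f (1 / z)\<close> at
  \<open>z = 0\<close>, where the reciprocals are those of the sphere.\<close>

fun sphere_deriv :: "(riemann_sphere \<Rightarrow> riemann_sphere) \<Rightarrow> riemann_sphere \<Rightarrow> complex" where
  "sphere_deriv f (Fin a) = deriv (\<lambda>z. coord (f (Fin z))) a"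
| "sphere_deriv f Infty = deriv (\<lambda>z. coord (sphere_inverse (f (sphere_inverse (Fin z))))) 0"


section \<open>Generalized heteroclinic connections of depth 2\<close>

definition words2 ::
    "'i set \<Rightarrow> ('i \<Rightarrow> riemann_sphere \<Rightarrow> riemann_sphere) \<Rightarrow> (riemann_sphere \<Rightarrow> riemann_sphere) set"
  where "words2 I f = {f i | i. i \<in> I} \<union> {f i \<circ> f j | i j. i \<in> I \<and> j \<in> I}"

definition Attr2 :: "'i set \<Rightarrow> ('i \<Rightarrow> riemann_sphere \<Rightarrow> riemann_sphere) \<Rightarrow> riemann_sphere set"
  where "Attr2 I f =
    {a \<in> extended_reals. \<exists>g\<in>words2 I f. g a = a \<and> norm (sphere_deriv g a) \<le> 1}"

definition Rep2 :: "'i set \<Rightarrow> ('i \<Rightarrow> riemann_sphere \<Rightarrow> riemann_sphere) \<Rightarrow> riemann_sphere set"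
  where "Rep2 I f =
    {a \<in> extended_reals. \<exists>g\<in>words2 I f. g a = a \<and> norm (sphere_deriv g a) \<ge> 1}"

definition heteroclinic_connection2 ::
    "'i set \<Rightarrow> ('i \<Rightarrow> riemann_sphere \<Rightarrow> riemann_sphere) \<Rightarrow> bool"
  where "heteroclinic_connection2 I f \<longleftrightarrow>
    (\<exists>h\<in>insert id (words2 I f). \<exists>a\<in>Attr2 I f. h a \<in> Rep2 I f)"


section \<open>The infinite matrix and vector of a positive family\<close>

definition g_zero :: "real^2^2 \<Rightarrow> complex"
  where "g_zero B = coord (mobius (F_map B) (Fin 0))"

definition gT_zero :: "real^2^2 \<Rightarrow> complex"
  where "gT_zero B = coord (mobius (transpose (F_map B)) (Fin 0))"

definition g_deriv_zero :: "real^2^2 \<Rightarrow> complex"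
  where "g_deriv_zero B = sphere_deriv (mobius (F_map B)) (Fin 0)"

definition v_seq :: "complex \<Rightarrow> complex \<Rightarrow> nat \<Rightarrow> complex"
  where "v_seq x c n = (if n = 0 then c else - ((- x) ^ n / of_nat n))"

definition v_vec :: "'i set \<Rightarrow> ('i \<Rightarrow> real) \<Rightarrow> ('i \<Rightarrow> real^2^2) \<Rightarrow> nat \<Rightarrow> complex"
  where "v_vec I w B n =
    (\<Sum>i\<in>I. of_real (w i) *
      v_seq (g_zero (B i)) (1/2 * ln (of_real (det (F_map (B i))) / g_deriv_zero (B i))) n)"

definition T_coeff :: "'i set \<Rightarrow> ('i \<Rightarrow> real) \<Rightarrow> ('i \<Rightarrow> real^2^2) \<Rightarrow> nat \<Rightarrow> nat \<Rightarrow> complex"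
  where "T_coeff I w B k n =
    (if n = 0 then 0
     else if k = 0 then (\<Sum>i\<in>I. of_real (w i) * gT_zero (B i) ^ n)
     else (\<Sum>i\<in>I. of_real (w i) * (\<Sum>l=1..min k n.
            of_nat (n choose l) * of_nat ((k - 1) choose (l - 1)) *
            gT_zero (B i) ^ (n - l) * (- g_zero (B i)) ^ (k - l) * g_deriv_zero (B i) ^ l)))"

definition T_op ::
    "'i set \<Rightarrow> ('i \<Rightarrow> real) \<Rightarrow> ('i \<Rightarrow> real^2^2) \<Rightarrow> (nat \<Rightarrow> complex) \<Rightarrow> (nat \<Rightarrow> complex)"
  where "T_op I w B u k = (\<Sum>n. T_coeff I w B k n * u n)"

end

theory Submission
  imports Defs
begin

text \<open>In the non-degenerate case all the matrices \<open>A\<^sub>i\<close> map the cone \<open>1/3 < y/x < 3\<close> into itself, so one linear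
  change of coordinates makes them positive. Attracting fixed points of words then lie in the invariant
  interval and repelling ones outside, so there is no heteroclinic connection. Counting pairs of
  prefixes that agree up to a carry shows that, up to a bounded factor, the number of cylinders of level
  \<open>n\<close> meeting \<open>(K\<^sub>1 + t) \<inter> K\<^sub>2\<close> is the norm of the matrix product along the first \<open>n\<close> digits of \<open>t\<close>. These
  counts are almost multiplicative by positivity, which gives the lower bound for the dimension without
  constructing a measure. Since \<open>T\<close> is the transfer operator of the Moebius maps up to constants and
  transposition, the partial sums of \<open>(T\<^sup>n v)\<^sub>0\<close> are the mean increments of the logarithm of that norm;
  they converge to the Lyapunov exponent because the Moebius maps contract the Poincare metric, and
  an exponential moment bound with Borel-Cantelli makes the Lyapunov exponent the almost sure growth rate.\<close>

section \<open>Counting digits\<close>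

text \<open>The digit matrices are not all positive in the given coordinates: the upper right entry
  vanishes for \<open>i = 0\<close> and the lower left one for \<open>i = b - 1\<close>. A cone is
  nevertheless preserved, because for a reflected pair each row has sum at least
  \<open>b - 2 \<ge> 3\<close> while corresponding entries of the two rows differ by at most two.
  The slopes 1/3 and 3 are wide enough for every \<open>b \<ge> 5\<close>, so one basis serves all
  parameters. Two obstacles stand between counting prefixes and the dimension. A matching prefix
  might have no continuation, and carries blur the correspondence between prefixes and points.
  Non-singularity removes the first, since a carry that could not be produced would give a vanishing
  column. Irrationality of \<open>t\<close>, at the price of a null set, keeps every carry in {0,
  1}; what ambiguity is left costs bounded factors. The cone also forces the two row sums of every
  product to be comparable, which makes the constants of near-multiplicativity independent of the
  level.\<close>

lemma card_Icc_minus_pair: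
  fixes l h x y :: int
  assumes "l \<le> h + 1"
  shows "int (card ({l..h} - {x, y})) =
    h - l + 1 - of_bool (x \<in> {l..h}) - of_bool (y \<in> {l..h}) + of_bool (x = y \<and> x \<in> {l..h})"
proof -
  have "int (card ({l..h} - {x, y})) = int (card {l..h}) - int (card ({l..h} \<inter> {x, y}))"
    by (subst card_Diff_subset_Int) (auto intro!: of_nat_diff card_mono simp del: card_atLeastAtMost_int)
  moreover have "int (card ({l..h} \<inter> {x, y})) =
    of_bool (x \<in> {l..h}) + of_bool (y \<in> {l..h}) - of_bool (x = y \<and> x \<in> {l..h})"
    by (cases "x \<in> {l..h}"; cases "y \<in> {l..h}"; cases "x = y")
      (simp_all only: Int_insert_right if_True if_False Int_empty_right card.empty, auto)
  ultimately show ?thesis using assms by simp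
qed

text \<open>With \<open>m = i + j\<close> the entries depend on \<open>i\<close> and
  \<open>j\<close> only through \<open>m\<close>, so the second row of one matrix is the first row
  of the next. The window {m..b-1} has \<open>b - m\<close> digits; two indicators remove the
  omitted digits that fall into it, and the last one repairs the double removal when they coincide.
  \<open>high_count\<close> does the same for the part that overflows past \<open>b\<close>.\<close>

definition low_count :: "int \<Rightarrow> int \<Rightarrow> int \<Rightarrow> int \<Rightarrow> int"
  where "low_count b \<tau> u m =
    b - m - of_bool (\<tau> + m \<le> b - 1) - of_bool (m \<le> u) + of_bool (\<tau> + m = u)"

definition high_count :: "int \<Rightarrow> int \<Rightarrow> int \<Rightarrow> int \<Rightarrow> int"
  where "high_count b \<tau> u m =
    m - of_bool (b \<le> \<tau> + m) - of_bool (u < m) + of_bool (\<tau> + m = u + b)"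

lemma image_add_Diff_singleton:
  "(\<lambda>d. d + c) ` ({l..h} - {x}) = {l + c..h + c} - {x + c}" for c :: int
  by (simp add: inj_on_def image_set_diff image_add_atLeastAtMost')

lemma digit_count_low:
  assumes "0 \<le> i + j" "i + j \<le> b" "\<tau> \<in> {0..b-1}" "u \<in> {0..b-1}"
  shows "int (digit_count b ({0..b-1} - {\<tau>}) ({0..b-1} - {u}) i j 0) = low_count b \<tau> u (i + j)"
proof -
  have "(\<lambda>d. d + i + j) ` ({0..b-1} - {\<tau>}) \<inter> (\<lambda>d. d + 0 * b) ` ({0..b-1} - {u}) =
    {i + j..b - 1} - {\<tau> + (i + j), u}"
    using assms unfolding add.assoc image_add_Diff_singleton by auto
  then show ?thesis
    using assms by (simp add: digit_count_def low_count_def card_Icc_minus_pair)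
qed

lemma digit_count_high:
  assumes "0 \<le> i + j" "i + j \<le> b" "\<tau> \<in> {0..b-1}" "u \<in> {0..b-1}"
  shows "int (digit_count b ({0..b-1} - {\<tau>}) ({0..b-1} - {u}) i j 1) = high_count b \<tau> u (i + j)"
proof -
  have "(\<lambda>d. d + i + j) ` ({0..b-1} - {\<tau>}) \<inter> (\<lambda>d. d + 1 * b) ` ({0..b-1} - {u}) =
    {b..i + j + b - 1} - {\<tau> + (i + j), u + b}"
    using assms unfolding add.assoc image_add_Diff_singleton by auto
  then show ?thesis
    using assms by (simp add: digit_count_def high_count_def card_Icc_minus_pair)
qed

lemma digit_matrix_nth:
  "digit_matrix b D1 D2 i $ 1 $ 1 = real (digit_count b D1 D2 i 0 0)"
  "digit_matrix b D1 D2 i $ 1 $ 2 = real (digit_count b D1 D2 i 0 1)"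
  "digit_matrix b D1 D2 i $ 2 $ 1 = real (digit_count b D1 D2 i 1 0)"
  "digit_matrix b D1 D2 i $ 2 $ 2 = real (digit_count b D1 D2 i 1 1)"
  by (simp_all add: digit_matrix_def)

lemma digit_matrix_counts:
  assumes "i \<in> {0..b-1}" "\<tau> \<in> {0..b-1}" "u \<in> {0..b-1}"
  shows "digit_matrix b ({0..b-1} - {\<tau>}) ({0..b-1} - {u}) i =
    vector [vector [of_int (low_count b \<tau> u i), of_int (high_count b \<tau> u i)],
            vector [of_int (low_count b \<tau> u (i + 1)), of_int (high_count b \<tau> u (i + 1))]]"
proof -
  have eq: "real n = of_int k" if "int n = k" for n k
    using that by auto
  have bd: "0 \<le> i + 0" "i + 0 \<le> b" "0 \<le> i + 1" "i + 1 \<le> b"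
    using assms by auto
  show ?thesis
    unfolding digit_matrix_def
    using digit_count_low[OF bd(1,2) assms(2,3), THEN eq] digit_count_low[OF bd(3,4) assms(2,3), THEN eq]
      digit_count_high[OF bd(1,2) assms(2,3), THEN eq] digit_count_high[OF bd(3,4) assms(2,3), THEN eq]
    by simp
qed

section \<open>Singular and non-singular digit matrices, and the invariant cone\<close>

lemma invertible_digit_matrix_iff:
  assumes "i \<in> {0..b-1}" "\<tau> \<in> {0..b-1}" "u \<in> {0..b-1}"
  shows "invertible (digit_matrix b ({0..b-1} - {\<tau>}) ({0..b-1} - {u}) i) \<longleftrightarrow>
    low_count b \<tau> u i * high_count b \<tau> u (i + 1) \<noteq> high_count b \<tau> u i * low_count b \<tau> u (i + 1)"
proof -
  have "det (digit_matrix b ({0..b-1} - {\<tau>}) ({0..b-1} - {u}) i) =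
    of_int (low_count b \<tau> u i * high_count b \<tau> u (i + 1) - high_count b \<tau> u i * low_count b \<tau> u (i + 1))"
    unfolding digit_matrix_counts[OF assms] by (simp add: det_2)
  then show ?thesis
    by (simp only: invertible_det_nz of_int_eq_0_iff) simp
qed

text \<open>Put \<open>x = b - 1 - \<tau>\<close>. Up to the coincidence terms, a step from row
  \<open>m\<close> to row \<open>m + 1\<close> moves one unit from the low to the high count, but an
  omission cancels this move at \<open>m = x\<close> and at \<open>m = u\<close>. If
  \<open>x \<noteq> u\<close> and one of them is not an end digit, then the matrix indexed by the
  other has equal rows. In the remaining cases both are end digits, and a column vanishes at
  \<open>i = 0\<close> or at \<open>i = b - 1\<close>.\<close>

lemma singular_digit_matrix_if:
  fixes b \<tau> u :: int
  assumes "b \<ge> 5" "\<tau> \<in> {0..b-1}" "u \<in> {0..b-1}"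
    and "\<not> ({\<tau>, u} \<inter> {0, b-1} = {} \<and> \<tau> + u = b - 1)"
  shows "\<exists>i\<in>{0..b-1}. low_count b \<tau> u i * high_count b \<tau> u (i + 1) =
    high_count b \<tau> u i * low_count b \<tau> u (i + 1)"
proof -
  define x where "x = b - 1 - \<tau>"
  have x: "0 \<le> x" "x \<le> b - 1" "\<tau> = b - 1 - x" using assms by (auto simp: x_def)
  have u: "0 \<le> u" "u \<le> b - 1" using assms by auto
  consider "x \<noteq> u" "u \<noteq> 0" "u \<noteq> b - 1" | "x \<noteq> u" "x \<noteq> 0" "x \<noteq> b - 1"
    | "u = 0" "x = b - 1" | "u = b - 1" "x = 0" | "u = 0" "x = 0" | "u = b - 1" "x = b - 1"
    using assms x(3) by auto
  then show ?thesis
  proof cases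
    case 1
    then have "low_count b \<tau> u x = low_count b \<tau> u (x + 1)" "high_count b \<tau> u x = high_count b \<tau> u (x + 1)"
      using u x assms(1) by (simp_all add: low_count_def high_count_def)
    then show ?thesis using x by (intro bexI[of _ x]) auto
  next
    case 2
    then have "low_count b \<tau> u u = low_count b \<tau> u (u + 1)" "high_count b \<tau> u u = high_count b \<tau> u (u + 1)"
      using u x assms(1) by (simp_all add: low_count_def high_count_def)
    then show ?thesis using u by (intro bexI[of _ u]) auto
  next
    case 3
    then show ?thesis using x assms(1)
      by (intro bexI[of _ 0]) (simp_all add: low_count_def high_count_def)
  next
    case 4
    then show ?thesis using x assms(1)
      by (intro bexI[of _ 0]) (simp_all add: low_count_def high_count_def)
  next
    case 5
    then show ?thesis using x assms(1)
      by (intro bexI[of _ 0]) (simp_all add: low_count_def high_count_def)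
  next
    case 6
    then show ?thesis using x assms(1)
      by (intro bexI[of _ "b - 1"]) (simp_all add: low_count_def high_count_def)
  qed
qed

lemma counts_reflected:
  fixes b u m :: int
  assumes "0 \<le> m" "m \<le> b"
  shows "low_count b (b - 1 - u) u m = b - m - 2 * of_bool (m \<le> u) + of_bool (m = 2 * u - b + 1)"
    and "high_count b (b - 1 - u) u m = m - 2 * of_bool (u < m) + of_bool (m = 2 * u + 1)"
  by (auto simp: low_count_def high_count_def)

text \<open>Row \<open>m\<close> has sum \<open>b - 2 + e m\<close>, so the determinant is this row
  sum times the increment \<open>d\<close> of the high count, plus a correction from
  \<open>e\<close>. When the omissions coincide they cancel the unit move twice, which turns it into
  \<open>d = -1\<close> at \<open>i = u\<close> instead of 0. The bounds on \<open>u\<close> keep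
  \<open>u\<close> apart from \<open>2 * u\<close> and \<open>2 * u - b + 1\<close>.\<close>

lemma nonsingular_counts_reflected:
  fixes b u i :: int
  assumes "b \<ge> 5" "1 \<le> u" "u \<le> b - 2" "0 \<le> i" "i \<le> b - 1"
  shows "low_count b (b - 1 - u) u i * high_count b (b - 1 - u) u (i + 1) \<noteq>
    high_count b (b - 1 - u) u i * low_count b (b - 1 - u) u (i + 1)"
proof -
  let ?a = "low_count b (b - 1 - u) u" and ?c = "high_count b (b - 1 - u) u"
  define e where "e = (\<lambda>m. of_bool (m = 2 * u - b + 1) + of_bool (m = 2 * u + 1) :: int)"
  have a: "?a m = b - 2 + e m - ?c m" if "0 \<le> m" "m \<le> b" for m
    using that by (auto simp: counts_reflected e_def)
  have c: "?c m = m - 2 * of_bool (u < m) + of_bool (m = 2 * u + 1)" if "0 \<le> m" "m \<le> b" for m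
    using that by (rule counts_reflected)
  define d where "d = ?c (i + 1) - ?c i"
  have d: "d = 1 - 2 * of_bool (i = u) + of_bool (i = 2 * u) - of_bool (i = 2 * u + 1)"
    using assms by (auto simp: d_def c)
  have "?a i = b - 2 + e i - ?c i" "?a (i + 1) = b - 2 + e (i + 1) - ?c (i + 1)"
    using assms a by auto
  then have eq: "?a i * ?c (i + 1) - ?c i * ?a (i + 1) = (b - 2 + e i) * d + (e i - e (i + 1)) * ?c i"
    unfolding d_def by algebra
  consider "i = u" | "i \<noteq> u" "i = 2 * u" | "i \<noteq> u" "i = 2 * u + 1" | "i \<noteq> u" "i = 2 * u - b + 1"
    | "i \<noteq> u" "i = 2 * u - b"
    | "i \<notin> {u, 2 * u, 2 * u + 1, 2 * u - b + 1, 2 * u - b}" by blast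
  then have "(b - 2 + e i) * d + (e i - e (i + 1)) * ?c i \<noteq> 0"
    by cases (use assms in \<open>simp_all add: d e_def c\<close>)
  then show ?thesis using eq by linarith
qed

text \<open>The four quantities are 8 times the entries of \<open>cone_conj\<close> of the digit
  matrix. They express that the edges (3, 1) and (1, 3) of the cone are mapped into its
  interior.\<close>

lemma cone_counts_reflected:
  fixes b u i :: int
  assumes "b \<ge> 5" "1 \<le> u" "u \<le> b - 2" "0 \<le> i" "i \<le> b - 1"
  defines "a \<equiv> low_count b (b - 1 - u) u i" and "c \<equiv> high_count b (b - 1 - u) u i"
    and "a' \<equiv> low_count b (b - 1 - u) u (i + 1)" and "c' \<equiv> high_count b (b - 1 - u) u (i + 1)"
  shows "9 * a + 3 * c - 3 * a' - c' > 0" "9 * a' + 3 * c' - 3 * a - c > 0"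
    "3 * a + 9 * c - a' - 3 * c' > 0" "3 * a' + 9 * c' - a - 3 * c > 0"
proof -
  have "a = b - i - 2 * (if i \<le> u then 1 else 0) + (if i = 2 * u - b + 1 then 1 else 0)"
    "c = i - 2 * (if u < i then 1 else 0) + (if i = 2 * u + 1 then 1 else 0)"
    "a' = b - (i + 1) - 2 * (if i + 1 \<le> u then 1 else 0) + (if i + 1 = 2 * u - b + 1 then 1 else 0)"
    "c' = i + 1 - 2 * (if u < i + 1 then 1 else 0) + (if i + 1 = 2 * u + 1 then 1 else 0)"
    unfolding a_def c_def a'_def c'_def
    using assms(4,5) counts_reflected[of i b u] counts_reflected[of "i + 1" b u] by (simp_all only: of_bool_def)
  then show "9 * a + 3 * c - 3 * a' - c' > 0" "9 * a' + 3 * c' - 3 * a - c > 0"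
    "3 * a + 9 * c - a' - 3 * c' > 0" "3 * a' + 9 * c' - a - 3 * c > 0"
    using assms(1-5) by smt+
qed

section \<open>Fixed points of words of Moebius maps\<close>

text \<open>Homogeneous coordinates: Moebius maps become linear and infinity needs no separate
  treatment. The pair (0, 0) represents no point and is excluded by a hypothesis wherever it
  matters.\<close>

definition sphere_point :: "complex \<Rightarrow> complex \<Rightarrow> riemann_sphere"
  where "sphere_point x y = (if y = 0 then Infty else Fin (x / y))"

lemma sphere_point_cases:
  obtains x y where "a = sphere_point x y" "x \<noteq> 0 \<or> y \<noteq> 0"
proof (cases a)
  case (Fin z)
  then show ?thesis using that[of z 1] by (simp add: sphere_point_def)
next
  case Infty
  then show ?thesis using that[of 1 0] by (simp add: sphere_point_def)
qed

lemma extended_reals_cases: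
  assumes "a \<in> extended_reals"
  obtains x y :: real where "a = sphere_point (of_real x) (of_real y)" "x \<noteq> 0 \<or> y \<noteq> 0"
proof (cases a)
  case (Fin z)
  then obtain x where "z = of_real x"
    using assms by (auto simp: extended_reals_def elim: Reals_cases)
  then show ?thesis using that[of x 1] Fin by (simp add: sphere_point_def)
next
  case Infty
  then show ?thesis using that[of 1 0] by (simp add: sphere_point_def)
qed

lemma mobius_sphere_point:
  assumes "x \<noteq> 0 \<or> y \<noteq> 0"
  shows "mobius M (sphere_point x y) =
    sphere_point (of_real (M $ 1 $ 1) * x + of_real (M $ 1 $ 2) * y)
      (of_real (M $ 2 $ 1) * x + of_real (M $ 2 $ 2) * y)"
proof (cases "y = 0")
  case False
  then have "of_real c * (x / y) + of_real d = (of_real c * x + of_real d * y) / y" for c d :: real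
    by (simp add: field_simps)
  with False show ?thesis by (simp add: sphere_point_def)
qed (use assms in \<open>auto simp: sphere_point_def\<close>)

lemma matrix_mult_2_nth:
  fixes M N :: "real^2^2"
  shows "(M ** N) $ i $ j = M $ i $ 1 * N $ 1 $ j + M $ i $ 2 * N $ 2 $ j"
  by (simp add: matrix_matrix_mult_def sum_2)

text \<open>The condition on \<open>det N\<close> ensures that the intermediate homogeneous
  coordinates are not (0, 0); otherwise elimination would give \<open>det N * x = 0\<close> and
  \<open>det N * y = 0\<close>.\<close>

lemma mobius_compose:
  assumes "det N \<noteq> 0"
  shows "mobius M \<circ> mobius N = mobius (M ** N)"
proof
  fix a
  obtain x y where a: "a = sphere_point x y" "x \<noteq> 0 \<or> y \<noteq> 0"
    by (rule sphere_point_cases)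
  let ?x = "of_real (N $ 1 $ 1) * x + of_real (N $ 1 $ 2) * y"
  let ?y = "of_real (N $ 2 $ 1) * x + of_real (N $ 2 $ 2) * y"
  have "?x \<noteq> 0 \<or> ?y \<noteq> 0"
  proof (rule ccontr)
    assume "\<not> ?thesis"
    then have "of_real (N $ 2 $ 2) * ?x - of_real (N $ 1 $ 2) * ?y = 0"
      "of_real (N $ 1 $ 1) * ?y - of_real (N $ 2 $ 1) * ?x = 0" by simp_all
    then have "of_real (det N) * x = 0" "of_real (det N) * y = 0"
      by (simp_all add: det_2 algebra_simps)
    then show False using a(2) assms by auto
  qed
  note pt = mobius_sphere_point[OF this, of M]
  show "(mobius M \<circ> mobius N) a = mobius (M ** N) a"
    unfolding a(1) o_apply mobius_sphere_point[OF a(2)] pt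
    by (simp add: matrix_mult_2_nth algebra_simps)
qed

lemma mobius_has_field_derivative:
  fixes M :: "real^2^2" and c :: complex
  defines "den \<equiv> \<lambda>z. of_real (M $ 2 $ 1) * z + of_real (M $ 2 $ 2)"
  assumes nz: "den c \<noteq> 0"
  shows "((\<lambda>z. coord (mobius M (Fin z))) has_field_derivative of_real (det M) / (den c)\<^sup>2) (at c)"
proof -
  have "((\<lambda>z. (of_real (M $ 1 $ 1) * z + of_real (M $ 1 $ 2)) / den z)
      has_field_derivative of_real (det M) / (den c)\<^sup>2) (at c)"
    using nz unfolding den_def
    by (auto intro!: derivative_eq_intros simp: det_2 power2_eq_square algebra_simps)
  moreover have "\<forall>\<^sub>F z in nhds c. den z \<noteq> 0"
  proof (rule tendsto_imp_eventually_ne)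
    show "(den \<longlongrightarrow> den c) (nhds c)"
      unfolding den_def by (intro tendsto_intros filterlim_ident)
  qed (rule nz)
  then have "\<forall>\<^sub>F z in nhds c. coord (mobius M (Fin z)) = (of_real (M $ 1 $ 1) * z + of_real (M $ 1 $ 2)) / den z"
    by eventually_elim (simp add: den_def)
  ultimately show ?thesis
    by (subst DERIV_cong_ev[OF refl _ refl])
qed

text \<open>Homogeneous coordinates of a fixed point form an eigenvector. In the finite chart as
  well as in the chart at infinity, the derivative is the other eigenvalue divided by
  \<open>\<mu>\<close>, that is \<open>det M / \<mu>\<^sup>2\<close>.\<close>

lemma mobius_fixed_point:
  fixes M :: "real^2^2" and x y :: real
  assumes "x \<noteq> 0 \<or> y \<noteq> 0" "det M \<noteq> 0"
    and fixed: "mobius M (sphere_point (of_real x) (of_real y)) = sphere_point (of_real x) (of_real y)"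
  obtains \<mu> where "\<mu> \<noteq> 0" "M $ 1 $ 1 * x + M $ 1 $ 2 * y = \<mu> * x" "M $ 2 $ 1 * x + M $ 2 $ 2 * y = \<mu> * y"
    "sphere_deriv (mobius M) (sphere_point (of_real x) (of_real y)) = of_real (det M / \<mu>\<^sup>2)"
proof (cases "y = 0")
  case True
  then have x: "x \<noteq> 0" using assms(1) by simp
  let ?\<alpha> = "M $ 1 $ 1" and ?\<beta> = "M $ 1 $ 2" and ?\<delta> = "M $ 2 $ 2"
  have \<gamma>: "M $ 2 $ 1 = 0" using fixed True by (simp add: sphere_point_def split: if_splits)
  then have nz: "?\<alpha> \<noteq> 0" "?\<delta> \<noteq> 0" using assms(2) by (auto simp: det_2)
  let ?f = "\<lambda>z. coord (sphere_inverse (mobius M (sphere_inverse (Fin z))))"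
  have "((\<lambda>z. of_real ?\<delta> * z / (of_real ?\<alpha> + of_real ?\<beta> * z)) has_field_derivative of_real (?\<delta> / ?\<alpha>)) (at 0)"
    using nz by (auto intro!: derivative_eq_intros)
  moreover have "\<forall>\<^sub>F z in nhds 0. of_real ?\<alpha> + of_real ?\<beta> * z \<noteq> (0 :: complex)"
  proof (rule tendsto_imp_eventually_ne)
    show "((\<lambda>z. of_real ?\<alpha> + of_real ?\<beta> * z) \<longlongrightarrow> (of_real ?\<alpha> + of_real ?\<beta> * 0 :: complex)) (nhds 0)"
      by (intro tendsto_intros filterlim_ident)
  qed (use nz in simp)
  then have "\<forall>\<^sub>F z in nhds 0. ?f z = of_real ?\<delta> * z / (of_real ?\<alpha> + of_real ?\<beta> * z)"
  proof eventually_elim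
    case (elim z)
    have "of_real ?\<alpha> / z + of_real ?\<beta> = (of_real ?\<alpha> + of_real ?\<beta> * z) / z" if "z \<noteq> 0"
      using that by (simp add: field_simps)
    then show ?case using elim nz \<gamma> by (cases "z = 0") simp_all
  qed
  ultimately have "(?f has_field_derivative of_real (?\<delta> / ?\<alpha>)) (at 0)"
    by (subst DERIV_cong_ev[OF refl _ refl])
  then have "deriv ?f 0 = of_real (?\<delta> / ?\<alpha>)"
    by (rule DERIV_imp_deriv)
  then have "sphere_deriv (mobius M) (sphere_point (of_real x) (of_real y)) = of_real (det M / ?\<alpha>\<^sup>2)"
    using True nz \<gamma> by (simp add: sphere_point_def det_2 power2_eq_square)
  then show ?thesis using that[of ?\<alpha>] True \<gamma> nz by simp
next
  case False
  let ?\<alpha> = "M $ 1 $ 1" and ?\<beta> = "M $ 1 $ 2" and ?\<gamma> = "M $ 2 $ 1" and ?\<delta> = "M $ 2 $ 2"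
  define c where "c = x / y"
  define \<mu> where "\<mu> = ?\<gamma> * c + ?\<delta>"
  have pt: "sphere_point (of_real x) (of_real y) = Fin (of_real c)"
    using False by (simp add: sphere_point_def c_def)
  have den: "of_real ?\<gamma> * of_real c + of_real ?\<delta> = (of_real \<mu> :: complex)"
    by (simp add: \<mu>_def)
  have "mobius M (Fin (of_real c)) = Fin (of_real c)" using fixed pt by simp
  then have \<mu>: "\<mu> \<noteq> 0" and "(of_real ?\<alpha> * of_real c + of_real ?\<beta>) / of_real \<mu> = (of_real c :: complex)"
    using den by (auto simp: Let_def split: if_splits)
  then have "of_real (?\<alpha> * c + ?\<beta>) = (of_real (\<mu> * c) :: complex)"
    by (simp add: field_simps)
  then have num: "?\<alpha> * c + ?\<beta> = \<mu> * c" by (simp only: of_real_eq_iff)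
  let ?f = "\<lambda>z. coord (mobius M (Fin z))"
  have "(?f has_field_derivative of_real (det M / \<mu>\<^sup>2)) (at (of_real c))"
    using mobius_has_field_derivative[of M "of_real c"] \<mu> unfolding den by simp
  then have "deriv ?f (of_real c) = of_real (det M / \<mu>\<^sup>2)"
    by (rule DERIV_imp_deriv)
  moreover have "?\<alpha> * x + ?\<beta> * y = \<mu> * x" "?\<gamma> * x + ?\<delta> * y = \<mu> * y"
  proof -
    have cy: "c * y = x" using False by (simp add: c_def)
    have "?\<alpha> * x + ?\<beta> * y = (?\<alpha> * c + ?\<beta>) * y" by (simp add: algebra_simps flip: cy)
    then show "?\<alpha> * x + ?\<beta> * y = \<mu> * x" by (simp add: num cy mult.assoc)
    show "?\<gamma> * x + ?\<delta> * y = \<mu> * y" by (simp add: \<mu>_def algebra_simps flip: cy)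
  qed
  ultimately show ?thesis using that[of \<mu>] \<mu> pt by simp
qed

text \<open>The other eigenvalue is \<open>det B / \<mu>\<close>, so this tells the dominant from the other eigenvector.\<close>

lemma positive_eigenvector:
  fixes B :: "real^2^2"
  assumes "positive_matrix B" "x \<noteq> 0 \<or> y \<noteq> 0"
    and e1: "B $ 1 $ 1 * x + B $ 1 $ 2 * y = \<mu> * x" and e2: "B $ 2 $ 1 * x + B $ 2 $ 2 * y = \<mu> * y"
  shows "x * y > 0 \<Longrightarrow> \<bar>det B\<bar> < \<mu>\<^sup>2" and "x * y \<le> 0 \<Longrightarrow> \<mu>\<^sup>2 < \<bar>det B\<bar> \<or> \<mu> = 0"
proof -
  define p q r s where pqrs: "p = B $ 1 $ 1" "q = B $ 1 $ 2" "r = B $ 2 $ 1" "s = B $ 2 $ 2"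
  have pos: "p > 0" "q > 0" "r > 0" "s > 0"
    using assms(1) by (auto simp: positive_matrix_def pqrs)
  have e: "p * x + q * y = \<mu> * x" "r * x + s * y = \<mu> * y" using e1 e2 by (simp_all add: pqrs)
  have nz: "x \<noteq> 0" "y \<noteq> 0" using e pos assms(2) by auto
  define t where "t = y / x"
  have t: "p + q * t = \<mu>" using e(1) nz by (simp add: t_def field_simps)
  have t': "r / t + s = \<mu>" using e(2) nz by (simp add: t_def field_simps)
  have tn: "t \<noteq> 0" using nz by (simp add: t_def)
  \<comment> \<open>The characteristic equation, as \<open>\<mu> - p = q * t\<close> and
    \<open>\<mu> - s = r / t\<close>. Both differences have the sign of \<open>t\<close>, which
    decides whether \<open>\<mu>\<close> or the other eigenvalue \<open>p + s - \<mu>\<close>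
    dominates.\<close>
  have "(\<mu> - p) * (\<mu> - s) = q * r" using tn unfolding t[symmetric] by (metis add_diff_cancel_left' add_diff_cancel_right' nonzero_mult_div_cancel_right t t' times_divide_eq_right mult.assoc mult.commute)
  then have d: "det B = \<mu> * (p + s - \<mu>)" by (simp add: det_2 pqrs[symmetric] algebra_simps)
  have *: "\<bar>\<mu>\<bar> * \<bar>p + s - \<mu>\<bar> = \<bar>det B\<bar>" "\<mu>\<^sup>2 = \<bar>\<mu>\<bar> * \<bar>\<mu>\<bar>"
    by (simp_all add: d abs_mult power2_eq_square)
  show "\<bar>det B\<bar> < \<mu>\<^sup>2" if "x * y > 0"
  proof -
    have "t > 0" using that by (auto simp: t_def zero_less_divide_iff zero_less_mult_iff)
    then have "q * t > 0" "r / t > 0" using pos by auto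
    then have "\<mu> > p" "\<mu> > s" using t t' by auto
    then have "\<bar>\<mu>\<bar> * \<bar>p + s - \<mu>\<bar> < \<bar>\<mu>\<bar> * \<bar>\<mu>\<bar>"
      using pos by (intro mult_strict_left_mono) auto
    then show ?thesis using * by simp
  qed
  show "\<mu>\<^sup>2 < \<bar>det B\<bar> \<or> \<mu> = 0" if "x * y \<le> 0"
  proof (cases "\<mu> = 0")
    case False
    have "t < 0" using that nz by (auto simp: t_def divide_less_0_iff mult_le_0_iff)
    then have "q * t < 0" "r / t < 0" using pos by (auto simp: mult_less_0_iff divide_less_0_iff)
    then have "\<mu> < p" "\<mu> < s" using t t' by auto
    then have "\<bar>\<mu>\<bar> * \<bar>\<mu>\<bar> < \<bar>\<mu>\<bar> * \<bar>p + s - \<mu>\<bar>"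
      using pos False by (intro mult_strict_left_mono) auto
    then show ?thesis using * by simp
  qed simp
qed

lemma positive_matrix_mult: "positive_matrix M \<Longrightarrow> positive_matrix N \<Longrightarrow> positive_matrix (M ** N)"
  unfolding positive_matrix_def matrix_mult_2_nth by (auto intro!: add_pos_pos mult_pos_pos)

text \<open>If one linear change of coordinates makes all matrices positive, then the attracting fixed points
  of words lie in the common invariant interval and the repelling ones outside of its closure.\<close>

lemma no_heteroclinic_connection2:
  fixes Q Q' :: "real^2^2" and G :: "'i \<Rightarrow> real^2^2"
  assumes inv: "Q' ** Q = mat 1"
    and pos: "\<And>i. i \<in> I \<Longrightarrow> positive_matrix (Q ** G i ** Q')"
    and det: "\<And>i. i \<in> I \<Longrightarrow> det (G i) \<noteq> 0"
  shows "\<not> heteroclinic_connection2 I (\<lambda>i. mobius (G i))"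
proof
  \<comment> \<open>Positive exactly if \<open>Q\<close> carries the point to one with coordinates
    of equal sign, that is, if the point lies in the open interval that all words map into
    itself.\<close>
  define u where "u = (\<lambda>x y. (Q $ 1 $ 1 * x + Q $ 1 $ 2 * y) * (Q $ 2 $ 1 * x + Q $ 2 $ 2 * y))"
  define S where "S = {M. det M \<noteq> 0 \<and> positive_matrix (Q ** M ** Q')}"
  have dQ: "det Q * det Q' = 1"
    using arg_cong[OF inv, of det] by (simp add: det_mul mult.commute)
  have nzQ: "Q $ 1 $ 1 * x + Q $ 1 $ 2 * y \<noteq> 0 \<or> Q $ 2 $ 1 * x + Q $ 2 $ 2 * y \<noteq> 0"
    if "x \<noteq> 0 \<or> y \<noteq> 0" for x y
  proof (rule ccontr)
    assume "\<not> ?thesis"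
    then have "Q $ 2 $ 2 * (Q $ 1 $ 1 * x + Q $ 1 $ 2 * y) - Q $ 1 $ 2 * (Q $ 2 $ 1 * x + Q $ 2 $ 2 * y) = 0"
      "Q $ 1 $ 1 * (Q $ 2 $ 1 * x + Q $ 2 $ 2 * y) - Q $ 2 $ 1 * (Q $ 1 $ 1 * x + Q $ 1 $ 2 * y) = 0"
      by simp_all
    then have "det Q * x = 0" "det Q * y = 0" by (simp_all add: det_2 algebra_simps)
    then show False using that dQ by auto
  qed
  have conj_apply: "(Q ** M ** Q') $ i $ 1 * (Q $ 1 $ 1 * x + Q $ 1 $ 2 * y) +
      (Q ** M ** Q') $ i $ 2 * (Q $ 2 $ 1 * x + Q $ 2 $ 2 * y) =
    Q $ i $ 1 * (M $ 1 $ 1 * x + M $ 1 $ 2 * y) + Q $ i $ 2 * (M $ 2 $ 1 * x + M $ 2 $ 2 * y)" for M i x y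
  proof -
    have "(Q ** M ** Q' ** Q) = Q ** M"
      by (simp add: inv matrix_mul_assoc[symmetric])
    then have "(Q ** M ** Q' ** Q) $ i $ j = (Q ** M) $ i $ j" for j by simp
    from this[of 1] this[of 2] show ?thesis
      unfolding matrix_mult_2_nth[of _ Q] matrix_mult_2_nth[of Q M] by algebra
  qed
  have words: "\<exists>M\<in>S. h = mobius M" if "h \<in> words2 I (\<lambda>i. mobius (G i))" for h
  proof -
    have 1: "G i \<in> S" if "i \<in> I" for i using that pos det by (simp add: S_def)
    have "G i ** G j \<in> S" if "i \<in> I" "j \<in> I" for i j
    proof -
      have "Q ** (G i ** G j) ** Q' = (Q ** G i ** Q') ** (Q ** G j ** Q')"
      proof -
        have "(Q ** G i ** Q') ** (Q ** G j ** Q') = Q ** G i ** (Q' ** Q) ** G j ** Q'"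
          by (simp add: matrix_mul_assoc)
        then show ?thesis by (simp add: inv matrix_mul_assoc)
      qed
      then show ?thesis
        using that pos det positive_matrix_mult by (auto simp: S_def det_mul)
    qed
    then show ?thesis
      using that 1 det by (fastforce simp: words2_def mobius_compose)
  qed
  have fixed: "(norm (sphere_deriv (mobius M) (sphere_point (of_real x) (of_real y))) \<le> 1 \<longrightarrow> u x y > 0) \<and>
      (norm (sphere_deriv (mobius M) (sphere_point (of_real x) (of_real y))) \<ge> 1 \<longrightarrow> u x y \<le> 0)"
    if M: "M \<in> S" and xy: "x \<noteq> 0 \<or> y \<noteq> 0"
      and fix_pt: "mobius M (sphere_point (of_real x) (of_real y)) = sphere_point (of_real x) (of_real y)" for M x y
  proof -
    have "det M \<noteq> 0" and B: "positive_matrix (Q ** M ** Q')" using M by (auto simp: S_def)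
    then obtain \<mu> where \<mu>: "\<mu> \<noteq> 0" "M $ 1 $ 1 * x + M $ 1 $ 2 * y = \<mu> * x" "M $ 2 $ 1 * x + M $ 2 $ 2 * y = \<mu> * y"
      and deriv: "sphere_deriv (mobius M) (sphere_point (of_real x) (of_real y)) = of_real (det M / \<mu>\<^sup>2)"
      using mobius_fixed_point[OF xy _ fix_pt] by metis
    have detB: "det (Q ** M ** Q') = det M" using dQ by (simp add: det_mul)
    have "(Q ** M ** Q') $ i $ 1 * (Q $ 1 $ 1 * x + Q $ 1 $ 2 * y) +
      (Q ** M ** Q') $ i $ 2 * (Q $ 2 $ 1 * x + Q $ 2 $ 2 * y) = \<mu> * (Q $ i $ 1 * x + Q $ i $ 2 * y)" for i
      unfolding conj_apply \<mu> by (simp add: algebra_simps)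
    note eig = positive_eigenvector[OF B nzQ[OF xy] this[of 1] this[of 2], unfolded detB, folded u_def]
    have "norm (sphere_deriv (mobius M) (sphere_point (of_real x) (of_real y))) = \<bar>det M\<bar> / \<mu>\<^sup>2"
      unfolding deriv norm_of_real by (simp add: abs_divide)
    moreover have "\<mu>\<^sup>2 > 0" using \<mu>(1) by simp
    ultimately show ?thesis using eig \<mu>(1) unfolding u_def
      by (smt (verit) divide_le_eq_1_pos le_divide_eq_1_pos)
  qed
  assume "heteroclinic_connection2 I (\<lambda>i. mobius (G i))"
  then obtain h a where h: "h \<in> insert id (words2 I (\<lambda>i. mobius (G i)))"
    and a: "a \<in> Attr2 I (\<lambda>i. mobius (G i))" and ha: "h a \<in> Rep2 I (\<lambda>i. mobius (G i))"
    unfolding heteroclinic_connection2_def by blast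
  from a obtain x y :: real where xy: "a = sphere_point (of_real x) (of_real y)" "x \<noteq> 0 \<or> y \<noteq> 0"
    using extended_reals_cases by (auto simp: Attr2_def)
  from a have ux: "u x y > 0"
    using words fixed[OF _ xy(2)] unfolding xy(1) Attr2_def by blast
  have "\<exists>x' y'. h a = sphere_point (of_real x') (of_real y') \<and> (x' \<noteq> 0 \<or> y' \<noteq> 0) \<and> u x' y' > 0"
  proof (cases "h = id")
    case True
    then show ?thesis using xy ux by auto
  next
    case False
    then obtain M where M: "M \<in> S" "h = mobius M" using h words by blast
    define x' y' where "x' = M $ 1 $ 1 * x + M $ 1 $ 2 * y" and "y' = M $ 2 $ 1 * x + M $ 2 $ 2 * y"
    define B where "B = Q ** M ** Q'"
    define X Y where XY: "X = Q $ 1 $ 1 * x + Q $ 1 $ 2 * y" "Y = Q $ 2 $ 1 * x + Q $ 2 $ 2 * y"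
    have B: "B $ i $ j > 0" for i j using M by (auto simp: S_def B_def positive_matrix_def)
    have "u x' y' = (B $ 1 $ 1 * X + B $ 1 $ 2 * Y) * (B $ 2 $ 1 * X + B $ 2 $ 2 * Y)"
      unfolding u_def x'_def y'_def XY B_def conj_apply ..
    also have "\<dots> = B $ 1 $ 1 * B $ 2 $ 1 * X\<^sup>2 + B $ 1 $ 2 * B $ 2 $ 2 * Y\<^sup>2 +
        (B $ 1 $ 1 * B $ 2 $ 2 + B $ 1 $ 2 * B $ 2 $ 1) * (X * Y)"
      by (simp add: algebra_simps power2_eq_square)
    also have "\<dots> > 0"
    proof -
      have "X * Y > 0" using ux by (simp add: u_def XY)
      then have "(B $ 1 $ 1 * B $ 2 $ 2 + B $ 1 $ 2 * B $ 2 $ 1) * (X * Y) > 0"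
        using B by (intro mult_pos_pos[of _ "X * Y"] add_pos_pos[OF mult_pos_pos mult_pos_pos]) auto
      moreover have "B $ 1 $ 1 * B $ 2 $ 1 * X\<^sup>2 \<ge> 0" "B $ 1 $ 2 * B $ 2 $ 2 * Y\<^sup>2 \<ge> 0"
        using B by (auto simp: less_imp_le)
      ultimately show ?thesis by linarith
    qed
    finally have u': "u x' y' > 0" .
    then have "x' \<noteq> 0 \<or> y' \<noteq> 0" by (auto simp: u_def)
    moreover have "h a = sphere_point (of_real x') (of_real y')"
      using xy M(2) by (simp add: mobius_sphere_point x'_def y'_def)
    ultimately show ?thesis using u' by blast
  qed
  then obtain x' y' where "h a = sphere_point (of_real x') (of_real y')" "x' \<noteq> 0 \<or> y' \<noteq> 0" "u x' y' > 0"
    by blast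
  with ha words fixed[OF _ this(2)] show False
    unfolding Rep2_def by fastforce
qed

section \<open>The operator \<open>T\<close> as a transfer operator\<close>

definition mob_act :: "real^2^2 \<Rightarrow> real \<Rightarrow> real"
  where "mob_act M x = (M $ 1 $ 1 * x + M $ 1 $ 2) / (M $ 2 $ 1 * x + M $ 2 $ 2)"

text \<open>A matrix sends \<open>(x, 1)\<close> to its denominator at \<open>x\<close> times
  \<open>(mob_act M x, 1)\<close>. Logarithms of these factors therefore add up along
  products.\<close>

definition log_cocycle :: "real^2^2 \<Rightarrow> real \<Rightarrow> real"
  where "log_cocycle M x = ln (M $ 2 $ 1 * x + M $ 2 $ 2)"

definition transfer_op :: "'i set \<Rightarrow> ('i \<Rightarrow> real) \<Rightarrow> ('i \<Rightarrow> real \<Rightarrow> real) \<Rightarrow>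
    (real \<Rightarrow> 'a::real_vector) \<Rightarrow> real \<Rightarrow> 'a"
  where "transfer_op I w g \<phi> x = (\<Sum>i\<in>I. w i *\<^sub>R \<phi> (g i x))"

lemma F_map_nth:
  "F_map M $ 1 $ 1 = (M $ 1 $ 1 - M $ 1 $ 2 - M $ 2 $ 1 + M $ 2 $ 2) / 2"
  "F_map M $ 1 $ 2 = (M $ 1 $ 1 + M $ 1 $ 2 - M $ 2 $ 1 - M $ 2 $ 2) / 2"
  "F_map M $ 2 $ 1 = (M $ 1 $ 1 - M $ 1 $ 2 + M $ 2 $ 1 - M $ 2 $ 2) / 2"
  "F_map M $ 2 $ 2 = (M $ 1 $ 1 + M $ 1 $ 2 + M $ 2 $ 1 + M $ 2 $ 2) / 2"
  by (simp_all add: F_map_def Let_def)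

lemma det_F_map: "det (F_map M) = det M"
  by (simp add: det_2 F_map_nth field_simps)

text \<open>\<open>F_map\<close> is conjugation by the coordinates difference and sum. The vector
  \<open>(a, c)\<close> with \<open>a + c = 1\<close> and \<open>a - c = x\<close> is nonnegative,
  and numerator and denominator are the difference and the sum of the two positive coordinates of
  its image under \<open>B\<close>.\<close>

lemma F_map_positive:
  assumes "positive_matrix B" "\<bar>x\<bar> \<le> 1"
  shows "F_map B $ 2 $ 1 * x + F_map B $ 2 $ 2 > 0"
    and "\<bar>F_map B $ 1 $ 1 * x + F_map B $ 1 $ 2\<bar> < F_map B $ 2 $ 1 * x + F_map B $ 2 $ 2"
    and "\<bar>mob_act (F_map B) x\<bar> < 1"
proof -
  define a c where "a = (1 + x) / 2" and "c = (1 - x) / 2"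
  have ac: "a \<ge> 0" "c \<ge> 0" "a > 0 \<or> c > 0" "x = a - c" "a + c = 1"
    using assms(2) by (auto simp: a_def c_def field_simps)
  have pos: "0 < a * M + c * N" if "M > 0" "N > 0" for M N
    using ac(3)
  proof
    assume "a > 0"
    then show ?thesis using ac(2) that by (intro add_pos_nonneg) auto
  next
    assume "c > 0"
    then show ?thesis using ac(1) that by (intro add_nonneg_pos) auto
  qed
  have B: "B $ j $ k > 0" for j k using assms(1) by (auto simp: positive_matrix_def)
  have x: "x = a - c" "1 = a + c" using ac by auto
  have num: "F_map B $ 1 $ 1 * x + F_map B $ 1 $ 2 = (a * B $ 1 $ 1 + c * B $ 1 $ 2) - (a * B $ 2 $ 1 + c * B $ 2 $ 2)"
    unfolding F_map_nth by (simp add: a_def c_def algebra_simps add_divide_distrib diff_divide_distrib)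
  have den: "F_map B $ 2 $ 1 * x + F_map B $ 2 $ 2 = (a * B $ 1 $ 1 + c * B $ 1 $ 2) + (a * B $ 2 $ 1 + c * B $ 2 $ 2)"
    unfolding F_map_nth by (simp add: a_def c_def algebra_simps add_divide_distrib diff_divide_distrib)
  have pp: "a * B $ 1 $ 1 + c * B $ 1 $ 2 > 0" "a * B $ 2 $ 1 + c * B $ 2 $ 2 > 0"
    by (rule pos[OF B B])+
  show 1: "F_map B $ 2 $ 1 * x + F_map B $ 2 $ 2 > 0"
    and 2: "\<bar>F_map B $ 1 $ 1 * x + F_map B $ 1 $ 2\<bar> < F_map B $ 2 $ 1 * x + F_map B $ 2 $ 2"
    unfolding num den using pp by auto
  show "\<bar>mob_act (F_map B) x\<bar> < 1"
    using 1 2 by (simp add: mob_act_def abs_divide)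
qed

lemma g_zero_eq: "F_map B $ 2 $ 2 \<noteq> 0 \<Longrightarrow> g_zero B = of_real (mob_act (F_map B) 0)"
  by (simp add: g_zero_def mob_act_def)

lemma gT_zero_eq: "F_map B $ 2 $ 2 \<noteq> 0 \<Longrightarrow> gT_zero B = of_real (F_map B $ 2 $ 1 / F_map B $ 2 $ 2)"
  by (simp add: gT_zero_def transpose_def)

lemma g_deriv_zero_eq:
  assumes "F_map B $ 2 $ 2 \<noteq> 0"
  shows "g_deriv_zero B = of_real (det B / (F_map B $ 2 $ 2)\<^sup>2)"
proof -
  have "((\<lambda>z. coord (mobius (F_map B) (Fin z))) has_field_derivative of_real (det B / (F_map B $ 2 $ 2)\<^sup>2)) (at 0)"
    using mobius_has_field_derivative[of "F_map B" 0] assms by (simp add: det_F_map)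
  then show ?thesis
    unfolding g_deriv_zero_def sphere_deriv.simps by (rule DERIV_imp_deriv)
qed

section \<open>Power series identities behind the coefficients of \<open>T\<close>\<close>

lemma negative_binomial_sums:
  fixes z :: complex
  assumes "norm z < 1"
  shows "(\<lambda>m. of_nat ((m + l) choose l) * z ^ m) sums (1 / (1 - z) ^ Suc l)"
proof -
  have nz: "1 - z \<noteq> 0" using assms by auto
  have "(\<lambda>m. (- of_nat (Suc l) gchoose m) * (- z) ^ m) sums (1 + - z) powr (- of_nat (Suc l))"
    by (rule gen_binomial_complex) (use assms in simp)
  moreover have "(1 + - z) powr (- of_nat (Suc l)) = 1 / (1 - z) ^ Suc l"
  proof -
    have "(1 - z) powr of_nat (Suc l) = (1 - z) ^ Suc l"
      using nz by (intro powr_nat') simp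
    then show ?thesis by (simp only: powr_minus_divide add_uminus_conv_diff)
  qed
  moreover have "(- of_nat (Suc l) gchoose m) * (- z) ^ m = of_nat ((m + l) choose l) * z ^ m" for m
  proof -
    have "(- of_nat (Suc l) gchoose m) = (- 1) ^ m * (of_nat (l + m) gchoose m :: complex)"
      unfolding gbinomial_minus by simp
    also have "(of_nat (l + m) gchoose m :: complex) = of_nat ((m + l) choose l)"
      unfolding binomial_gbinomial[symmetric] by (subst binomial_symmetric) (simp_all add: add.commute)
    finally show ?thesis unfolding power_minus[of z] by simp
  qed
  ultimately show ?thesis by (simp only:)
qed

text \<open>\<open>v_seq x c\<close> lists the Taylor coefficients of
  \<open>c + Ln (1 + x * z)\<close> in \<open>z\<close>. The series is thus the \<open>l\<close>-th
  derivative of this function at \<open>y\<close>, divided by the factorial of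
  \<open>l\<close>.\<close>

lemma binomial_v_seq_sums:
  fixes x y :: complex
  assumes "norm (x * y) < 1" "l \<ge> 1"
  shows "(\<lambda>n. of_nat (n choose l) * y ^ (n - l) * v_seq x c n) sums
    (- ((- x / (1 + x * y)) ^ l / of_nat l))"
proof -
  obtain j where l: "l = Suc j" using assms(2) by (cases l) auto
  have "(\<lambda>m. (- ((- x) ^ l / of_nat l)) * (of_nat ((m + j) choose j) * (- (x * y)) ^ m)) sums
      ((- ((- x) ^ l / of_nat l)) * (1 / (1 - - (x * y)) ^ Suc j))"
    by (intro sums_mult negative_binomial_sums) (use assms in simp)
  moreover have "(- ((- x) ^ l / of_nat l)) * (of_nat ((m + j) choose j) * (- (x * y)) ^ m) =
      of_nat ((m + l) choose l) * y ^ (m + l - l) * v_seq x c (m + l)" for m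
  proof -
    \<comment> \<open>Absorption of \<open>l\<close> into the binomial coefficient cancels the
      denominators of the logarithmic series and leaves a negative binomial series.\<close>
    have "l * ((m + l) choose l) = (m + l) * ((m + j) choose j)"
      using Suc_times_binomial_eq[of "m + j" j] by (simp only: l add_Suc_right mult.commute)
    then have "(of_nat l :: complex) * of_nat ((m + l) choose l) = of_nat (m + l) * of_nat ((m + j) choose j)"
      by (simp only: of_nat_mult[symmetric])
    then have "of_nat ((m + j) choose j) / of_nat l = (of_nat ((m + l) choose l) / of_nat (m + l) :: complex)"
      using l by (simp add: field_simps del: of_nat_Suc of_nat_add)
    then have "of_nat ((m + j) choose j) / of_nat l * (- ((- x) ^ l * (- (x * y)) ^ m)) =
        (of_nat ((m + l) choose l) / of_nat (m + l) :: complex) * (- ((- x) ^ l * (- (x * y)) ^ m))"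
      by simp
    moreover have "(- x) ^ l * (- (x * y)) ^ m = (- x) ^ (m + l) * y ^ m"
      unfolding power_add mult_minus_left[symmetric] power_mult_distrib by (simp only: mult_ac)
    moreover have "m + l \<noteq> 0" using l by simp
    ultimately show ?thesis using assms(2) by (simp add: v_seq_def mult_ac del: of_nat_add)
  qed
  ultimately have shifted: "(\<lambda>m. of_nat ((m + l) choose l) * y ^ (m + l - l) * v_seq x c (m + l)) sums
      ((- ((- x) ^ l / of_nat l)) * (1 / (1 - - (x * y)) ^ Suc j))" by simp
  have "of_nat (n choose l) * y ^ (n - l) * v_seq x c n = 0" if "n < l" for n
    using that by (simp add: binomial_eq_0)
  from sums_zero_iff_shift[of l "\<lambda>n. of_nat (n choose l) * y ^ (n - l) * v_seq x c n", OF this] shifted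
  have "(\<lambda>n. of_nat (n choose l) * y ^ (n - l) * v_seq x c n) sums
      ((- ((- x) ^ l / of_nat l)) * (1 / (1 - - (x * y)) ^ Suc j))"
    by (rule iffD1)
  moreover have "(- ((- x) ^ l / of_nat l)) * (1 / (1 - - (x * y)) ^ Suc j) = - ((- x / (1 + x * y)) ^ l / of_nat l)"
    unfolding l power_divide diff_minus_eq_add by (simp only: times_divide_times_eq minus_divide_left mult_1_left mult_1_right mult.commute divide_divide_eq_left)
  ultimately show ?thesis by (rule back_subst[of "\<lambda>c. _ sums c"])
qed

lemma sum_binomial_drop_first:
  fixes a b :: "'a::comm_ring_1"
  shows "(\<Sum>l=1..k. of_nat (k choose l) * a ^ l * b ^ (k - l)) = (a + b) ^ k - b ^ k"
proof -
  have "(\<Sum>l\<le>k. of_nat (k choose l) * a ^ l * b ^ (k - l)) = b ^ k + (\<Sum>l=1..k. of_nat (k choose l) * a ^ l * b ^ (k - l))"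
    by (simp add: atMost_atLeast0 sum.atLeast_Suc_atMost)
  then show ?thesis by (simp add: binomial_ring)
qed

text \<open>The coefficient of \<open>z\<^sup>k\<close> in \<open>(y + g' z / (1 + g z))\<^sup>n\<close>, with the constant functions removed.\<close>

definition power_coeff :: "complex \<Rightarrow> complex \<Rightarrow> complex \<Rightarrow> nat \<Rightarrow> nat \<Rightarrow> complex"
  where "power_coeff y g g' k n =
    (if n = 0 then 0 else if k = 0 then y ^ n
     else (\<Sum>l=1..min k n. of_nat (n choose l) * of_nat ((k - 1) choose (l - 1)) *
       y ^ (n - l) * (- g) ^ (k - l) * g' ^ l))"

lemma T_coeff_eq:
  "T_coeff I w B k n = (\<Sum>i\<in>I. of_real (w i) * power_coeff (gT_zero (B i)) (g_zero (B i)) (g_deriv_zero (B i)) k n)"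
  by (simp add: T_coeff_def power_coeff_def)

text \<open>Substitute \<open>y + g' * z / (1 + g * z)\<close> for the variable in
  \<open>Ln (1 + x * z)\<close>. The argument factors as
  \<open>(1 + x * y) * (1 + h * z) / (1 + g * z)\<close> with
  \<open>h = g + g' * x / (1 + x * y)\<close>, and the three logarithms give the right-hand side. In
  the application the substituted function is the transposed Moebius map. The constant
  \<open>a\<close> cancels and is free to become a value of the cocycle.\<close>

lemma power_coeff_v_seq_sums:
  assumes "norm (x * y) < 1"
  shows "(\<lambda>n. power_coeff y g g' k n * v_seq x c n) sums
    (v_seq (g + g' * x / (1 + x * y)) (a + Ln (1 + x * y)) k - v_seq g a k)"
proof (cases "k = 0")
  case True
  have "(\<lambda>n. (- 1) ^ Suc n / of_nat n * (x * y) ^ n) sums Ln (1 + x * y)"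
    using Ln_series[OF assms] .
  moreover have "(- 1) ^ Suc n / of_nat n * (x * y) ^ n = power_coeff y g g' k n * v_seq x c n" for n
    using True by (auto simp: power_coeff_def v_seq_def power_mult_distrib power_minus[of x])
  ultimately show ?thesis using True by (simp add: v_seq_def)
next
  case False
  define h where "h = - x / (1 + x * y)"
  let ?K = "\<lambda>l. of_nat ((k - 1) choose (l - 1)) * (- g) ^ (k - l) * g' ^ l :: complex"
  have eq: "power_coeff y g g' k n * v_seq x c n =
      (\<Sum>l=1..k. ?K l * (of_nat (n choose l) * y ^ (n - l) * v_seq x c n))" for n
  proof (cases "n = 0")
    case False
    have "(\<Sum>l=1..min k n. ?K l * (of_nat (n choose l) * y ^ (n - l) * v_seq x c n)) =
        (\<Sum>l=1..k. ?K l * (of_nat (n choose l) * y ^ (n - l) * v_seq x c n))"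
      by (rule sum.mono_neutral_left) auto
    moreover have "power_coeff y g g' k n * v_seq x c n =
        (\<Sum>l=1..min k n. ?K l * (of_nat (n choose l) * y ^ (n - l) * v_seq x c n))"
      using False \<open>k \<noteq> 0\<close> by (simp add: power_coeff_def sum_distrib_left mult_ac)
    ultimately show ?thesis by simp
  next
    case True
    then show ?thesis by (auto simp: power_coeff_def binomial_eq_0 intro!: sum.neutral)
  qed
  have "(\<lambda>n. power_coeff y g g' k n * v_seq x c n) sums (\<Sum>l=1..k. ?K l * (- (h ^ l / of_nat l)))"
    unfolding eq by (intro sums_sum sums_mult) (use binomial_v_seq_sums[OF assms] in \<open>auto simp: h_def\<close>)
  moreover have "(\<Sum>l=1..k. ?K l * (- (h ^ l / of_nat l))) =
      - (\<Sum>l=1..k. of_nat (k choose l) * (g' * h) ^ l * (- g) ^ (k - l)) / of_nat k"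
    unfolding sum_negf[symmetric] sum_divide_distrib
  proof (rule sum.cong)
    fix l assume l: "l \<in> {1..k}"
    then obtain j m where jm: "l = Suc j" "k = Suc m" by (cases l; cases k) auto
    have "l * (k choose l) = k * ((k - 1) choose (l - 1))"
      using Suc_times_binomial_eq[of m j] by (simp only: jm mult.commute diff_Suc_1)
    then have "(of_nat l :: complex) * of_nat (k choose l) = of_nat k * of_nat ((k - 1) choose (l - 1))"
      by (simp only: of_nat_mult[symmetric])
    then have "of_nat ((k - 1) choose (l - 1)) / of_nat l = (of_nat (k choose l) / of_nat k :: complex)"
      using l by (simp add: field_simps)
    then have "of_nat ((k - 1) choose (l - 1)) / of_nat l * (- ((- g) ^ (k - l) * g' ^ l * h ^ l)) =
        (of_nat (k choose l) / of_nat k :: complex) * (- ((- g) ^ (k - l) * g' ^ l * h ^ l))" by simp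
    then show "?K l * (- (h ^ l / of_nat l)) = - (of_nat (k choose l) * (g' * h) ^ l * (- g) ^ (k - l)) / of_nat k"
      by (simp add: power_mult_distrib mult_ac)
  qed simp
  moreover have "- (\<Sum>l=1..k. of_nat (k choose l) * (g' * h) ^ l * (- g) ^ (k - l)) / of_nat k =
      v_seq (g + g' * x / (1 + x * y)) (a + Ln (1 + x * y)) k - v_seq g a k"
  proof -
    have eq': "g' * h + - g = - (g + g' * x / (1 + x * y))" by (simp add: h_def)
    show ?thesis
      using False unfolding sum_binomial_drop_first eq' by (simp add: v_seq_def diff_divide_distrib)
  qed
  ultimately show ?thesis by simp
qed

lemma mob_act_expand:
  assumes "M $ 2 $ 2 \<noteq> 0" "M $ 2 $ 1 * x + M $ 2 $ 2 \<noteq> 0"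
  shows "mob_act M x = mob_act M 0 + det M / (M $ 2 $ 2)\<^sup>2 * x / (1 + x * (M $ 2 $ 1 / M $ 2 $ 2))"
proof -
  let ?s = "M $ 2 $ 2" and ?r = "M $ 2 $ 1"
  have e: "1 + x * (?r / ?s) = (?r * x + ?s) / ?s" using assms by (simp add: field_simps)
  have "det M / ?s\<^sup>2 * x / ((?r * x + ?s) / ?s) = det M * x / ((?r * x + ?s) * ?s)"
    using assms by (simp add: power2_eq_square)
  moreover have "mob_act M x - mob_act M 0 = det M * x / ((?r * x + ?s) * ?s)"
    unfolding mob_act_def using assms by (simp add: diff_frac_eq det_2 algebra_simps)
  ultimately show ?thesis unfolding e by simp
qed

text \<open>\<open>T\<close> sends \<open>v(x;c)\<close> to \<open>\<Psi>(x) - \<Psi>(0)\<close>, where \<open>\<Psi>(x)\<close> averages the sequences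
  \<open>v(g\<^sub>i(x); log_cocycle x)\<close>. As \<open>\<Psi>(0)\<close> is the given vector, the partial sums of \<open>T\<^sup>n v\<close> telescope to
  the iterates of the transfer operator at \<open>0\<close>.\<close>

context
  fixes I :: "'i set" and w :: "'i \<Rightarrow> real" and B :: "'i \<Rightarrow> real^2^2"
  assumes pos: "\<And>i. i \<in> I \<Longrightarrow> positive_matrix (B i)"
    and inv: "\<And>i. i \<in> I \<Longrightarrow> det (B i) \<noteq> 0"
    and w: "(\<Sum>i\<in>I. w i) = 1"
begin

private definition "g i = mob_act (F_map (B i))"

private definition "\<Psi> k x = (\<Sum>i\<in>I. w i *\<^sub>R v_seq (of_real (g i x)) (of_real (log_cocycle (F_map (B i)) x)) k)"

private definition "\<Phi> n k = (transfer_op I w g ^^ n) (\<Psi> k)"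

text \<open>The constant in the definition of the vector is the cocycle at 0 in disguise: the
  derivative at 0 is the determinant over the square of the lower right entry.\<close>

private lemma v_vec_eq: "v_vec I w B k = \<Phi> 0 k 0"
proof -
  have "v_seq (g_zero (B i)) (1/2 * ln (of_real (det (F_map (B i))) / g_deriv_zero (B i))) k =
      v_seq (of_real (g i 0)) (of_real (log_cocycle (F_map (B i)) 0)) k" if "i \<in> I" for i
  proof -
    have s: "F_map (B i) $ 2 $ 2 > 0" using F_map_positive(1)[OF pos[OF that], of 0] by simp
    have "of_real (det (F_map (B i))) / g_deriv_zero (B i) = of_real ((F_map (B i) $ 2 $ 2)\<^sup>2)"
      using s inv[OF that] by (simp add: g_deriv_zero_eq det_F_map)
    moreover have "ln (of_real ((F_map (B i) $ 2 $ 2)\<^sup>2) :: complex) = of_real (2 * ln (F_map (B i) $ 2 $ 2))"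
      using s by (subst Ln_of_real) (simp_all add: ln_realpow)
    ultimately have "1/2 * ln (of_real (det (F_map (B i))) / g_deriv_zero (B i)) = of_real (log_cocycle (F_map (B i)) 0)"
      by (simp add: log_cocycle_def)
    then show ?thesis using s by (simp add: g_zero_eq g_def)
  qed
  then show ?thesis by (simp add: v_vec_def \<Phi>_def \<Psi>_def scaleR_conv_of_real)
qed

private lemma T_coeff_v_seq_sums:
  assumes "\<bar>x\<bar> \<le> 1"
  shows "(\<lambda>n. T_coeff I w B k n * v_seq (of_real x) c n) sums (\<Psi> k x - \<Psi> k 0)"
proof -
  have "(\<lambda>n. power_coeff (gT_zero (B i)) (g_zero (B i)) (g_deriv_zero (B i)) k n * v_seq (of_real x) c n) sums
      (v_seq (of_real (g i x)) (of_real (log_cocycle (F_map (B i)) x)) k -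
       v_seq (of_real (g i 0)) (of_real (log_cocycle (F_map (B i)) 0)) k)" if "i \<in> I" for i
  proof -
    let ?M = "F_map (B i)"
    let ?y = "?M $ 2 $ 1 / ?M $ 2 $ 2"
    have s: "?M $ 2 $ 2 > 0" using F_map_positive(1)[OF pos[OF that], of 0] by simp
    have sr: "?M $ 2 $ 1 * x + ?M $ 2 $ 2 > 0" using F_map_positive(1)[OF pos[OF that] assms] .
    \<comment> \<open>Positivity of the denominator at both endpoints 1 and -1 bounds the transposed
      map at 0 strictly by 1, so the logarithmic series converges even for
      \<open>\<bar>x\<bar> = 1\<close>.\<close>
    have "\<bar>?M $ 2 $ 1\<bar> < ?M $ 2 $ 2"
      using F_map_positive(1)[OF pos[OF that], of 1] F_map_positive(1)[OF pos[OF that], of "-1"] by auto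
    then have "\<bar>?y\<bar> < 1" using s by (simp add: abs_divide)
    moreover have "\<bar>x * ?y\<bar> \<le> 1 * \<bar>?y\<bar>"
      unfolding abs_mult by (rule mult_right_mono[OF assms]) simp
    ultimately have "\<bar>x * ?y\<bar> < 1" by simp
    then have xy: "norm (of_real x * gT_zero (B i)) < 1"
      using s by (simp add: gT_zero_eq norm_mult norm_divide abs_mult)
    have e: "1 + x * ?y = (?M $ 2 $ 1 * x + ?M $ 2 $ 2) / ?M $ 2 $ 2" using s by (simp add: field_simps)
    have 1: "1 + of_real x * gT_zero (B i) = of_real (1 + x * ?y)"
      using s by (simp add: gT_zero_eq)
    have 2: "g_zero (B i) + g_deriv_zero (B i) * of_real x / (1 + of_real x * gT_zero (B i)) = of_real (g i x)"
    proof -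
      have "g_zero (B i) + g_deriv_zero (B i) * of_real x / (1 + of_real x * gT_zero (B i)) =
          of_real (mob_act ?M 0 + det ?M / (?M $ 2 $ 2)\<^sup>2 * x / (1 + x * ?y))"
        unfolding 1 using s by (simp only: g_zero_eq g_deriv_zero_eq det_F_map of_real_add of_real_mult of_real_divide less_imp_neq[symmetric] not_False_eq_True)
      also have "mob_act ?M 0 + det ?M / (?M $ 2 $ 2)\<^sup>2 * x / (1 + x * ?y) = mob_act ?M x"
        using s sr by (intro mob_act_expand[symmetric]) auto
      finally show ?thesis by (simp only: g_def)
    qed
    have "0 < 1 + x * ?y" unfolding e using s sr by simp
    then have Ln: "Ln (1 + of_real x * gT_zero (B i)) = of_real (ln (1 + x * ?y))"
      unfolding 1 by (rule Ln_of_real)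
    have "ln (1 + x * ?y) = log_cocycle ?M x - ln (?M $ 2 $ 2)"
      unfolding e log_cocycle_def using s sr by (simp add: ln_div)
    then have 3: "of_real (ln (?M $ 2 $ 2)) + Ln (1 + of_real x * gT_zero (B i)) = of_real (log_cocycle ?M x)"
      unfolding Ln by simp
    have 4: "g_zero (B i) = of_real (g i 0)" "ln (?M $ 2 $ 2) = log_cocycle ?M 0"
      using s by (simp_all add: g_zero_eq g_def log_cocycle_def)
    show ?thesis
      using power_coeff_v_seq_sums[OF xy, of "g_zero (B i)" "g_deriv_zero (B i)" k c "of_real (ln (?M $ 2 $ 2))"]
      unfolding 2 3 unfolding 4 .
  qed
  then have "(\<lambda>n. \<Sum>i\<in>I. of_real (w i) * (power_coeff (gT_zero (B i)) (g_zero (B i)) (g_deriv_zero (B i)) k n * v_seq (of_real x) c n)) sums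
      (\<Sum>i\<in>I. of_real (w i) * (v_seq (of_real (g i x)) (of_real (log_cocycle (F_map (B i)) x)) k -
       v_seq (of_real (g i 0)) (of_real (log_cocycle (F_map (B i)) 0)) k))"
    by (intro sums_sum sums_mult)
  then show ?thesis
    by (simp add: T_coeff_eq \<Psi>_def sum_distrib_right mult.assoc right_diff_distrib sum_subtractf scaleR_conv_of_real)
qed

text \<open>Each iterate at \<open>x\<close> is a finite average of values at points of the unit
  interval, where the series identity is available. The term \<open>\<Psi> k 0\<close> does not
  depend on the point and survives averaging unchanged because the weights have sum 1.\<close>

private lemma T_coeff_\<Phi>_sums:
  assumes "\<bar>x\<bar> \<le> 1"
  shows "(\<lambda>m. T_coeff I w B k m * \<Phi> n m x) sums (\<Phi> (Suc n) k x - \<Psi> k 0)"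
proof -
  have bound: "\<bar>g i x\<bar> \<le> 1" if "i \<in> I" "\<bar>x\<bar> \<le> 1" for i x
    using F_map_positive(3)[OF pos[OF that(1)] that(2)] by (simp add: g_def)
  have avg: "(\<Sum>i\<in>I. w i *\<^sub>R (c i - d)) = (\<Sum>i\<in>I. w i *\<^sub>R c i) - d" for c :: "'i \<Rightarrow> complex" and d
    using w by (simp add: scaleR_right_diff_distrib sum_subtractf flip: scaleR_left.sum)
  have \<Phi>_Suc: "\<Phi> (Suc n) k x = (\<Sum>i\<in>I. w i *\<^sub>R \<Phi> n k (g i x))" for n k x
    by (simp add: \<Phi>_def transfer_op_def)
  have \<Phi>_0: "\<Phi> 0 k = \<Psi> k" for k by (simp add: \<Phi>_def)
  show ?thesis
    using assms
  proof (induction n arbitrary: x)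
    case 0
    have 1: "(\<lambda>m. \<Sum>i\<in>I. w i *\<^sub>R (T_coeff I w B k m * v_seq (of_real (g i x)) (of_real (log_cocycle (F_map (B i)) x)) m)) sums
        (\<Sum>i\<in>I. w i *\<^sub>R (\<Psi> k (g i x) - \<Psi> k 0))"
      by (intro sums_sum sums_scaleR_right T_coeff_v_seq_sums bound) (use 0 in auto)
    have 2: "(\<lambda>m. \<Sum>i\<in>I. w i *\<^sub>R (T_coeff I w B k m * v_seq (of_real (g i x)) (of_real (log_cocycle (F_map (B i)) x)) m)) =
        (\<lambda>m. T_coeff I w B k m * \<Phi> 0 m x)"
      by (simp add: \<Phi>_0 \<Psi>_def sum_distrib_left)
    have 3: "(\<Sum>i\<in>I. w i *\<^sub>R (\<Psi> k (g i x) - \<Psi> k 0)) = \<Phi> (Suc 0) k x - \<Psi> k 0"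
      by (simp only: avg \<Phi>_Suc \<Phi>_0)
    from 1 show ?case unfolding 2 3 .
  next
    case (Suc n)
    have 1: "(\<lambda>m. \<Sum>i\<in>I. w i *\<^sub>R (T_coeff I w B k m * \<Phi> n m (g i x))) sums
        (\<Sum>i\<in>I. w i *\<^sub>R (\<Phi> (Suc n) k (g i x) - \<Psi> k 0))"
      by (intro sums_sum sums_scaleR_right Suc.IH bound) (use Suc.prems in auto)
    have 2: "(\<lambda>m. \<Sum>i\<in>I. w i *\<^sub>R (T_coeff I w B k m * \<Phi> n m (g i x))) =
        (\<lambda>m. T_coeff I w B k m * \<Phi> (Suc n) m x)"
      by (simp add: \<Phi>_Suc sum_distrib_left)
    have 3: "(\<Sum>i\<in>I. w i *\<^sub>R (\<Phi> (Suc n) k (g i x) - \<Psi> k 0)) = \<Phi> (Suc (Suc n)) k x - \<Psi> k 0"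
      by (simp only: avg \<Phi>_Suc[of "Suc n"])
    from 1 show ?case unfolding 2 3 .
  qed
qed

private lemma T_op_power_v_vec:
  "(T_op I w B ^^ n) (v_vec I w B) k = \<Phi> n k 0 - (if n = 0 then 0 else \<Phi> (n - 1) k 0)"
proof (induction n arbitrary: k)
  case 0
  then show ?case by (simp add: v_vec_eq)
next
  case (Suc n)
  have "(\<lambda>m. T_coeff I w B k m * ((T_op I w B ^^ n) (v_vec I w B) m)) sums (\<Phi> (Suc n) k 0 - \<Phi> n k 0)"
  proof (cases n)
    case 0
    then show ?thesis using T_coeff_\<Phi>_sums[of 0 k 0] by (simp add: v_vec_eq \<Phi>_def)
  next
    case (Suc j)
    have "(\<lambda>m. T_coeff I w B k m * \<Phi> n m 0 - T_coeff I w B k m * \<Phi> j m 0) sums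
        ((\<Phi> (Suc n) k 0 - \<Psi> k 0) - (\<Phi> (Suc j) k 0 - \<Psi> k 0))"
      by (intro sums_diff T_coeff_\<Phi>_sums) auto
    then show ?thesis unfolding \<open>\<And>k. (T_op I w B ^^ n) (v_vec I w B) k = _\<close>
      using Suc by (simp add: right_diff_distrib)
  qed
  then have "(\<Sum>m. T_coeff I w B k m * ((T_op I w B ^^ n) (v_vec I w B) m)) = \<Phi> (Suc n) k 0 - \<Phi> n k 0"
    by (rule sums_unique[symmetric])
  moreover have "(T_op I w B ^^ Suc n) (v_vec I w B) k = (\<Sum>m. T_coeff I w B k m * ((T_op I w B ^^ n) (v_vec I w B) m))"
    unfolding funpow.simps o_apply T_op_def[of I w B "(T_op I w B ^^ n) (v_vec I w B)"] ..
  ultimately show ?case by simp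
qed

lemma sum_T_op_power_v_vec:
  "(\<Sum>m<Suc n. (T_op I w B ^^ m) (v_vec I w B) 0) =
    of_real ((transfer_op I w (\<lambda>i. mob_act (F_map (B i))) ^^ n) (\<lambda>x. \<Sum>i\<in>I. w i * log_cocycle (F_map (B i)) x) 0)"
proof -
  have "(\<Sum>m<Suc n. (T_op I w B ^^ m) (v_vec I w B) 0) = \<Phi> n 0 0"
    unfolding T_op_power_v_vec by (induction n) simp_all
  moreover have "\<Phi> n 0 x = of_real ((transfer_op I w g ^^ n) (\<lambda>x. \<Sum>i\<in>I. w i * log_cocycle (F_map (B i)) x) x)" for x
  proof (induction n arbitrary: x)
    case 0
    show ?case by (simp add: \<Phi>_def \<Psi>_def v_seq_def scaleR_conv_of_real)
  next
    case (Suc n)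
    then show ?case by (simp add: \<Phi>_def transfer_op_def scaleR_conv_of_real)
  qed
  moreover have "g = (\<lambda>i. mob_act (F_map (B i)))" by (rule ext) (simp add: g_def)
  ultimately show ?thesis by simp
qed

end

section \<open>Contraction of the Poincare metric\<close>

text \<open>The hyperbolic tangent of half the Poincare distance, which positive matrices contract.\<close>

definition pdist :: "real \<Rightarrow> real \<Rightarrow> real"
  where "pdist x y = \<bar>x - y\<bar> / (1 - x * y)"

lemma abs_mult_less_one: "\<bar>x\<bar> < 1 \<Longrightarrow> \<bar>y\<bar> < 1 \<Longrightarrow> x * y < (1 :: real)"
proof -
  assume "\<bar>x\<bar> < 1" "\<bar>y\<bar> < 1"
  then have "\<bar>x * y\<bar> < 1 * 1"
    unfolding abs_mult by (intro mult_strict_mono) auto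
  then show ?thesis by simp
qed

lemma abs_diff_le_pdist:
  assumes "\<bar>x\<bar> < 1" "\<bar>y\<bar> < 1"
  shows "\<bar>x - y\<bar> \<le> 2 * pdist x y"
proof -
  have "0 < 1 - x * y" using abs_mult_less_one[OF assms] by simp
  moreover have "1 - x * y \<le> 2" using abs_mult_less_one[of "- x" y] assms by simp
  ultimately show ?thesis
    by (simp add: pdist_def pos_le_divide_eq mult_left_mono mult.commute[of 2])
qed

text \<open>The factor is the absolute determinant over the permanent. The determinant comes from
  the difference of the two images; the permanent appears because
  \<open>1 - mob_act x * mob_act y\<close>, over a common denominator, is the permanent times
  \<open>1 - x * y\<close> plus nonnegative terms.\<close>

lemma pdist_mob_act_le:
  assumes B: "positive_matrix B" and xy: "\<bar>x\<bar> < 1" "\<bar>y\<bar> < 1"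
  shows "pdist (mob_act (F_map B) x) (mob_act (F_map B) y) \<le>
    \<bar>det B\<bar> / (B $ 1 $ 1 * B $ 2 $ 2 + B $ 1 $ 2 * B $ 2 $ 1) * pdist x y"
proof -
  let ?M = "F_map B"
  define m where "m = B $ 1 $ 1 * B $ 2 $ 2 + B $ 1 $ 2 * B $ 2 $ 1"
  define dx dy where "dx = ?M $ 2 $ 1 * x + ?M $ 2 $ 2" and "dy = ?M $ 2 $ 1 * y + ?M $ 2 $ 2"
  define nx ny where "nx = ?M $ 1 $ 1 * x + ?M $ 1 $ 2" and "ny = ?M $ 1 $ 1 * y + ?M $ 1 $ 2"
  have Bp: "B $ j $ k > 0" for j k using B by (auto simp: positive_matrix_def)
  have m: "m > 0" unfolding m_def by (intro add_pos_pos mult_pos_pos Bp)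
  have d: "dx > 0" "dy > 0"
    using F_map_positive(1)[OF B, of x] F_map_positive(1)[OF B, of y] xy by (auto simp: dx_def dy_def)
  have xy1: "1 - x * y > 0" using abs_mult_less_one[OF xy] by simp
  have "dx * dy - nx * ny = m * (1 - x * y) +
      B $ 1 $ 1 * B $ 2 $ 1 * ((1 + x) * (1 + y)) + B $ 1 $ 2 * B $ 2 $ 2 * ((1 - x) * (1 - y))"
    unfolding dx_def dy_def nx_def ny_def m_def F_map_nth
    by (simp add: field_simps)
  moreover have "B $ 1 $ 1 * B $ 2 $ 1 * ((1 + x) * (1 + y)) \<ge> 0" "B $ 1 $ 2 * B $ 2 $ 2 * ((1 - x) * (1 - y)) \<ge> 0"
    using xy by (auto intro!: mult_nonneg_nonneg less_imp_le[OF Bp])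
  ultimately have q: "dx * dy - nx * ny \<ge> m * (1 - x * y)" by linarith
  then have q0: "dx * dy - nx * ny > 0" using m xy1 by (smt (verit) mult_pos_pos)
  have act: "mob_act ?M x = nx / dx" "mob_act ?M y = ny / dy"
    by (simp_all add: mob_act_def nx_def ny_def dx_def dy_def)
  have "nx / dx - ny / dy = (nx * dy - ny * dx) / (dx * dy)"
    using d by (simp add: diff_frac_eq)
  also have "nx * dy - ny * dx = det ?M * (x - y)"
    by (simp add: nx_def ny_def dx_def dy_def det_2 algebra_simps)
  finally have diff: "\<bar>nx / dx - ny / dy\<bar> = \<bar>det B\<bar> * \<bar>x - y\<bar> / (dx * dy)"
    using d by (simp add: det_F_map abs_mult abs_divide)
  have "1 - nx / dx * (ny / dy) = (dx * dy - nx * ny) / (dx * dy)"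
    using d by (simp add: diff_divide_distrib)
  then have "pdist (mob_act ?M x) (mob_act ?M y) = \<bar>det B\<bar> * \<bar>x - y\<bar> / (dx * dy - nx * ny)"
    unfolding pdist_def act diff using d by simp
  also have "\<dots> \<le> \<bar>det B\<bar> * \<bar>x - y\<bar> / (m * (1 - x * y))"
    using q q0 m xy1 by (intro divide_left_mono mult_pos_pos mult_nonneg_nonneg) auto
  finally show ?thesis by (simp add: pdist_def m_def)
qed

lemma det_contraction_factor:
  assumes "positive_matrix B"
  shows "\<bar>det B\<bar> / (B $ 1 $ 1 * B $ 2 $ 2 + B $ 1 $ 2 * B $ 2 $ 1) < 1"
proof -
  have Bp: "B $ j $ k > 0" for j k using assms by (auto simp: positive_matrix_def)
  have "0 < B $ 1 $ 1 * B $ 2 $ 2" "0 < B $ 1 $ 2 * B $ 2 $ 1" by (intro mult_pos_pos Bp)+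
  then show ?thesis by (simp add: det_2)
qed

text \<open>Compactness of the closed interval makes the strict bound uniform. After one step all
  orbits stay in a smaller interval, on which \<open>pdist\<close> is bounded.\<close>

lemma mob_act_uniform_bound:
  assumes B: "positive_matrix B"
  shows "\<exists>\<rho><1. \<forall>x. \<bar>x\<bar> \<le> 1 \<longrightarrow> \<bar>mob_act (F_map B) x\<bar> \<le> \<rho>"
proof -
  have nz: "F_map B $ 2 $ 1 * x + F_map B $ 2 $ 2 \<noteq> 0" if "x \<in> {-1..1}" for x
    using F_map_positive(1)[OF B, of x] that by (simp add: abs_le_iff)
  have "continuous_on {-1..1} (\<lambda>x. \<bar>mob_act (F_map B) x\<bar>)"
    unfolding mob_act_def using nz by (intro continuous_intros) auto
  then obtain z where z: "z \<in> {-1..1}" "\<And>x. x \<in> {-1..1} \<Longrightarrow> \<bar>mob_act (F_map B) x\<bar> \<le> \<bar>mob_act (F_map B) z\<bar>"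
    using continuous_attains_sup[of "{-1..1::real}" "\<lambda>x. \<bar>mob_act (F_map B) x\<bar>"] by auto
  show ?thesis
    using F_map_positive(3)[OF B, of z] z by (intro exI[of _ "\<bar>mob_act (F_map B) z\<bar>"]) (auto simp: abs_le_iff)
qed

lemma log_cocycle_lipschitz:
  assumes B: "positive_matrix B"
  shows "\<exists>K\<ge>0. \<forall>x y. \<bar>x\<bar> \<le> 1 \<longrightarrow> \<bar>y\<bar> \<le> 1 \<longrightarrow>
    \<bar>log_cocycle (F_map B) x - log_cocycle (F_map B) y\<bar> \<le> K * \<bar>x - y\<bar>"
proof -
  let ?r = "F_map B $ 2 $ 1" and ?s = "F_map B $ 2 $ 2"
  define m where "m = ?s - \<bar>?r\<bar>"
  have m: "m > 0"
    using F_map_positive(1)[OF B, of 1] F_map_positive(1)[OF B, of "-1"] by (auto simp: m_def abs_if)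
  have low: "m \<le> ?r * x + ?s" if "\<bar>x\<bar> \<le> 1" for x
  proof -
    have "\<bar>?r * x\<bar> \<le> \<bar>?r\<bar> * 1" unfolding abs_mult using that by (intro mult_left_mono) auto
    then show ?thesis by (simp add: m_def)
  qed
  have le: "log_cocycle (F_map B) x - log_cocycle (F_map B) y \<le> \<bar>?r\<bar> / m * \<bar>x - y\<bar>"
    if "\<bar>x\<bar> \<le> 1" "\<bar>y\<bar> \<le> 1" for x y
  proof -
    have p: "0 < ?r * x + ?s" "0 < ?r * y + ?s" using low[OF that(1)] low[OF that(2)] m by auto
    have "log_cocycle (F_map B) x - log_cocycle (F_map B) y \<le> ((?r * x + ?s) - (?r * y + ?s)) / (?r * y + ?s)"
      unfolding log_cocycle_def by (rule ln_diff_le[OF p])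
    also have "\<dots> = ?r * (x - y) / (?r * y + ?s)" by (simp add: algebra_simps)
    also have "\<dots> \<le> \<bar>?r * (x - y)\<bar> / (?r * y + ?s)" using p by (intro divide_right_mono) auto
    also have "\<dots> \<le> \<bar>?r * (x - y)\<bar> / m" using p m low[OF that(2)] by (intro divide_left_mono) auto
    finally show ?thesis by (simp add: abs_mult)
  qed
  show ?thesis
  proof (intro exI conjI allI impI)
    show "\<bar>?r\<bar> / m \<ge> 0" using m by simp
    fix x y :: real
    assume xy: "\<bar>x\<bar> \<le> 1" "\<bar>y\<bar> \<le> 1"
    show "\<bar>log_cocycle (F_map B) x - log_cocycle (F_map B) y\<bar> \<le> \<bar>?r\<bar> / m * \<bar>x - y\<bar>"
      using le[OF xy] le[OF xy(2,1)] by (simp add: abs_le_iff abs_minus_commute)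
  qed
qed

lemma finite_uniform_bound:
  fixes P :: "'i \<Rightarrow> real \<Rightarrow> bool"
  assumes "finite I" "\<And>i. i \<in> I \<Longrightarrow> \<exists>c<d. P i c" "\<And>i c c'. P i c \<Longrightarrow> c \<le> c' \<Longrightarrow> P i c'" "a < d"
  shows "\<exists>c<d. a \<le> c \<and> (\<forall>i\<in>I. P i c)"
  using assms(1,2)
proof (induction I rule: finite_induct)
  case empty
  then show ?case using assms(4) by auto
next
  case (insert i I)
  then obtain c where c: "c < d" "a \<le> c" "\<forall>i\<in>I. P i c" by auto
  obtain c' where c': "c' < d" "P i c'" using insert by auto
  show ?case
    using c c' assms(3)[OF _ max.cobounded1[of c c']] assms(3)[OF _ max.cobounded2[of c' c]]
    by (intro exI[of _ "max c c'"]) auto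
qed

text \<open>Two families are allowed because the second one is also taken to consist of identity
  maps; the bound then compares a function with its image under the operator.\<close>

lemma transfer_op_diff_le:
  fixes \<phi> :: "real \<Rightarrow> real"
  assumes "\<And>i. i \<in> I \<Longrightarrow> w i \<ge> 0" "(\<Sum>i\<in>I. w i) = 1"
    and "\<And>i. i \<in> I \<Longrightarrow> \<bar>\<phi> (g i x) - \<phi> (h i y)\<bar> \<le> c"
  shows "\<bar>transfer_op I w g \<phi> x - transfer_op I w h \<phi> y\<bar> \<le> c"
proof -
  have "\<bar>transfer_op I w g \<phi> x - transfer_op I w h \<phi> y\<bar> = \<bar>\<Sum>i\<in>I. w i * (\<phi> (g i x) - \<phi> (h i y))\<bar>"
    by (simp add: transfer_op_def sum_subtractf right_diff_distrib)
  also have "\<dots> \<le> (\<Sum>i\<in>I. w i * c)"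
    using assms(1,3) by (intro order_trans[OF sum_abs] sum_mono) (simp add: abs_mult mult_left_mono)
  also have "\<dots> = c" using assms(2) by (simp flip: sum_distrib_right)
  finally show ?thesis .
qed

text \<open>The Lipschitz constants of the iterates with respect to \<open>pdist\<close> decay
  geometrically. The iterates become flat on the common interval, their values at 0 form a Cauchy
  sequence, and flatness makes the convergence uniform there.\<close>

lemma transfer_op_limit:
  fixes B :: "'i \<Rightarrow> real^2^2" and I :: "'i set"
  assumes fin: "finite I" and pos: "\<And>i. i \<in> I \<Longrightarrow> positive_matrix (B i)"
    and w: "\<And>i. i \<in> I \<Longrightarrow> w i \<ge> 0" "(\<Sum>i\<in>I. w i) = 1"
  defines "g \<equiv> \<lambda>i. mob_act (F_map (B i))"
  defines "\<psi> \<equiv> \<lambda>x. \<Sum>i\<in>I. w i * log_cocycle (F_map (B i)) x"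
  obtains \<rho> \<Lambda> where "0 \<le> \<rho>" "\<rho> < 1" "\<And>i x. i \<in> I \<Longrightarrow> \<bar>x\<bar> \<le> 1 \<Longrightarrow> \<bar>g i x\<bar> \<le> \<rho>"
    "(\<lambda>n. (transfer_op I w g ^^ n) \<psi> 0) \<longlonglongrightarrow> \<Lambda>"
    "\<And>\<epsilon>. \<epsilon> > 0 \<Longrightarrow> \<exists>n. \<forall>x. \<bar>x\<bar> \<le> \<rho> \<longrightarrow> \<bar>(transfer_op I w g ^^ n) \<psi> x - \<Lambda>\<bar> \<le> \<epsilon>"
proof -
  let ?L = "transfer_op I w g"
  have "\<exists>\<rho><1. 0 \<le> \<rho> \<and> (\<forall>i\<in>I. \<forall>x. \<bar>x\<bar> \<le> 1 \<longrightarrow> \<bar>g i x\<bar> \<le> \<rho>)"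
  proof (rule finite_uniform_bound[OF fin])
    show "\<exists>\<rho><1. \<forall>x. \<bar>x\<bar> \<le> 1 \<longrightarrow> \<bar>g i x\<bar> \<le> \<rho>" if "i \<in> I" for i
      unfolding g_def by (rule mob_act_uniform_bound[OF pos[OF that]])
    show "\<forall>x. \<bar>x\<bar> \<le> 1 \<longrightarrow> \<bar>g i x\<bar> \<le> c'" if "\<forall>x. \<bar>x\<bar> \<le> 1 \<longrightarrow> \<bar>g i x\<bar> \<le> c" "c \<le> c'" for i c c'
      using that by force
  qed simp
  then obtain \<rho> where \<rho>: "0 \<le> \<rho>" "\<rho> < 1" "\<And>i x. i \<in> I \<Longrightarrow> \<bar>x\<bar> \<le> 1 \<Longrightarrow> \<bar>g i x\<bar> \<le> \<rho>" by blast
  have "\<exists>\<kappa><1. 0 \<le> \<kappa> \<and> (\<forall>i\<in>I. \<forall>x y. \<bar>x\<bar> < 1 \<longrightarrow> \<bar>y\<bar> < 1 \<longrightarrow> pdist (g i x) (g i y) \<le> \<kappa> * pdist x y)"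
  proof (rule finite_uniform_bound[OF fin])
    show "\<exists>\<kappa><1. \<forall>x y. \<bar>x\<bar> < 1 \<longrightarrow> \<bar>y\<bar> < 1 \<longrightarrow> pdist (g i x) (g i y) \<le> \<kappa> * pdist x y" if "i \<in> I" for i
      using det_contraction_factor[OF pos[OF that]] pdist_mob_act_le[OF pos[OF that]] unfolding g_def by blast
    show "\<forall>x y. \<bar>x\<bar> < 1 \<longrightarrow> \<bar>y\<bar> < 1 \<longrightarrow> pdist (g i x) (g i y) \<le> c' * pdist x y"
      if *: "\<forall>x y. \<bar>x\<bar> < 1 \<longrightarrow> \<bar>y\<bar> < 1 \<longrightarrow> pdist (g i x) (g i y) \<le> c * pdist x y" "c \<le> c'" for i c c'
    proof (intro allI impI)
      fix x y :: real assume xy: "\<bar>x\<bar> < 1" "\<bar>y\<bar> < 1"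
      then have "pdist x y \<ge> 0" using abs_mult_less_one[OF xy] by (simp add: pdist_def)
      then have "c * pdist x y \<le> c' * pdist x y" by (rule mult_right_mono[OF *(2)])
      then show "pdist (g i x) (g i y) \<le> c' * pdist x y" using *(1) xy by force
    qed
  qed simp
  then obtain \<kappa> where \<kappa>: "0 \<le> \<kappa>" "\<kappa> < 1"
    "\<And>i x y. i \<in> I \<Longrightarrow> \<bar>x\<bar> < 1 \<Longrightarrow> \<bar>y\<bar> < 1 \<Longrightarrow> pdist (g i x) (g i y) \<le> \<kappa> * pdist x y" by blast
  have "\<forall>i\<in>I. \<exists>K\<ge>0. \<forall>x y. \<bar>x\<bar> \<le> 1 \<longrightarrow> \<bar>y\<bar> \<le> 1 \<longrightarrow>
      \<bar>log_cocycle (F_map (B i)) x - log_cocycle (F_map (B i)) y\<bar> \<le> K * \<bar>x - y\<bar>"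
    using log_cocycle_lipschitz[OF pos] by (intro ballI)
  from bchoice[OF this] obtain K where K: "\<And>i. i \<in> I \<Longrightarrow> K i \<ge> 0"
    "\<And>i x y. i \<in> I \<Longrightarrow> \<bar>x\<bar> \<le> 1 \<Longrightarrow> \<bar>y\<bar> \<le> 1 \<Longrightarrow>
      \<bar>log_cocycle (F_map (B i)) x - log_cocycle (F_map (B i)) y\<bar> \<le> K i * \<bar>x - y\<bar>"
    by auto
  define C where "C = 2 * (\<Sum>i\<in>I. w i * K i)"
  have C: "C \<ge> 0" using w(1) K(1) by (auto simp: C_def intro!: sum_nonneg)
  have g_less: "\<bar>g i x\<bar> < 1" if "i \<in> I" "\<bar>x\<bar> \<le> 1" for i x
    using \<rho>(2) \<rho>(3)[OF that] by simp
  have lip: "\<bar>(?L ^^ n) \<psi> x - (?L ^^ n) \<psi> y\<bar> \<le> C * \<kappa> ^ n * pdist x y" if "\<bar>x\<bar> < 1" "\<bar>y\<bar> < 1" for n x y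
    using that
  proof (induction n arbitrary: x y)
    case 0
    have "\<bar>\<psi> x - \<psi> y\<bar> = \<bar>\<Sum>i\<in>I. w i * (log_cocycle (F_map (B i)) x - log_cocycle (F_map (B i)) y)\<bar>"
      by (simp add: \<psi>_def sum_subtractf right_diff_distrib)
    also have "\<dots> \<le> (\<Sum>i\<in>I. w i * (K i * \<bar>x - y\<bar>))"
      using 0 w(1) K(2) by (intro order_trans[OF sum_abs] sum_mono) (simp add: abs_mult mult_left_mono)
    also have "\<dots> = (\<Sum>i\<in>I. w i * K i) * \<bar>x - y\<bar>"
      by (simp add: sum_distrib_right mult.assoc)
    also have "\<dots> \<le> (\<Sum>i\<in>I. w i * K i) * (2 * pdist x y)"
      using w(1) K(1) abs_diff_le_pdist[OF 0] by (intro mult_left_mono sum_nonneg) auto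
    finally show ?case by (simp add: C_def)
  next
    case (Suc n)
    have "\<bar>(?L ^^ n) \<psi> (g i x) - (?L ^^ n) \<psi> (g i y)\<bar> \<le> C * \<kappa> ^ Suc n * pdist x y" if "i \<in> I" for i
    proof -
      have "\<bar>(?L ^^ n) \<psi> (g i x) - (?L ^^ n) \<psi> (g i y)\<bar> \<le> C * \<kappa> ^ n * pdist (g i x) (g i y)"
        using Suc.prems that by (intro Suc.IH g_less) auto
      also have "\<dots> \<le> C * \<kappa> ^ n * (\<kappa> * pdist x y)"
        using \<kappa>(1,3) C Suc.prems that by (intro mult_left_mono) auto
      finally show ?thesis by (simp add: mult_ac)
    qed
    then show ?case using transfer_op_diff_le[OF w, where \<phi> = "(?L ^^ n) \<psi>"] by simp
  qed
  \<comment> \<open>On \<open>[-\<rho>, \<rho>]\<close> the numerator of \<open>pdist\<close> is at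
    most 2 and its denominator at least \<open>1 - \<rho> * \<rho>\<close>.\<close>
  define D where "D = C * (2 / (1 - \<rho> * \<rho>))"
  have lip': "\<bar>(?L ^^ n) \<psi> x - (?L ^^ n) \<psi> y\<bar> \<le> D * \<kappa> ^ n" if "\<bar>x\<bar> \<le> \<rho>" "\<bar>y\<bar> \<le> \<rho>" for n x y
  proof -
    have "\<bar>x * y\<bar> \<le> \<rho> * \<rho>" unfolding abs_mult using that by (intro mult_mono) auto
    moreover have "\<rho> * \<rho> < 1" using abs_mult_less_one[of \<rho> \<rho>] \<rho> by simp
    ultimately have "pdist x y \<le> 2 / (1 - \<rho> * \<rho>)"
      unfolding pdist_def using that \<rho> by (intro frac_le) auto
    then have "C * \<kappa> ^ n * pdist x y \<le> C * \<kappa> ^ n * (2 / (1 - \<rho> * \<rho>))"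
      using C \<kappa>(1) by (intro mult_left_mono) auto
    then show ?thesis using lip[of x y n] that \<rho>(2) by (simp add: D_def mult_ac)
  qed
  define a where "a n = (?L ^^ n) \<psi> 0" for n
  have step: "\<bar>a (Suc n) - a n\<bar> \<le> D * \<kappa> ^ n" for n
  proof -
    \<comment> \<open>With identity maps the operator fixes every function, so the increment is a
      difference of two averages.\<close>
    have "transfer_op I w (\<lambda>_ x. x) ((?L ^^ n) \<psi>) 0 = a n"
      using w(2) by (simp add: transfer_op_def a_def flip: sum_distrib_right)
    moreover have "\<bar>?L ((?L ^^ n) \<psi>) 0 - transfer_op I w (\<lambda>_ x. x) ((?L ^^ n) \<psi>) 0\<bar> \<le> D * \<kappa> ^ n"
      using \<rho> by (intro transfer_op_diff_le w lip') auto
    ultimately show ?thesis by (simp add: a_def)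
  qed
  have sm: "summable (\<lambda>n. D * \<kappa> ^ n)"
    using \<kappa> by (simp add: summable_mult summable_geometric)
  have "summable (\<lambda>n. a (Suc n) - a n)"
    by (rule summable_comparison_test'[OF sm, of 0]) (simp add: step)
  then have "convergent (\<lambda>n. a n - a 0)"
    unfolding summable_iff_convergent sum_lessThan_telescope .
  then have "convergent a" by (simp only: convergent_diff_const_right_iff)
  then obtain \<Lambda> where \<Lambda>: "a \<longlonglongrightarrow> \<Lambda>" by (auto simp: convergent_def)
  have D: "D * \<kappa> ^ n \<ge> 0" for n using lip'[of 0 0 n] \<rho>(1) by simp
  have unif: "\<exists>n. \<forall>x. \<bar>x\<bar> \<le> \<rho> \<longrightarrow> \<bar>(?L ^^ n) \<psi> x - \<Lambda>\<bar> \<le> \<epsilon>" if "\<epsilon> > 0" for \<epsilon>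
  proof -
    have "(\<lambda>n. D * \<kappa> ^ n + \<bar>a n - \<Lambda>\<bar>) \<longlonglongrightarrow> D * 0 + \<bar>\<Lambda> - \<Lambda>\<bar>"
      using \<kappa> by (intro tendsto_intros \<Lambda> LIMSEQ_realpow_zero) auto
    then have "\<forall>\<^sub>F n in sequentially. D * \<kappa> ^ n + \<bar>a n - \<Lambda>\<bar> < \<epsilon>"
      using that by (intro order_tendstoD(2)) auto
    then obtain n where n: "D * \<kappa> ^ n + \<bar>a n - \<Lambda>\<bar> < \<epsilon>"
      by (auto simp: eventually_sequentially)
    show ?thesis
    proof (intro exI allI impI)
      fix x :: real assume "\<bar>x\<bar> \<le> \<rho>"
      then have "\<bar>(?L ^^ n) \<psi> x - a n\<bar> \<le> D * \<kappa> ^ n" unfolding a_def using \<rho>(1) by (intro lip') auto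
      then show "\<bar>(?L ^^ n) \<psi> x - \<Lambda>\<bar> \<le> \<epsilon>" using n by linarith
    qed
  qed
  show ?thesis by (rule that[OF \<rho> \<Lambda>[unfolded a_def] unif])
qed

section \<open>The law of large numbers along digit expansions\<close>

text \<open>For \<open>j = \<lfloor>b ^ n * t\<rfloor>\<close> the digits of \<open>t\<close> act in
  their natural order on the starting point 0, the newest digit outermost. \<open>walk_sum\<close>
  evaluates \<open>l\<close> at the position before the digit acts.\<close>

primrec walk :: "int \<Rightarrow> (int \<Rightarrow> real \<Rightarrow> real) \<Rightarrow> nat \<Rightarrow> int \<Rightarrow> real" where
  "walk b g 0 j = 0"
| "walk b g (Suc n) j = g (j mod b) (walk b g n (j div b))"

primrec walk_sum :: "int \<Rightarrow> (int \<Rightarrow> real \<Rightarrow> real) \<Rightarrow> (int \<Rightarrow> real \<Rightarrow> real) \<Rightarrow> nat \<Rightarrow> int \<Rightarrow> real" where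
  "walk_sum b g l 0 j = 0"
| "walk_sum b g l (Suc n) j = l (j mod b) (walk b g n (j div b)) + walk_sum b g l n (j div b)"

lemma exp_le_quadratic:
  fixes x :: real
  assumes "\<bar>x\<bar> \<le> 1"
  shows "exp x \<le> 1 + x + x\<^sup>2"
proof (cases "x \<ge> 0")
  case True
  then show ?thesis using exp_bound[of x] assms by simp
next
  case False
  define y where "y = - x"
  have y: "0 < y" "y \<le> 1" using False assms by (auto simp: y_def)
  have "1 + y \<le> exp y" by (rule exp_ge_add_one_self)
  then have "exp (- y) \<le> 1 / (1 + y)"
    using y by (simp add: exp_minus inverse_eq_divide divide_left_mono)
  also have "\<dots> \<le> 1 - y + y\<^sup>2"
  proof -
    have "(1 - y + y\<^sup>2) * (1 + y) = 1 + y ^ 3" by (simp add: algebra_simps power2_eq_square power3_eq_cube)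
    then show ?thesis using y by (simp add: pos_divide_le_eq)
  qed
  finally show ?thesis by (simp add: y_def)
qed

lemma sum_atLeastLessThan_power_Suc:
  fixes b :: int and f :: "int \<Rightarrow> 'a::comm_monoid_add"
  assumes "b > 0"
  shows "(\<Sum>j\<in>{0..<b ^ Suc n}. f j) = (\<Sum>j\<in>{0..<b ^ n}. \<Sum>i\<in>{0..b-1}. f (b * j + i))"
proof -
  have "bij_betw (\<lambda>(j, i). b * j + i) ({0..<b ^ n} \<times> {0..b-1}) {0..<b ^ Suc n}"
  proof (rule bij_betw_byWitness[where f' = "\<lambda>k. (k div b, k mod b)"])
    show "(\<lambda>(j, i). b * j + i) ` ({0..<b ^ n} \<times> {0..b-1}) \<subseteq> {0..<b ^ Suc n}"
    proof -
      have "b * j + i \<in> {0..<b ^ Suc n}" if "j \<in> {0..<b ^ n}" "i \<in> {0..b-1}" for i j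
      proof -
        have "b * (j + 1) \<le> b * b ^ n"
          using assms that by (intro mult_left_mono) auto
        then have "b * j + i < b ^ Suc n"
          using that by (simp add: distrib_left)
        then show ?thesis using assms that by simp
      qed
      then show ?thesis by auto
    qed
    show "(\<lambda>k. (k div b, k mod b)) ` {0..<b ^ Suc n} \<subseteq> {0..<b ^ n} \<times> {0..b-1}"
    proof -
      have "k div b \<in> {0..<b ^ n} \<and> k mod b \<in> {0..b-1}" if "k \<in> {0..<b ^ Suc n}" for k
      proof -
        have "b * (k div b) \<le> k" using assms by (simp add: minus_mod_eq_mult_div[symmetric])
        then have "b * (k div b) < b * b ^ n" using that by simp
        then show ?thesis
          using assms that pos_mod_bound[OF assms, of k] by (simp add: pos_imp_zdiv_nonneg_iff)
      qed
      then show ?thesis by auto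
    qed
  qed (use assms in auto)
  from sum.reindex_bij_betw[OF this, of f] show ?thesis
    by (simp add: sum.cartesian_product case_prod_unfold)
qed

lemma measure_floor_power:
  fixes b :: int
  assumes "b > 0" "J \<subseteq> {0..<b ^ n}"
  obtains A :: "real set" where "A \<in> sets lborel" "\<And>t. \<lfloor>of_int b ^ n * t\<rfloor> \<in> J \<Longrightarrow> t \<in> A"
    "emeasure lborel A < \<infinity>" "measure lborel A \<le> real (card J) / of_int b ^ n"
proof
  let ?I = "\<lambda>j. {of_int j / of_int b ^ n..<of_int (j + 1) / (of_int b ^ n :: real)}"
  let ?A = "\<Union>j\<in>J. ?I j"
  have fin: "finite J" using assms(2) finite_subset by blast
  have bn: "(of_int b :: real) ^ n > 0" using assms(1) by simp
  show "?A \<in> sets lborel" using fin by (intro sets.finite_UN) auto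
  show "t \<in> ?A" if "\<lfloor>of_int b ^ n * t\<rfloor> \<in> J" for t :: real
  proof (rule UN_I[OF that])
    have "of_int \<lfloor>of_int b ^ n * t\<rfloor> \<le> of_int b ^ n * t" "of_int b ^ n * t < of_int (\<lfloor>of_int b ^ n * t\<rfloor> + 1)"
      by linarith+
    then show "t \<in> ?I \<lfloor>of_int b ^ n * t\<rfloor>"
      using bn by (simp add: pos_divide_le_eq pos_less_divide_eq mult.commute)
  qed
  have m: "emeasure lborel (?I j) = ennreal (1 / of_int b ^ n)" for j
  proof -
    have "of_int (j + 1) / of_int b ^ n - of_int j / of_int b ^ n = (1 / of_int b ^ n :: real)"
      by (simp add: add_divide_distrib)
    moreover have "of_int j / of_int b ^ n \<le> of_int (j + 1) / (of_int b ^ n :: real)"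
      using bn by (intro divide_right_mono) auto
    ultimately show ?thesis by simp
  qed
  have "emeasure lborel ?A \<le> (\<Sum>j\<in>J. emeasure lborel (?I j))"
    using fin by (intro emeasure_subadditive_finite) auto
  also have "\<dots> = ennreal (real (card J) / of_int b ^ n)"
    unfolding m using bn by (simp add: ennreal_of_nat_eq_real_of_nat flip: ennreal_mult)
  finally have le: "emeasure lborel ?A \<le> ennreal (real (card J) / of_int b ^ n)" .
  then show "emeasure lborel ?A < \<infinity>" using le_less_trans by fastforce
  show "measure lborel ?A \<le> real (card J) / of_int b ^ n"
    using le bn unfolding measure_def by (intro enn2real_leI) auto
qed

text \<open>An exponential Markov inequality. Averaging over the last digit multiplies the moment by
  at most \<open>exp (3 / 4 * \<theta> * \<epsilon>)\<close>, whatever the current position;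
  comparison with \<open>exp (\<theta> * \<epsilon>)\<close> per step leaves
  \<open>q = exp (- (\<theta> * \<epsilon> / 4))\<close>.\<close>

lemma walk_sum_large_deviation:
  fixes b :: int and g Y :: "int \<Rightarrow> real \<Rightarrow> real"
  assumes b: "b \<ge> 1" and \<rho>: "\<rho> \<ge> 0"
    and g: "\<And>i x. i \<in> {0..b-1} \<Longrightarrow> \<bar>x\<bar> \<le> \<rho> \<Longrightarrow> \<bar>g i x\<bar> \<le> \<rho>"
    and Y: "\<And>i x. i \<in> {0..b-1} \<Longrightarrow> \<bar>x\<bar> \<le> \<rho> \<Longrightarrow> \<bar>Y i x\<bar> \<le> K"
    and mean: "\<And>x. \<bar>x\<bar> \<le> \<rho> \<Longrightarrow> (\<Sum>i\<in>{0..b-1}. Y i x) \<le> of_int b * (\<epsilon> / 2)"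
    and pos: "\<epsilon> > 0" "K > 0"
  shows "\<exists>q. 0 < q \<and> q < 1 \<and>
    (\<forall>n. real (card {j \<in> {0..<b ^ n}. walk_sum b g Y n j \<ge> \<epsilon> * n}) \<le> of_int b ^ n * q ^ n)"
proof -
  \<comment> \<open>The first bound makes the quadratic estimate of the exponential applicable. The
    second keeps the quadratic term below \<open>\<theta> * \<epsilon> / 4\<close>, which together
    with the mean \<open>\<epsilon> / 2\<close> gives the rate 3/4.\<close>
  define \<theta> where "\<theta> = min (1 / K) (\<epsilon> / (4 * K\<^sup>2))"
  have \<theta>: "\<theta> > 0" "\<theta> * K \<le> 1" "\<theta> * K\<^sup>2 \<le> \<epsilon> / 4"
  proof -
    show "\<theta> > 0" using pos by (simp add: \<theta>_def)
    have "\<theta> * K \<le> 1 / K * K" unfolding \<theta>_def using pos by (intro mult_right_mono) auto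
    then show "\<theta> * K \<le> 1" using pos by simp
    have "\<theta> * K\<^sup>2 \<le> \<epsilon> / (4 * K\<^sup>2) * K\<^sup>2" unfolding \<theta>_def by (intro mult_right_mono) auto
    then show "\<theta> * K\<^sup>2 \<le> \<epsilon> / 4" using pos by simp
  qed
  have walk: "\<bar>walk b g n j\<bar> \<le> \<rho>" for n j
  proof (induction n arbitrary: j)
    case (Suc n)
    have "j mod b \<in> {0..b-1}" using b by (simp add: pos_mod_bound[of b j])
    then show ?case using g Suc by simp
  qed (simp add: \<rho>)
  have step: "(\<Sum>i\<in>{0..b-1}. exp (\<theta> * Y i x)) \<le> of_int b * exp (3 / 4 * \<theta> * \<epsilon>)" if x: "\<bar>x\<bar> \<le> \<rho>" for x
  proof -
    have "exp (\<theta> * Y i x) \<le> 1 + \<theta> * Y i x + (\<theta> * K)\<^sup>2" if "i \<in> {0..b-1}" for i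
    proof -
      have le: "\<bar>\<theta> * Y i x\<bar> \<le> \<theta> * K"
        unfolding abs_mult using \<theta>(1) Y[OF that x] by (simp add: mult_left_mono)
      then have "exp (\<theta> * Y i x) \<le> 1 + \<theta> * Y i x + (\<theta> * Y i x)\<^sup>2"
        using \<theta>(2) by (intro exp_le_quadratic) simp
      also have "(\<theta> * Y i x)\<^sup>2 \<le> (\<theta> * K)\<^sup>2"
        using le by (metis abs_ge_zero power2_abs power_mono)
      finally show ?thesis by simp
    qed
    then have "(\<Sum>i\<in>{0..b-1}. exp (\<theta> * Y i x)) \<le> (\<Sum>i\<in>{0..b-1}. 1 + \<theta> * Y i x + (\<theta> * K)\<^sup>2)"
      by (rule sum_mono)
    also have "\<dots> = of_int b + \<theta> * (\<Sum>i\<in>{0..b-1}. Y i x) + of_int b * (\<theta> * K)\<^sup>2"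
      using b by (simp add: sum.distrib sum_distrib_left)
    also have "\<theta> * (\<Sum>i\<in>{0..b-1}. Y i x) \<le> \<theta> * (of_int b * (\<epsilon> / 2))"
      using \<theta>(1) mean[OF x] by (intro mult_left_mono) auto
    also have "(\<theta> * K)\<^sup>2 \<le> \<theta> * (\<epsilon> / 4)"
      using \<theta>(1,3) by (simp add: power_mult_distrib power2_eq_square[of \<theta>] mult.assoc mult_left_mono)
    finally have "(\<Sum>i\<in>{0..b-1}. exp (\<theta> * Y i x)) \<le> of_int b + \<theta> * (of_int b * (\<epsilon> / 2)) + of_int b * (\<theta> * (\<epsilon> / 4))"
      using b by (simp add: mult_left_mono)
    also have "\<dots> = of_int b * (1 + 3 / 4 * \<theta> * \<epsilon>)" by (simp add: algebra_simps)
    also have "\<dots> \<le> of_int b * exp (3 / 4 * \<theta> * \<epsilon>)"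
      using b by (intro mult_left_mono exp_ge_add_one_self) auto
    finally show ?thesis .
  qed
  have moment: "(\<Sum>j\<in>{0..<b ^ n}. exp (\<theta> * walk_sum b g Y n j)) \<le> of_int b ^ n * exp (3 / 4 * \<theta> * \<epsilon>) ^ n" for n
  proof (induction n)
    case 0
    then show ?case by simp
  next
    case (Suc n)
    have "(\<Sum>j\<in>{0..<b ^ Suc n}. exp (\<theta> * walk_sum b g Y (Suc n) j)) =
        (\<Sum>j\<in>{0..<b ^ n}. \<Sum>i\<in>{0..b-1}. exp (\<theta> * walk_sum b g Y (Suc n) (b * j + i)))"
      using b by (intro sum_atLeastLessThan_power_Suc) auto
    also have "\<dots> = (\<Sum>j\<in>{0..<b ^ n}. exp (\<theta> * walk_sum b g Y n j) * (\<Sum>i\<in>{0..b-1}. exp (\<theta> * Y i (walk b g n j))))"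
      unfolding sum_distrib_left
    proof (intro sum.cong refl)
      fix j i :: int assume i: "i \<in> {0..b-1}"
      then have "(b * j + i) div b = j" "(b * j + i) mod b = i" by auto
      then show "exp (\<theta> * walk_sum b g Y (Suc n) (b * j + i)) =
          exp (\<theta> * walk_sum b g Y n j) * exp (\<theta> * Y i (walk b g n j))"
        by (simp add: distrib_left exp_add mult.commute)
    qed
    also have "\<dots> \<le> (\<Sum>j\<in>{0..<b ^ n}. exp (\<theta> * walk_sum b g Y n j) * (of_int b * exp (3 / 4 * \<theta> * \<epsilon>)))"
      by (intro sum_mono mult_left_mono step walk) simp
    also have "\<dots> = (\<Sum>j\<in>{0..<b ^ n}. exp (\<theta> * walk_sum b g Y n j)) * (of_int b * exp (3 / 4 * \<theta> * \<epsilon>))"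
      by (simp add: sum_distrib_right)
    also have "\<dots> \<le> of_int b ^ n * exp (3 / 4 * \<theta> * \<epsilon>) ^ n * (of_int b * exp (3 / 4 * \<theta> * \<epsilon>))"
      using b by (intro mult_right_mono Suc.IH) auto
    finally show ?case by (simp add: mult_ac)
  qed
  define q where "q = exp (- (\<theta> * \<epsilon> / 4))"
  have "real (card {j \<in> {0..<b ^ n}. walk_sum b g Y n j \<ge> \<epsilon> * n}) \<le> of_int b ^ n * q ^ n" for n
  proof -
    let ?J = "{j \<in> {0..<b ^ n}. walk_sum b g Y n j \<ge> \<epsilon> * n}"
    have "card ?J * exp (\<theta> * \<epsilon>) ^ n = (\<Sum>j\<in>?J. exp (\<theta> * (\<epsilon> * n)))"
      by (simp add: exp_of_nat_mult[symmetric] mult_ac)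
    also have "\<dots> \<le> (\<Sum>j\<in>?J. exp (\<theta> * walk_sum b g Y n j))"
      using \<theta>(1) by (intro sum_mono) auto
    also have "\<dots> \<le> (\<Sum>j\<in>{0..<b ^ n}. exp (\<theta> * walk_sum b g Y n j))"
      by (intro sum_mono2) auto
    also have "\<dots> \<le> of_int b ^ n * exp (3 / 4 * \<theta> * \<epsilon>) ^ n" by (rule moment)
    also have "exp (3 / 4 * \<theta> * \<epsilon>) = q * exp (\<theta> * \<epsilon>)"
      by (simp add: q_def flip: exp_add)
    finally show ?thesis by (simp add: power_mult_distrib)
  qed
  moreover have "0 < q" "q < 1" using \<theta>(1) pos by (auto simp: q_def)
  ultimately show ?thesis by blast
qed

lemma walk_sum_small_eventually:
  fixes b :: int and g Y :: "int \<Rightarrow> real \<Rightarrow> real"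
  assumes b: "b \<ge> 1" and \<rho>: "\<rho> \<ge> 0"
    and g: "\<And>i x. i \<in> {0..b-1} \<Longrightarrow> \<bar>x\<bar> \<le> \<rho> \<Longrightarrow> \<bar>g i x\<bar> \<le> \<rho>"
    and Y: "\<And>i x. i \<in> {0..b-1} \<Longrightarrow> \<bar>x\<bar> \<le> \<rho> \<Longrightarrow> \<bar>Y i x\<bar> \<le> K"
    and mean: "\<And>x. \<bar>x\<bar> \<le> \<rho> \<Longrightarrow> (\<Sum>i\<in>{0..b-1}. Y i x) \<le> of_int b * (\<epsilon> / 2)"
    and pos: "\<epsilon> > 0" "K > 0"
  shows "AE t :: real in lborel. 0 \<le> t \<longrightarrow> t < 1 \<longrightarrow>
    (\<forall>\<^sub>F n in sequentially. walk_sum b g Y n \<lfloor>of_int b ^ n * t\<rfloor> < \<epsilon> * n)"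
proof -
  define J where "J n = {j \<in> {0..<b ^ n}. walk_sum b g Y n j \<ge> \<epsilon> * n}" for n
  have "\<exists>q. 0 < q \<and> q < 1 \<and>
      (\<forall>n. real (card {j \<in> {0..<b ^ n}. walk_sum b g Y n j \<ge> \<epsilon> * n}) \<le> of_int b ^ n * q ^ n)"
    by (rule walk_sum_large_deviation[where \<rho> = \<rho> and K = K]) fact+
  then obtain q where q: "0 < q" "q < 1" "\<And>n. real (card (J n)) \<le> of_int b ^ n * q ^ n"
    unfolding J_def by auto
  have "\<forall>n. \<exists>A :: real set. A \<in> sets lborel \<and> (\<forall>t. \<lfloor>of_int b ^ n * t\<rfloor> \<in> J n \<longrightarrow> t \<in> A) \<and>
    emeasure lborel A < \<infinity> \<and> measure lborel A \<le> q ^ n"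
    (is "\<forall>n. \<exists>A. ?P n A")
  proof
    fix n
    have "b > 0" "J n \<subseteq> {0..<b ^ n}" using b by (auto simp: J_def)
    then obtain A :: "real set" where A: "A \<in> sets lborel" "\<And>t. \<lfloor>of_int b ^ n * t\<rfloor> \<in> J n \<Longrightarrow> t \<in> A"
      "emeasure lborel A < \<infinity>" "measure lborel A \<le> real (card (J n)) / of_int b ^ n"
      by (rule measure_floor_power) blast
    have "real (card (J n)) / of_int b ^ n \<le> q ^ n"
      using q(3)[of n] b by (simp add: pos_divide_le_eq mult.commute)
    then have "measure lborel A \<le> q ^ n" using A(4) by simp
    then show "\<exists>A. ?P n A"
      using A(1-3) by blast
  qed
  from choice[OF this] obtain A :: "nat \<Rightarrow> real set" where A: "\<And>n. A n \<in> sets lborel"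
    "\<And>n t. \<lfloor>of_int b ^ n * t\<rfloor> \<in> J n \<Longrightarrow> t \<in> A n"
    "\<And>n. emeasure lborel (A n) < \<infinity>" "\<And>n. measure lborel (A n) \<le> q ^ n"
    by blast
  have sm: "summable (\<lambda>n. q ^ n)" using q by (simp add: summable_geometric)
  have "summable (\<lambda>n. measure lborel (A n))"
    by (rule summable_comparison_test'[OF sm, of 0]) (simp add: A(4))
  from borel_cantelli_AE1[OF A(1,3) this]
  show ?thesis
  proof eventually_elim
    case (elim t)
    show ?case
    proof (intro impI)
      assume t: "0 \<le> t" "t < 1"
      show "\<forall>\<^sub>F n in sequentially. walk_sum b g Y n \<lfloor>of_int b ^ n * t\<rfloor> < \<epsilon> * n"
        using elim
      proof eventually_elim
        case (elim n)
        have bn: "(of_int b :: real) ^ n > 0" using b by simp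
        have "of_int b ^ n * t < of_int b ^ n" using bn t by simp
        then have "\<lfloor>of_int b ^ n * t\<rfloor> < b ^ n" by (simp add: floor_less_iff)
        moreover have "0 \<le> \<lfloor>of_int b ^ n * t\<rfloor>" using bn t by simp
        ultimately show ?case using A(2)[of n t] elim by (force simp: J_def)
      qed
    qed
  qed
qed

text \<open>Adding the coboundary of the truncated corrector \<open>H = \<Sum>k<m. L\<^sup>k \<psi>\<close> turns \<open>l - \<Lambda>\<close> into a function
  with small conditional mean, whose exponential moments along the walk are controlled step by step.\<close>

lemma walk_sum_average_AE:
  fixes b :: int and g l :: "int \<Rightarrow> real \<Rightarrow> real"
  assumes b: "b \<ge> 1" and \<rho>: "\<rho> \<ge> 0"
    and g: "\<And>i x. i \<in> {0..b-1} \<Longrightarrow> \<bar>x\<bar> \<le> \<rho> \<Longrightarrow> \<bar>g i x\<bar> \<le> \<rho>"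
    and l: "\<And>i x. i \<in> {0..b-1} \<Longrightarrow> \<bar>x\<bar> \<le> \<rho> \<Longrightarrow> \<bar>l i x\<bar> \<le> K"
    and unif: "\<And>\<epsilon>. \<epsilon> > 0 \<Longrightarrow> \<exists>n. \<forall>x. \<bar>x\<bar> \<le> \<rho> \<longrightarrow>
      \<bar>(transfer_op {0..b-1} (\<lambda>i. 1 / of_int b) g ^^ n) (\<lambda>x. \<Sum>i\<in>{0..b-1}. 1 / of_int b * l i x) x - \<Lambda>\<bar> \<le> \<epsilon>"
  shows "AE t :: real in lborel. 0 \<le> t \<longrightarrow> t < 1 \<longrightarrow>
    (\<lambda>n. walk_sum b g l n \<lfloor>of_int b ^ n * t\<rfloor> / n) \<longlonglongrightarrow> \<Lambda>"
proof -
  let ?I = "{0..b-1}"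
  let ?L = "transfer_op ?I (\<lambda>i. 1 / of_int b) g"
  define \<psi> where "\<psi> = (\<lambda>x. \<Sum>i\<in>?I. 1 / of_int b * l i x)"
  have K: "K \<ge> 0" using l[of 0 0] b \<rho> by force
  have L_bound: "\<bar>?L \<phi> x\<bar> \<le> c" if "\<And>i. i \<in> ?I \<Longrightarrow> \<bar>\<phi> (g i x)\<bar> \<le> c" for \<phi> :: "real \<Rightarrow> real" and x c
  proof -
    have "\<bar>?L \<phi> x\<bar> \<le> (\<Sum>i\<in>?I. 1 / of_int b * c)"
      unfolding transfer_op_def using that b
      by (intro order_trans[OF sum_abs] sum_mono) (simp add: abs_mult divide_right_mono)
    then show ?thesis using b by simp
  qed
  have iter_bound: "\<bar>(?L ^^ n) \<psi> x\<bar> \<le> K" if "\<bar>x\<bar> \<le> \<rho>" for n x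
    using that
  proof (induction n arbitrary: x)
    case 0
    have "\<bar>\<psi> x\<bar> \<le> (\<Sum>i\<in>?I. 1 / of_int b * K)"
      unfolding \<psi>_def using l[OF _ 0] b
      by (intro order_trans[OF sum_abs] sum_mono) (simp add: abs_mult divide_right_mono)
    then show ?case using b by simp
  next
    case (Suc n)
    have "\<bar>?L ((?L ^^ n) \<psi>) x\<bar> \<le> K"
      using g Suc.prems by (intro L_bound Suc.IH) auto
    then show ?case by simp
  qed
  have dev: "AE t :: real in lborel. 0 \<le> t \<longrightarrow> t < 1 \<longrightarrow>
    (\<forall>\<^sub>F n in sequentially. \<bar>walk_sum b g l n \<lfloor>of_int b ^ n * t\<rfloor> / n - \<Lambda>\<bar> \<le> 2 * \<epsilon>)" if "\<epsilon> > 0" for \<epsilon>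
  proof -
    obtain m where m: "\<And>x. \<bar>x\<bar> \<le> \<rho> \<Longrightarrow> \<bar>(?L ^^ m) \<psi> x - \<Lambda>\<bar> \<le> \<epsilon> / 2"
      using unif[of "\<epsilon> / 2"] \<open>\<epsilon> > 0\<close> unfolding \<psi>_def by (auto simp del: atLeastAtMost_iff)
    define H where "H x = (\<Sum>k<m. (?L ^^ k) \<psi> x)" for x
    define C where "C = real m * K"
    have H: "\<bar>H x\<bar> \<le> C" if "\<bar>x\<bar> \<le> \<rho>" for x
    proof -
      have "\<bar>H x\<bar> \<le> (\<Sum>k<m. K)"
        unfolding H_def using that by (intro order_trans[OF sum_abs] sum_mono iter_bound)
      then show ?thesis by (simp add: C_def)
    qed
    \<comment> \<open>The sign \<open>\<sigma> = 1\<close> or \<open>\<sigma> = -1\<close> lets one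
      one-sided estimate control both tails.\<close>
    define Y where "Y \<sigma> i x = \<sigma> * (l i x - \<Lambda> + (H (g i x) - H x))" for \<sigma> :: real and i x
    define K' where "K' = K + \<bar>\<Lambda>\<bar> + 2 * C + 1"
    have C: "C \<ge> 0" using K by (simp add: C_def)
    have Y: "\<bar>Y \<sigma> i x\<bar> \<le> K'" if "\<bar>\<sigma>\<bar> = 1" "i \<in> ?I" "\<bar>x\<bar> \<le> \<rho>" for \<sigma> i x
    proof -
      have "\<bar>Y \<sigma> i x\<bar> = \<bar>l i x - \<Lambda> + (H (g i x) - H x)\<bar>" using that(1) by (simp add: Y_def abs_mult)
      then show ?thesis
        using l[OF that(2,3)] H[OF that(3)] H[OF g[OF that(2,3)]] unfolding K'_def by linarith
    qed
    have mean: "(\<Sum>i\<in>?I. Y \<sigma> i x) \<le> of_int b * (\<epsilon> / 2)" if "\<bar>\<sigma>\<bar> = 1" "\<bar>x\<bar> \<le> \<rho>" for \<sigma> x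
    proof -
      \<comment> \<open>The corrector solves \<open>L H - H = L\<^sup>m \<psi> - \<psi>\<close>. The
        average of \<open>Y\<close> thus involves only the \<open>m\<close>-th iterate, which is
        within \<open>\<epsilon> / 2\<close> of \<open>\<Lambda>\<close>.\<close>
      have "?L H x = (\<Sum>k<m. (?L ^^ Suc k) \<psi> x)"
        unfolding H_def transfer_op_def scaleR_sum_right by (subst sum.swap) (simp add: transfer_op_def)
      then have "?L H x - H x = (\<Sum>k<m. (?L ^^ Suc k) \<psi> x - (?L ^^ k) \<psi> x)"
        by (simp add: H_def sum_subtractf)
      also have "\<dots> = (?L ^^ m) \<psi> x - (?L ^^ 0) \<psi> x" by (rule sum_lessThan_telescope)
      finally have LH: "?L H x - H x = (?L ^^ m) \<psi> x - \<psi> x" by simp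
      have "(\<Sum>i\<in>?I. Y \<sigma> i x) = \<sigma> * of_int b * (\<psi> x - \<Lambda> + (?L H x - H x))"
        using b unfolding Y_def \<psi>_def transfer_op_def
        by (simp add: sum.distrib sum_subtractf algebra_simps flip: sum_distrib_left sum_divide_distrib)
      also have "\<dots> = of_int b * (\<sigma> * ((?L ^^ m) \<psi> x - \<Lambda>))"
        unfolding LH by simp
      also have "\<sigma> * ((?L ^^ m) \<psi> x - \<Lambda>) \<le> \<bar>\<sigma>\<bar> * \<bar>(?L ^^ m) \<psi> x - \<Lambda>\<bar>"
        by (metis abs_ge_self abs_mult)
      also have "\<dots> \<le> \<epsilon> / 2" using m[OF that(2)] that(1) by simp
      finally show ?thesis using b by simp
    qed
    have walk: "\<bar>walk b g n j\<bar> \<le> \<rho>" for n j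
    proof (induction n arbitrary: j)
      case (Suc n)
      have "j mod b \<in> ?I" using b by (simp add: pos_mod_bound[of b j])
      then show ?case using g Suc by simp
    qed (simp add: \<rho>)
    have sum_Y: "walk_sum b g (Y \<sigma>) n j = \<sigma> * (walk_sum b g l n j - n * \<Lambda> + (H (walk b g n j) - H 0))" for \<sigma> n j
      by (induction n arbitrary: j) (simp_all add: Y_def algebra_simps)
    have K': "K' > 0" using K C by (simp add: K'_def)
    have small: "AE t :: real in lborel. 0 \<le> t \<longrightarrow> t < 1 \<longrightarrow>
        (\<forall>\<^sub>F n in sequentially. walk_sum b g (Y \<sigma>) n \<lfloor>of_int b ^ n * t\<rfloor> < \<epsilon> * n)" if "\<bar>\<sigma>\<bar> = 1" for \<sigma>
      by (rule walk_sum_small_eventually[where \<rho> = \<rho> and K = K'])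
        (use b \<rho> g Y[OF that] mean[OF that] \<open>\<epsilon> > 0\<close> K' in auto)
    \<comment> \<open>The coboundary telescopes along the walk to a difference of at most
      \<open>2 * C\<close>, which the second \<open>\<epsilon>\<close> in the bound
      \<open>2 * \<epsilon>\<close> absorbs for large \<open>n\<close>.\<close>
    have large: "\<forall>\<^sub>F n in sequentially. 2 * C / \<epsilon> < real n \<and> 0 < n"
      by (intro eventually_conj eventually_gt_at_top)
        (use filterlim_real_sequentially eventually_compose_filterlim eventually_gt_at_top in blast)
    from small[of 1, simplified] small[of "- 1", simplified] show ?thesis
    proof eventually_elim
      case (elim t)
      show ?case
      proof (intro impI)
        assume "0 \<le> t" "t < 1"
        with elim have "\<forall>\<^sub>F n in sequentially. walk_sum b g (Y 1) n \<lfloor>of_int b ^ n * t\<rfloor> < \<epsilon> * n"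
          "\<forall>\<^sub>F n in sequentially. walk_sum b g (Y (- 1)) n \<lfloor>of_int b ^ n * t\<rfloor> < \<epsilon> * n" by auto
        then show "\<forall>\<^sub>F n in sequentially. \<bar>walk_sum b g l n \<lfloor>of_int b ^ n * t\<rfloor> / n - \<Lambda>\<bar> \<le> 2 * \<epsilon>"
          using large
        proof eventually_elim
          case (elim n)
          let ?j = "\<lfloor>of_int b ^ n * t\<rfloor>"
          have n: "real n > 0" using elim by simp
          have "2 * C < \<epsilon> * n" using elim(3) \<open>\<epsilon> > 0\<close> by (simp add: pos_divide_less_eq mult.commute)
          moreover have "\<bar>H (walk b g n ?j)\<bar> \<le> C" "\<bar>H 0\<bar> \<le> C" using H walk \<rho> by auto
          moreover have "(walk_sum b g l n ?j - n * \<Lambda>) + (H (walk b g n ?j) - H 0) < \<epsilon> * n"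
            "- ((walk_sum b g l n ?j - n * \<Lambda>) + (H (walk b g n ?j) - H 0)) < \<epsilon> * n"
            using elim(1,2) unfolding sum_Y by simp_all
          moreover have "2 * \<epsilon> * n = \<epsilon> * n + \<epsilon> * n" by simp
          ultimately have "\<bar>walk_sum b g l n ?j - n * \<Lambda>\<bar> \<le> 2 * \<epsilon> * n"
            by arith
          moreover have "walk_sum b g l n ?j / n - \<Lambda> = (walk_sum b g l n ?j - n * \<Lambda>) / n"
            using n by (simp add: diff_divide_distrib)
          ultimately show ?case using n by (simp add: abs_divide pos_divide_le_eq)
        qed
      qed
    qed
  qed
  have "AE t :: real in lborel. \<forall>k. 0 \<le> t \<longrightarrow> t < 1 \<longrightarrow>
    (\<forall>\<^sub>F n in sequentially. \<bar>walk_sum b g l n \<lfloor>of_int b ^ n * t\<rfloor> / n - \<Lambda>\<bar> \<le> 2 * (1 / real (Suc k)))"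
    unfolding AE_all_countable by (intro allI dev) simp
  then show ?thesis
  proof eventually_elim
    case (elim t)
    show ?case
    proof (intro impI tendstoI)
      fix e :: real assume t: "0 \<le> t" "t < 1" and e: "e > 0"
      obtain k where k: "inverse (real (Suc k)) < e / 2" using reals_Archimedean[of "e / 2"] e by auto
      have "\<forall>\<^sub>F n in sequentially. \<bar>walk_sum b g l n \<lfloor>of_int b ^ n * t\<rfloor> / n - \<Lambda>\<bar> \<le> 2 * (1 / real (Suc k))"
        using elim t by blast
      then show "\<forall>\<^sub>F n in sequentially. dist (walk_sum b g l n \<lfloor>of_int b ^ n * t\<rfloor> / n) \<Lambda> < e"
      proof eventually_elim
        case (elim n)
        then show ?case using k by (simp add: dist_real_def inverse_eq_divide)
      qed
    qed
  qed
qed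

section \<open>Prefixes and carries\<close>

primrec prefixes :: "int \<Rightarrow> int set \<Rightarrow> nat \<Rightarrow> int set" where
  "prefixes b D 0 = {0}"
| "prefixes b D (Suc n) = (\<lambda>(y, x). b * y + x) ` (prefixes b D n \<times> D)"

text \<open>If \<open>T = \<lfloor>b\<^sup>n t\<rfloor>\<close>, these are the prefixes of the points of \<open>(K\<^sub>1 + t) \<inter> K\<^sub>2\<close>: \<open>j\<close> is the carry coming
  in from the later digits and \<open>k\<close> the carry lost in the reduction modulo \<open>1\<close>.\<close>

definition matching :: "int \<Rightarrow> int set \<Rightarrow> int set \<Rightarrow> nat \<Rightarrow> int \<Rightarrow> int set"
  where "matching b D1 D2 n T = {y \<in> prefixes b D2 n. \<exists>x\<in>prefixes b D1 n. \<exists>j\<in>{0, 1}. \<exists>k\<in>{0, 1}.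
    x + T + j = y + k * b ^ n}"

definition entry_sum :: "real^2^2 \<Rightarrow> real"
  where "entry_sum M = M $ 1 $ 1 + M $ 1 $ 2 + M $ 2 $ 1 + M $ 2 $ 2"

text \<open>A block of \<open>n\<close> digits is treated as one digit to the base
  \<open>b ^ n\<close>, so that blocks obey the same carry rules as single digits.\<close>

definition prefix_matrix :: "int \<Rightarrow> int set \<Rightarrow> int set \<Rightarrow> nat \<Rightarrow> int \<Rightarrow> real^2^2"
  where "prefix_matrix b D1 D2 n T = digit_matrix (b ^ n) (prefixes b D1 n) (prefixes b D2 n) T"

lemma digit_count_alt: "digit_count b D1 D2 i j k = card {d \<in> D1. d + i + j - k * b \<in> D2}"
proof -
  have "(\<lambda>d. d + i + j) ` D1 \<inter> (\<lambda>d. d + k * b) ` D2 = (\<lambda>d. d + i + j) ` {d \<in> D1. d + i + j - k * b \<in> D2}"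
    by (auto simp: image_iff) (metis add.commute diff_add_cancel)+
  moreover have "inj_on (\<lambda>d. d + i + j) {d \<in> D1. d + i + j - k * b \<in> D2}" by (simp add: inj_on_def)
  ultimately show ?thesis by (simp add: digit_count_def card_image)
qed

text \<open>Adding with carry: the carry out of the low block is the carry into the high block.\<close>

lemma digit_count_compose:
  fixes c B T T' j k :: int
  assumes c: "c > 0" and X: "X1 \<subseteq> {0..<c}" "X2 \<subseteq> {0..<c}" and T': "0 \<le> T'" "T' < c" and j: "j \<in> {0, 1}"
    and fin: "finite Y1"
  shows "digit_count (c * B) ((\<lambda>(y, x). c * y + x) ` (Y1 \<times> X1)) ((\<lambda>(y, x). c * y + x) ` (Y2 \<times> X2)) (c * T + T') j k =
    digit_count c X1 X2 T' j 0 * digit_count B Y1 Y2 T 0 k + digit_count c X1 X2 T' j 1 * digit_count B Y1 Y2 T 1 k"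
proof -
  let ?f = "\<lambda>(y, x). c * y + x :: int"
  \<comment> \<open>Pairs of high and low blocks with internal carry \<open>l\<close>. The carry is
    determined by the pair because the low block of the result must lie in {0..<c}.\<close>
  define U where "U l = {y \<in> Y1. y + T + l - k * B \<in> Y2} \<times> {x \<in> X1. x + T' + j - l * c \<in> X2}" for l
  have uniq: "y = y' \<and> x = x'" if "c * y + x = c * y' + x'" "x \<in> {0..<c}" "x' \<in> {0..<c}" for x x' y y' :: int
  proof -
    have "(c * y + x) div c = y" "(c * y' + x') div c = y'" using that(2,3) c by auto
    then show ?thesis using that(1) by auto
  qed
  have inj: "inj_on ?f (Y1 \<times> X1)"
  proof (rule inj_onI)
    fix p q assume pq: "p \<in> Y1 \<times> X1" "q \<in> Y1 \<times> X1" "?f p = ?f q"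
    then have "snd p \<in> {0..<c}" "snd q \<in> {0..<c}" using X(1) by auto
    then show "p = q"
      using uniq[of "fst p" "snd p" "fst q" "snd q"] pq(3) by (simp add: case_prod_unfold prod_eq_iff)
  qed
  have "{d \<in> ?f ` (Y1 \<times> X1). d + (c * T + T') + j - k * (c * B) \<in> ?f ` (Y2 \<times> X2)} = ?f ` (U 0 \<union> U 1)"
  proof (intro equalityI subsetI)
    fix d assume "d \<in> {d \<in> ?f ` (Y1 \<times> X1). d + (c * T + T') + j - k * (c * B) \<in> ?f ` (Y2 \<times> X2)}"
    then obtain y x y2 x2 where *: "y \<in> Y1" "x \<in> X1" "d = c * y + x" "y2 \<in> Y2" "x2 \<in> X2"
      "c * y + x + (c * T + T') + j - k * (c * B) = c * y2 + x2" by auto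
    have x: "0 \<le> x" "x < c" "0 \<le> x2" "x2 < c" using * X by auto
    define l where "l = y2 - y - T + k * B"
    have e: "x + T' + j = c * l + x2" using *(6) by (simp add: l_def algebra_simps)
    have l: "l \<in> {0, 1}"
    proof -
      have j: "0 \<le> j" "j \<le> 1" using \<open>j \<in> {0, 1}\<close> by auto
      \<comment> \<open>The low blocks and \<open>T'\<close> lie in {0..<c} and \<open>j\<close> is
        at most 1, so the carry is strictly between -1 and 2.\<close>
      have "c * l < c * 2" "c * (- 1) < c * l" using e x T' j by linarith+
      then have "l < 2" "- 1 < l" using c by (simp_all only: mult_less_cancel_left_pos)
      then show ?thesis by auto
    qed
    have "y + T + l - k * B = y2" "x + T' + j - l * c = x2" using e by (simp_all add: l_def algebra_simps)
    then have "(y, x) \<in> U l" using * by (simp add: U_def)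
    then show "d \<in> ?f ` (U 0 \<union> U 1)" using l *(3) by (auto intro!: image_eqI[where x = "(y, x)"])
  next
    fix d assume "d \<in> ?f ` (U 0 \<union> U 1)"
    then obtain y x l where *: "l \<in> {0, 1}" "(y, x) \<in> U l" "d = c * y + x" by auto
    have mem: "(y, x) \<in> Y1 \<times> X1" "(y + T + l - k * B, x + T' + j - l * c) \<in> Y2 \<times> X2"
      using *(2) by (auto simp: U_def)
    have eq: "d + (c * T + T') + j - k * (c * B) = ?f (y + T + l - k * B, x + T' + j - l * c)"
      using *(3) by (simp add: algebra_simps)
    have "d = ?f (y, x)" using *(3) by simp
    then show "d \<in> {d \<in> ?f ` (Y1 \<times> X1). d + (c * T + T') + j - k * (c * B) \<in> ?f ` (Y2 \<times> X2)}"
      unfolding mem_Collect_eq eq using mem by (blast intro: imageI)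
  qed
  moreover have "card (?f ` (U 0 \<union> U 1)) = card (U 0 \<union> U 1)"
    by (rule card_image, rule inj_on_subset[OF inj]) (auto simp: U_def)
  moreover have "card (U 0 \<union> U 1) = card (U 0) + card (U 1)"
  proof (rule card_Un_disjoint)
    have "finite X1" using X(1) finite_subset by blast
    then show "finite (U 0)" "finite (U 1)" using fin by (auto simp: U_def)
    show "U 0 \<inter> U 1 = {}" by (auto simp: U_def dest!: subsetD[OF X(2)])
  qed
  moreover have "card (U l) = digit_count c X1 X2 T' j l * digit_count B Y1 Y2 T l k" for l
    by (simp add: U_def card_cartesian_product digit_count_alt mult.commute)
  ultimately show ?thesis by (simp add: digit_count_alt)
qed

text \<open>Rows index the incoming carry and columns the outgoing one. The low block receives the
  outer carry and passes its own upwards, hence it stands on the left of the product.\<close>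

lemma digit_matrix_compose:
  fixes c B T T' :: int
  assumes "c > 0" "X1 \<subseteq> {0..<c}" "X2 \<subseteq> {0..<c}" "0 \<le> T'" "T' < c" "finite Y1"
  shows "digit_matrix (c * B) ((\<lambda>(y, x). c * y + x) ` (Y1 \<times> X1)) ((\<lambda>(y, x). c * y + x) ` (Y2 \<times> X2)) (c * T + T') =
    digit_matrix c X1 X2 T' ** digit_matrix B Y1 Y2 T"
  unfolding vec_eq_iff forall_2 matrix_matrix_mult_def
  by (simp add: digit_matrix_def sum_2 digit_count_compose[OF assms(1-5) _ assms(6)])

lemma finite_prefixes: "finite D \<Longrightarrow> finite (prefixes b D n)"
  by (induction n) auto

lemma prefixes_bounds:
  assumes "b > 0" "D \<subseteq> {0..b-1}" "x \<in> prefixes b D n"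
  shows "0 \<le> x" "x < b ^ n"
proof -
  have "0 \<le> x \<and> x < b ^ n" using assms(3)
  proof (induction n arbitrary: x)
    case (Suc n)
    then obtain y d where yd: "y \<in> prefixes b D n" "d \<in> D" "x = b * y + d" by auto
    have "0 \<le> y" "y + 1 \<le> b ^ n" using Suc.IH[OF yd(1)] by auto
    then have "b * (y + 1) \<le> b * b ^ n" using assms(1) by (intro mult_left_mono) auto
    moreover have "0 \<le> d" "d < b" using yd(2) assms(2) by auto
    ultimately show ?case using \<open>0 \<le> y\<close> assms(1) yd(3) by (simp add: distrib_left)
  qed simp
  then show "0 \<le> x" "x < b ^ n" by auto
qed

lemma prefixes_add:
  "prefixes b D (n + k) = (\<lambda>(y, x). b ^ k * y + x) ` (prefixes b D n \<times> prefixes b D k)"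
proof (induction k)
  case 0
  show ?case by (force simp: image_iff)
next
  case (Suc k)
  show ?case
  proof (intro equalityI subsetI)
    fix z assume "z \<in> prefixes b D (n + Suc k)"
    then obtain y x d where "y \<in> prefixes b D n" "x \<in> prefixes b D k" "d \<in> D" "z = b * (b ^ k * y + x) + d"
      using Suc by auto
    then have "(y, b * x + d) \<in> prefixes b D n \<times> prefixes b D (Suc k)" "z = b ^ Suc k * y + (b * x + d)"
      by (auto simp: distrib_left mult.assoc)
    then show "z \<in> (\<lambda>(y, x). b ^ Suc k * y + x) ` (prefixes b D n \<times> prefixes b D (Suc k))"
      by force
  next
    fix z assume "z \<in> (\<lambda>(y, x). b ^ Suc k * y + x) ` (prefixes b D n \<times> prefixes b D (Suc k))"
    then obtain y x d where "y \<in> prefixes b D n" "x \<in> prefixes b D k" "d \<in> D" "z = b ^ Suc k * y + (b * x + d)"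
      by auto
    moreover from this have "b ^ k * y + x \<in> prefixes b D (n + k)" unfolding Suc by force
    moreover have "b ^ Suc k * y + (b * x + d) = b * (b ^ k * y + x) + d"
      by (simp add: distrib_left mult.assoc)
    ultimately show "z \<in> prefixes b D (n + Suc k)" by force
  qed
qed

lemma prefix_matrix_add:
  assumes "b > 0" "D1 \<subseteq> {0..b-1}" "D2 \<subseteq> {0..b-1}" "0 \<le> T'" "T' < b ^ k"
  shows "prefix_matrix b D1 D2 (n + k) (b ^ k * T + T') = prefix_matrix b D1 D2 k T' ** prefix_matrix b D1 D2 n T"
proof -
  have fin: "finite D1" using assms(2) finite_subset by blast
  have sub: "prefixes b D1 k \<subseteq> {0..<b ^ k}" "prefixes b D2 k \<subseteq> {0..<b ^ k}"
    using prefixes_bounds[OF assms(1,2)] prefixes_bounds[OF assms(1,3)] by auto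
  show ?thesis
    unfolding prefix_matrix_def prefixes_add power_add mult.commute[of "b ^ n"]
    using assms by (intro digit_matrix_compose sub finite_prefixes fin) auto
qed

lemma prefix_matrix_Suc:
  assumes "b > 0" "D1 \<subseteq> {0..b-1}" "D2 \<subseteq> {0..b-1}"
  shows "prefix_matrix b D1 D2 (Suc n) T = digit_matrix b D1 D2 (T mod b) ** prefix_matrix b D1 D2 n (T div b)"
proof -
  have "prefix_matrix b D1 D2 1 i = digit_matrix b D1 D2 i" for i
    by (simp add: prefix_matrix_def image_image case_prod_unfold flip: insert_is_Un)
      (simp add: image_def)
  then show ?thesis
    using prefix_matrix_add[OF assms, of "T mod b" 1 n "T div b"] assms(1) by simp
qed

lemma prefix_matrix_0: "prefix_matrix b D1 D2 0 0 = mat 1"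
proof -
  have "{d \<in> {0 :: int}. d + 0 + j - k * 1 \<in> {0}} = (if j = k then {0} else {})" for j k :: int by auto
  then show ?thesis
    by (simp add: prefix_matrix_def vec_eq_iff forall_2 digit_matrix_def digit_count_alt mat_def)
qed

lemma entry_sum_prefix_matrix:
  "entry_sum (prefix_matrix b D1 D2 n T) = real (\<Sum>j\<in>{0, 1}. \<Sum>k\<in>{0, 1}. digit_count (b ^ n) (prefixes b D1 n) (prefixes b D2 n) T j k)"
  by (simp add: entry_sum_def prefix_matrix_def digit_matrix_def)

lemma matching_finite: "finite D2 \<Longrightarrow> finite (matching b D1 D2 n T)"
  by (auto simp: matching_def finite_prefixes)

lemma matching_eq_UN:
  "matching b D1 D2 n T = (\<Union>j\<in>{0, 1}. \<Union>k\<in>{0, 1}.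
    (\<lambda>d. d + T + j - k * b ^ n) ` {d \<in> prefixes b D1 n. d + T + j - k * b ^ n \<in> prefixes b D2 n})"
proof -
  have "x + T + j = y + k * b ^ n \<longleftrightarrow> y = x + T + j - k * b ^ n" for x y j k by auto
  then show ?thesis by (auto simp: matching_def)
qed

lemma card_matching_le:
  assumes "finite D1"
  shows "card (matching b D1 D2 n T) \<le> entry_sum (prefix_matrix b D1 D2 n T)"
proof -
  have fin: "finite {d \<in> prefixes b D1 n. d + T + j - k * b ^ n \<in> prefixes b D2 n}" for j k
    using finite_prefixes[OF assms, of b n] by simp
  have "card (matching b D1 D2 n T) \<le> (\<Sum>j\<in>{0, 1}. card (\<Union>k\<in>{0, 1}.
    (\<lambda>d. d + T + j - k * b ^ n) ` {d \<in> prefixes b D1 n. d + T + j - k * b ^ n \<in> prefixes b D2 n}))"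
    unfolding matching_eq_UN by (rule card_UN_le) simp
  also have "\<dots> \<le> (\<Sum>j\<in>{0, 1}. \<Sum>k\<in>{0, 1}. card
    ((\<lambda>d. d + T + j - k * b ^ n) ` {d \<in> prefixes b D1 n. d + T + j - k * b ^ n \<in> prefixes b D2 n}))"
    by (intro sum_mono card_UN_le) simp
  also have "\<dots> \<le> (\<Sum>j\<in>{0, 1}. \<Sum>k\<in>{0, 1}. digit_count (b ^ n) (prefixes b D1 n) (prefixes b D2 n) T j k)"
    unfolding digit_count_alt by (intro sum_mono card_image_le fin)
  finally show ?thesis unfolding entry_sum_prefix_matrix by (simp only: of_nat_le_iff)
qed

text \<open>For fixed carries the prefix of the first set is recovered from that of the second, so
  each of the four entries is at most the number of matching prefixes.\<close>

lemma entry_sum_le_card_matching: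
  assumes "finite D2"
  shows "entry_sum (prefix_matrix b D1 D2 n T) \<le> 4 * card (matching b D1 D2 n T)"
proof -
  have "digit_count (b ^ n) (prefixes b D1 n) (prefixes b D2 n) T j k \<le> card (matching b D1 D2 n T)"
    if "j \<in> {0, 1}" "k \<in> {0, 1}" for j k
  proof -
    have "inj_on (\<lambda>d. d + T + j - k * b ^ n) {d \<in> prefixes b D1 n. d + T + j - k * b ^ n \<in> prefixes b D2 n}"
      by (simp add: inj_on_def)
    then show ?thesis
      unfolding digit_count_alt
      by (rule card_inj_on_le) (use that matching_finite[OF assms] in \<open>auto simp: matching_eq_UN\<close>)
  qed
  then have "(\<Sum>j\<in>{0, 1}. \<Sum>k\<in>{0, 1}. digit_count (b ^ n) (prefixes b D1 n) (prefixes b D2 n) T j k) \<le>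
      (\<Sum>j\<in>{0, 1 :: int}. \<Sum>k\<in>{0, 1 :: int}. card (matching b D1 D2 n T))"
    by (intro sum_mono)
  then show ?thesis unfolding entry_sum_prefix_matrix by simp
qed

text \<open>The low block keeps the incoming carry, and the carry \<open>j'\<close> that it passes
  to the high block lies in {0, 1} by the size of the blocks. This bounds how many matching prefixes
  share a high block.\<close>

lemma matching_mod:
  assumes b: "b > 0" and D: "D1 \<subseteq> {0..b-1}" "D2 \<subseteq> {0..b-1}" and T': "0 \<le> T'" "T' < b ^ k"
    and y: "y \<in> matching b D1 D2 (n + k) (b ^ k * T + T')"
  shows "y mod b ^ k \<in> matching b D1 D2 k T'"
proof -
  obtain x j l where x: "x \<in> prefixes b D1 (n + k)" "y \<in> prefixes b D2 (n + k)" "j \<in> {0, 1}" "l \<in> {0, 1}"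
    "x + (b ^ k * T + T') + j = y + l * b ^ (n + k)"
    using y unfolding matching_def by blast
  obtain x1 x2 where x12: "x = b ^ k * x1 + x2" "x2 \<in> prefixes b D1 k"
    using x(1) unfolding prefixes_add by auto
  obtain y1 y2 where y12: "y = b ^ k * y1 + y2" "y2 \<in> prefixes b D2 k"
    using x(2) unfolding prefixes_add by auto
  note bx = prefixes_bounds[OF b D(1) x12(2)] and by' = prefixes_bounds[OF b D(2) y12(2)]
  have y2: "y mod b ^ k = y2" using y12(1) by' by simp
  define j' where "j' = y1 + l * b ^ n - x1 - T"
  have e: "x2 + T' + j = y2 + j' * b ^ k"
    using x(5) by (simp add: j'_def x12 y12 power_add algebra_simps)
  have bk: "b ^ k > 0" using b by simp
  have "0 \<le> j" "j \<le> 1" using x(3) by auto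
  have "j' \<in> {0, 1}"
  proof -
    have "j' * b ^ k < 2 * b ^ k" "(- 1) * b ^ k < j' * b ^ k" using e bx by' T' \<open>0 \<le> j\<close> \<open>j \<le> 1\<close> by linarith+
    then have "j' < 2" "- 1 < j'" using bk by (simp_all only: mult_less_cancel_right_pos)
    then show ?thesis by auto
  qed
  then show ?thesis
    unfolding y2 matching_def using x12(2) y12(2) x(3) e by blast
qed

section \<open>Hausdorff dimension of the intersections\<close>

primrec digit_prefix :: "int \<Rightarrow> (nat \<Rightarrow> int) \<Rightarrow> nat \<Rightarrow> int" where
  "digit_prefix b d 0 = 0"
| "digit_prefix b d (Suc n) = b * digit_prefix b d n + d (Suc n)"

definition digit_value :: "int \<Rightarrow> (nat \<Rightarrow> int) \<Rightarrow> real"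
  where "digit_value b d = (\<Sum>n. real_of_int (d (Suc n)) / real_of_int b ^ Suc n)"

lemma digit_set_eq: "digit_set b D = (\<lambda>d. to_circle (digit_value b d)) ` {d. \<forall>n\<ge>1. d n \<in> D}"
  by (auto simp: digit_set_def digit_value_def)

lemma digit_prefix_mem:
  assumes "\<forall>n\<ge>1. d n \<in> D"
  shows "digit_prefix b d n \<in> prefixes b D n"
proof (induction n)
  case (Suc n)
  have "d (Suc n) \<in> D" using assms by simp
  then show ?case using Suc by force
qed simp

context
  fixes b :: int
  assumes b: "b \<ge> 2"
begin

lemma partial_sum_digits:
  "(\<Sum>k<n. real_of_int (d (Suc k)) / real_of_int b ^ Suc k) = digit_prefix b d n / real_of_int b ^ n"
proof (induction n)
  case (Suc n)
  have "real_of_int b \<noteq> 0" using b by simp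
  then show ?case unfolding sum.lessThan_Suc Suc.IH by (simp add: add_divide_distrib)
qed simp

lemma digit_term_bound:
  assumes "x \<in> {0..b-1}"
  shows "\<bar>real_of_int x / real_of_int b ^ Suc n\<bar> \<le> (1 / real_of_int b) ^ n"
proof -
  have "0 \<le> real_of_int x / real_of_int b" "real_of_int x / real_of_int b \<le> 1" using assms b by simp_all
  then have "real_of_int x / real_of_int b * (1 / real_of_int b) ^ n \<le> 1 * (1 / real_of_int b) ^ n"
    using b by (intro mult_right_mono) auto
  moreover have "real_of_int x / real_of_int b ^ Suc n = real_of_int x / real_of_int b * (1 / real_of_int b) ^ n"
    by (simp add: power_one_over)
  moreover have "0 \<le> real_of_int x / real_of_int b ^ Suc n" using assms b by simp
  ultimately show ?thesis by (simp only: abs_of_nonneg mult_1_left)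
qed

lemma inverse_power_tendsto: "(\<lambda>n. 1 / real_of_int b ^ n) \<longlonglongrightarrow> 0"
  using LIMSEQ_realpow_zero[of "1 / real_of_int b"] b by (simp add: power_one_over)

lemma summable_inverse_power: "summable (\<lambda>n. (1 / real_of_int b) ^ n)"
  using b by (intro summable_geometric) simp

lemma digit_value_tendsto:
  assumes "\<forall>n\<ge>1. d n \<in> {0..b-1}"
  shows "(\<lambda>n. digit_prefix b d n / real_of_int b ^ n) \<longlonglongrightarrow> digit_value b d"
proof -
  have "summable (\<lambda>n. real_of_int (d (Suc n)) / real_of_int b ^ Suc n)"
    by (rule summable_comparison_test'[OF summable_inverse_power, of 0], unfold real_norm_def, rule digit_term_bound)
      (use assms in auto)
  from summable_LIMSEQ[OF this] show ?thesis
    unfolding partial_sum_digits digit_value_def .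
qed

text \<open>Nested intervals: the lower ends \<open>digit_prefix / b ^ n\<close> increase, the upper
  ends decrease, and both tend to the value.\<close>

lemma digit_value_bounds:
  assumes d: "\<forall>n\<ge>1. d n \<in> {0..b-1}"
  shows "of_int (digit_prefix b d n) \<le> of_int b ^ n * digit_value b d"
    and "of_int b ^ n * digit_value b d \<le> of_int (digit_prefix b d n) + 1"
proof -
  have bn: "real_of_int b ^ n > 0" for n using b by simp
  have step: "b * digit_prefix b d n \<le> digit_prefix b d (Suc n)"
    "digit_prefix b d (Suc n) + 1 \<le> b * (digit_prefix b d n + 1)" for n
  proof -
    have "0 \<le> d (Suc n)" "d (Suc n) \<le> b - 1" using d by auto
    then show "b * digit_prefix b d n \<le> digit_prefix b d (Suc n)"
      "digit_prefix b d (Suc n) + 1 \<le> b * (digit_prefix b d n + 1)" by (auto simp: distrib_left)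
  qed
  have "incseq (\<lambda>n. digit_prefix b d n / real_of_int b ^ n)"
  proof (rule incseq_SucI)
    fix n
    have "real_of_int (b * digit_prefix b d n) \<le> real_of_int (digit_prefix b d (Suc n))"
      using step(1) by (simp only: of_int_le_iff)
    then have "real_of_int (b * digit_prefix b d n) / real_of_int b ^ Suc n \<le> digit_prefix b d (Suc n) / real_of_int b ^ Suc n"
      using bn[of "Suc n"] by (intro divide_right_mono) auto
    then show "digit_prefix b d n / real_of_int b ^ n \<le> digit_prefix b d (Suc n) / real_of_int b ^ Suc n"
      using b by simp
  qed
  from incseq_le[OF this digit_value_tendsto[OF d], of n]
  show "of_int (digit_prefix b d n) \<le> of_int b ^ n * digit_value b d"
    using bn[of n] by (simp add: pos_divide_le_eq mult.commute)
  have "decseq (\<lambda>n. (digit_prefix b d n + 1) / real_of_int b ^ n)"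
  proof (rule decseq_SucI)
    fix n
    have "real_of_int (digit_prefix b d (Suc n) + 1) \<le> real_of_int (b * (digit_prefix b d n + 1))"
      using step(2) by (simp only: of_int_le_iff)
    then have "real_of_int (digit_prefix b d (Suc n) + 1) / real_of_int b ^ Suc n \<le>
        real_of_int (b * (digit_prefix b d n + 1)) / real_of_int b ^ Suc n"
      using bn[of "Suc n"] by (intro divide_right_mono) auto
    then show "(digit_prefix b d (Suc n) + 1) / real_of_int b ^ Suc n \<le> (digit_prefix b d n + 1) / real_of_int b ^ n"
      using b by simp
  qed
  moreover have "(\<lambda>n. (digit_prefix b d n + 1) / real_of_int b ^ n) \<longlonglongrightarrow> digit_value b d"
    using tendsto_add[OF digit_value_tendsto[OF d] inverse_power_tendsto] by (simp add: add_divide_distrib)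
  ultimately have "(digit_prefix b d n + 1) / real_of_int b ^ n \<ge> digit_value b d"
    by (rule decseq_ge)
  then show "of_int b ^ n * digit_value b d \<le> of_int (digit_prefix b d n) + 1"
    using bn[of n] by (simp add: pos_le_divide_eq mult.commute)
qed

text \<open>The digit sequences form a compact product of finite sets, and the digit series is
  continuous there as a uniform limit of partial sums. Compactness later provides finite
  subcovers.\<close>

lemma compact_digit_set:
  assumes "D \<subseteq> {0..b-1}"
  shows "compact (digit_set b D)"
proof -
  let ?S = "\<Pi>\<^sub>E n\<in>(UNIV :: nat set). D"
  let ?f = "\<lambda>d. \<Sum>n. real_of_int (d n) / real_of_int b ^ Suc n"
  have "compact D" using assms finite_subset by (intro finite_imp_compact) blast
  then have "compactin (product_topology (\<lambda>_. euclidean) UNIV) ?S"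
    by (simp add: compactin_PiE)
  then have S: "compact ?S"
    unfolding euclidean_product_topology compactin_euclidean_iff .
  have "continuous_on ?S ?f"
  proof (rule uniform_limit_theorem)
    show "uniform_limit ?S (\<lambda>n d. \<Sum>k<n. real_of_int (d k) / real_of_int b ^ Suc k) ?f sequentially"
      by (rule Weierstrass_m_test[OF _ summable_inverse_power], unfold real_norm_def, rule digit_term_bound)
        (use assms in \<open>auto simp: PiE_iff\<close>)
    have "continuous_on ?S (\<lambda>d. d k)" for k
      by (rule continuous_on_subset[OF continuous_on_product_coordinates]) simp
    then show "\<forall>\<^sub>F n in sequentially. continuous_on ?S (\<lambda>d. \<Sum>k<n. real_of_int (d k) / real_of_int b ^ Suc k)"
      using b by (intro always_eventually allI continuous_intros) auto
  qed simp
  then have "compact (to_circle ` ?f ` ?S)"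
    by (intro compact_continuous_image continuous_on_to_circle S)
  moreover have "digit_set b D = to_circle ` ?f ` ?S"
  proof -
    have "\<exists>d'\<in>?S. ?f d' = digit_value b d" if "\<forall>n\<ge>1. d n \<in> D" for d
      using that by (intro bexI[of _ "\<lambda>n. d (Suc n)"]) (auto simp: digit_value_def)
    moreover have "\<exists>d'. (\<forall>n\<ge>1. d' n \<in> D) \<and> digit_value b d' = ?f d" if "d \<in> ?S" for d
      using that by (intro exI[of _ "\<lambda>n. d (n - 1)"]) (auto simp: digit_value_def)
    ultimately show ?thesis
      unfolding digit_set_eq image_image by (auto simp: image_iff) metis+
  qed
  ultimately show ?thesis by simp
qed

lemma prefix_sequence_digits:
  assumes D: "D \<noteq> {}" and "E 0 \<in> prefixes b D m" and "\<And>n. \<exists>x\<in>D. E (Suc n) = b * E n + x"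
  shows "\<exists>d. (\<forall>n\<ge>1. d n \<in> D) \<and> (\<forall>n. digit_prefix b d (m + n) = E n)"
proof -
  have "\<exists>d. (\<forall>n\<ge>1. d n \<in> D) \<and> digit_prefix b d m = x" if "x \<in> prefixes b D m" for x
    using that
  proof (induction m arbitrary: x)
    case 0
    then show ?case using D by auto
  next
    case (Suc m)
    then obtain y c where yc: "y \<in> prefixes b D m" "c \<in> D" "x = b * y + c" by auto
    obtain d where d: "\<forall>n\<ge>1. d n \<in> D" "digit_prefix b d m = y" using Suc.IH[OF yc(1)] by blast
    have "digit_prefix b (d(Suc m := c)) k = digit_prefix b d k" if "k \<le> m" for k
      using that by (induction k) auto
    from this[of m] have "digit_prefix b (d(Suc m := c)) (Suc m) = x"
      using d(2) yc(3) by simp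
    moreover have "\<forall>n\<ge>1. (d(Suc m := c)) n \<in> D" using d(1) yc(2) by simp
    ultimately show ?case by blast
  qed
  then obtain d0 where d0: "\<forall>n\<ge>1. d0 n \<in> D" "digit_prefix b d0 m = E 0" using assms(2) by blast
  obtain x where x: "\<And>n. x n \<in> D" "\<And>n. E (Suc n) = b * E n + x n" using assms(3) by metis
  define d where "d n = (if n \<le> m then d0 n else x (n - Suc m))" for n
  have "digit_prefix b d k = digit_prefix b d0 k" if "k \<le> m" for k
    using that by (induction k) (auto simp: d_def)
  then have "digit_prefix b d (m + n) = E n" for n
    by (induction n) (auto simp: d0 x d_def)
  moreover have "d n \<in> D" if "n \<ge> 1" for n using d0(1) x(1) that by (auto simp: d_def)
  ultimately show ?thesis by blast
qed

end

lemma to_circle_eq_iff: "to_circle x = to_circle y \<longleftrightarrow> x - y \<in> \<int>"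
  using circle.abs_eq_iff by auto

lemma to_circle_add: "to_circle x + to_circle y = to_circle (x + y)"
  by (simp add: plus_circle.abs_eq)

text \<open>Both ends belong to the arc because a tail of digits may have the value 0 or 1 in units
  of the last place.\<close>

definition digit_arc :: "int \<Rightarrow> nat \<Rightarrow> int \<Rightarrow> circle set"
  where "digit_arc b n y = to_circle ` {of_int y / of_int b ^ n..of_int (y + 1) / of_int b ^ n}"

text \<open>\<open>nonadic\<close> puts the fractional part of \<open>b ^ n * t\<close> strictly
  between 0 and 1. Tails of digit expansions only lie in the closed interval, so this strictness is
  what confines carries to {0, 1}.\<close>

locale digit_translate =
  fixes b :: int and D1 D2 :: "int set" and t :: real
  assumes b: "b \<ge> 2" and D: "D1 \<subseteq> {0..b-1}" "D2 \<subseteq> {0..b-1}"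
    and t: "0 < t" "t < 1" and nonadic: "\<And>n. of_int b ^ n * t \<notin> \<int>"
begin

definition X where "X = (\<lambda>x. x + to_circle t) ` digit_set b D1 \<inter> digit_set b D2"

definition T where "T n = \<lfloor>of_int b ^ n * t\<rfloor>"

abbreviation R where "R n \<equiv> matching b D1 D2 n (T n)"

lemma bpos: "b > 0" "real_of_int b > 0" "real_of_int b ^ n > 0"
  using b by auto

lemma T_Suc: "T (Suc n) = b * T n + T (Suc n) mod b" "T (Suc n) mod b \<in> {0..b-1}"
proof -
  have "T (Suc n) div b = T n"
    unfolding T_def using bpos floor_divide_real_eq_div[of b "of_int b ^ Suc n * t"] by simp
  then show "T (Suc n) = b * T n + T (Suc n) mod b" by (metis mult_div_mod_eq)
  show "T (Suc n) mod b \<in> {0..b-1}" using pos_mod_bound[of b "T (Suc n)"] bpos by auto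
qed

lemma T_add: "\<exists>T'. 0 \<le> T' \<and> T' < b ^ k \<and> T (n + k) = b ^ k * T n + T'"
proof (induction k)
  case 0
  then show ?case by simp
next
  case (Suc k)
  then obtain T' where T': "0 \<le> T'" "T' + 1 \<le> b ^ k" "T (n + k) = b ^ k * T n + T'" by auto
  have "b * (T' + 1) \<le> b * b ^ k" using T' bpos by (intro mult_left_mono) auto
  then have "b * T' + T (Suc (n + k)) mod b < b ^ Suc k"
    using T_Suc(2)[of "n + k"] by (simp add: distrib_left)
  moreover have "T (n + Suc k) = b ^ Suc k * T n + (b * T' + T (Suc (n + k)) mod b)"
    using T_Suc(1)[of "n + k"] T'(3) by (simp add: distrib_left mult.assoc)
  moreover have "0 \<le> b * T' + T (Suc (n + k)) mod b" using T' T_Suc(2)[of "n + k"] bpos by simp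
  ultimately show ?case by blast
qed

lemma T_bounds: "of_int (T n) < of_int b ^ n * t" "of_int b ^ n * t < of_int (T n) + 1"
proof -
  have "of_int (T n) \<noteq> of_int b ^ n * t" using nonadic[of n] by (metis Ints_of_int)
  moreover have "of_int (T n) \<le> of_int b ^ n * t" unfolding T_def by linarith
  ultimately show "of_int (T n) < of_int b ^ n * t" by simp
  show "of_int b ^ n * t < of_int (T n) + 1" unfolding T_def by linarith
qed

lemma T_tendsto: "(\<lambda>n. T n / real_of_int b ^ n) \<longlonglongrightarrow> t"
proof (rule tendsto_sandwich[of "\<lambda>n. t - 1 / real_of_int b ^ n" _ _ "\<lambda>n. t"])
  show "(\<lambda>n. t - 1 / real_of_int b ^ n) \<longlonglongrightarrow> t"
    using tendsto_diff[OF tendsto_const inverse_power_tendsto[OF b], of t] by simp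
  show "\<forall>\<^sub>F n in sequentially. t - 1 / real_of_int b ^ n \<le> T n / real_of_int b ^ n"
  proof (intro always_eventually allI)
    fix n
    have "t - 1 / real_of_int b ^ n = (of_int b ^ n * t - 1) / real_of_int b ^ n"
      using b by (simp add: diff_divide_distrib)
    also have "\<dots> \<le> T n / real_of_int b ^ n"
      using bpos(3)[of n] T_bounds(2)[of n] by (intro divide_right_mono) auto
    finally show "t - 1 / real_of_int b ^ n \<le> T n / real_of_int b ^ n" .
  qed
  show "\<forall>\<^sub>F n in sequentially. T n / real_of_int b ^ n \<le> t"
    using T_bounds(1) bpos(3) by (intro always_eventually allI) (simp add: pos_divide_le_eq mult.commute less_imp_le)
qed simp

lemma compact_X: "compact X"
proof -
  have "continuous_on (digit_set b D1) (\<lambda>x. x + to_circle t)"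
  proof (rule continuous_onI)
    have "dist (x + to_circle t) (y + to_circle t) = dist x y" for x y
    proof (induction x rule: circle.abs_induct)
      case (1 x)
      show ?case
        by (induction y rule: circle.abs_induct) (simp add: to_circle_add dist_circle.abs_eq)
    qed
    then show "\<exists>d>0. \<forall>x'\<in>digit_set b D1. dist x' x < d \<longrightarrow> dist (x' + to_circle t) (x + to_circle t) \<le> e"
      if "0 < e" for e x using that by (auto intro!: exI[of _ e])
  qed
  then show ?thesis
    unfolding X_def using compact_digit_set[OF b] D
    by (intro compact_Int compact_continuous_image) auto
qed

text \<open>Two expansions meeting in a point of the circle differ, after translation, by an integer
  \<open>k\<close>, the carry lost modulo 1. Truncation after \<open>n\<close> digits turns this
  real equation into the integer equation of a matching pair.\<close>

lemma X_subset_arcs: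
  assumes "x \<in> X"
  shows "\<exists>y\<in>R n. x \<in> digit_arc b n y"
proof -
  obtain d e where d: "\<forall>n\<ge>1. d n \<in> D1" and e: "\<forall>n\<ge>1. e n \<in> D2"
    and x: "x = to_circle (digit_value b d + t)" "x = to_circle (digit_value b e)"
    using assms by (auto simp: X_def digit_set_eq to_circle_add)
  have d': "\<forall>n\<ge>1. d n \<in> {0..b-1}" and e': "\<forall>n\<ge>1. e n \<in> {0..b-1}" using d e D by blast+
  obtain k where k: "digit_value b d + t - digit_value b e = of_int k"
    using x to_circle_eq_iff by (metis Ints_cases)
  note vd = digit_value_bounds[OF b d'] and ve = digit_value_bounds[OF b e']
  have k01: "k \<in> {0, 1}"
  proof -
    have "of_int k < (2 :: real)" "- 1 < (of_int k :: real)"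
      using vd[of 0] ve[of 0] t k by auto
    then show ?thesis by auto
  qed
  let ?D = "digit_prefix b d n" and ?E = "digit_prefix b e n"
  \<comment> \<open>The incoming carry: tail of \<open>d\<close> plus tail of \<open>t\<close> minus
    tail of \<open>e\<close>, in units of the \<open>n\<close>-th place, hence strictly between -1
    and 2.\<close>
  define j where "j = ?E + k * b ^ n - ?D - T n"
  have "of_int b ^ n * digit_value b d + of_int b ^ n * t - of_int b ^ n * digit_value b e = of_int b ^ n * of_int k"
    unfolding k[symmetric] by (simp add: algebra_simps)
  then have j: "of_int j = (of_int b ^ n * digit_value b d - ?D) + (of_int b ^ n * t - T n) - (of_int b ^ n * digit_value b e - ?E)"
    by (simp add: j_def algebra_simps)
  have "j \<in> {0, 1}"
  proof -
    have "of_int j < (2 :: real)" "- 1 < (of_int j :: real)"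
      using vd[of n] ve[of n] T_bounds[of n] j by linarith+
    then show ?thesis by auto
  qed
  moreover have "?D + T n + j = ?E + k * b ^ n" by (simp add: j_def)
  ultimately have "?E \<in> R n"
    unfolding matching_def using k01 digit_prefix_mem[OF d] digit_prefix_mem[OF e] by blast
  moreover have "x \<in> digit_arc b n ?E"
    unfolding digit_arc_def x(2) using ve[of n] bpos(3)[of n]
    by (intro imageI) (simp add: pos_divide_le_eq pos_le_divide_eq mult.commute)
  ultimately show ?thesis by blast
qed

end

lemma diameter_le_dist:
  assumes "\<And>x y. x \<in> S \<Longrightarrow> y \<in> S \<Longrightarrow> dist x y \<le> d" "0 \<le> d"
  shows "diameter S \<le> d"
  using assms by (auto simp: diameter_def intro!: cSUP_least)

text \<open>\<open>extend\<close> excludes dead ends: for every digit of \<open>t\<close> and every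
  carry \<open>l\<close> already promised, some next pair of digits produces \<open>l\<close> at the
  price of a new incoming carry \<open>j\<close>. \<open>supmult\<close> keeps cylinders from
  concentrating, and \<open>growth\<close> fixes the exponential rate of their number.\<close>

locale digit_translate_growth = digit_translate +
  fixes \<Lambda> :: real
  assumes extend: "\<And>i l. i \<in> {0..b-1} \<Longrightarrow> l \<in> {0, 1} \<Longrightarrow> \<exists>d\<in>D1. \<exists>j\<in>{0, 1}. d + i + j - l * b \<in> D2"
    and supmult: "\<And>n k S S'. 0 \<le> S \<Longrightarrow> S < b ^ n \<Longrightarrow> 0 \<le> S' \<Longrightarrow> S' < b ^ k \<Longrightarrow>
      card (matching b D1 D2 k S') * card (matching b D1 D2 n S) \<le> 16 * card (matching b D1 D2 (n + k) (b ^ k * S + S'))"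
    and growth: "(\<lambda>n. ln (card (matching b D1 D2 n \<lfloor>of_int b ^ n * t\<rfloor>)) / n) \<longlonglongrightarrow> \<Lambda>"
begin

lemma digits_nonempty: "D1 \<noteq> {}" "D2 \<noteq> {}"
  using extend[of 0 0] b by auto

lemma finite_digits: "finite D1" "finite D2"
  using D finite_subset by blast+

lemma finite_R: "finite (R n)"
  by (rule matching_finite[OF finite_digits(2)])

text \<open>Digits are appended forever while the integer equation is kept with a changing incoming
  carry. Divided by the power of \<open>b\<close>, the bounded carry disappears in the limit, and
  the two limit points agree on the circle.\<close>

lemma matching_realized:
  assumes "y \<in> R m"
  shows "\<exists>x\<in>X. x \<in> digit_arc b m y"
proof -
  obtain x j k where x: "x \<in> prefixes b D1 m" "y \<in> prefixes b D2 m" "j \<in> {0, 1}" "k \<in> {0, 1 :: int}"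
    "x + T m + j = y + k * b ^ m"
    using assms unfolding matching_def by blast
  \<comment> \<open>A state consists of both prefixes and the incoming carry; the outgoing carry
    \<open>k\<close> stays fixed. The last clause pins down the initial state, which the choice
    principle would otherwise leave open.\<close>
  define P where "P n s = (case s of (v, w, l) \<Rightarrow> l \<in> {0, 1} \<and> v + T (m + n) + l = w + k * b ^ (m + n) \<and>
    (n = 0 \<longrightarrow> s = (x, y, j)))" for n and s :: "int \<times> int \<times> int"
  define Q where "Q s s' = (case s of (v, w, l) \<Rightarrow> case s' of (v', w', l') \<Rightarrow>
    (\<exists>d\<in>D1. v' = b * v + d) \<and> (\<exists>e\<in>D2. w' = b * w + e))" for s s' :: "int \<times> int \<times> int"
  have "\<exists>f. \<forall>n. P n (f n) \<and> Q (f n) (f (Suc n))"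
  proof (rule dependent_nat_choice)
    show "\<exists>s. P 0 s" using x by (intro exI[of _ "(x, y, j)"]) (auto simp: P_def)
    fix s n assume "P n s"
    then obtain v w l where s: "s = (v, w, l)" "l \<in> {0, 1}" "v + T (m + n) + l = w + k * b ^ (m + n)"
      by (auto simp: P_def)
    define i where "i = T (Suc (m + n)) mod b"
    obtain d l' where d: "d \<in> D1" "l' \<in> {0, 1}" "d + i + l' - l * b \<in> D2"
      using extend[of i l] T_Suc(2)[of "m + n"] s(2) unfolding i_def by blast
    have "T (m + Suc n) = b * T (m + n) + i" using T_Suc(1)[of "m + n"] by (simp add: i_def)
    then have "b * v + d + T (m + Suc n) + l' = b * (v + T (m + n) + l) + (d + i + l' - l * b)"
      by (simp add: algebra_simps)
    also have "\<dots> = b * w + (d + i + l' - l * b) + k * b ^ (m + Suc n)"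
      unfolding s(3) by (simp add: algebra_simps)
    finally have "P (Suc n) (b * v + d, b * w + (d + i + l' - l * b), l')"
      using d by (simp add: P_def)
    moreover have "Q s (b * v + d, b * w + (d + i + l' - l * b), l')"
      using d by (auto simp: Q_def s)
    ultimately show "\<exists>s'. P (Suc n) s' \<and> Q s s'" by blast
  qed
  then obtain f where f: "\<And>n. P n (f n)" "\<And>n. Q (f n) (f (Suc n))" by blast
  define V W l where "V n = fst (f n)" and "W n = fst (snd (f n))" and "l n = snd (snd (f n))" for n
  have PVW: "l n \<in> {0, 1}" "V n + T (m + n) + l n = W n + k * b ^ (m + n)" for n
    using f(1)[of n] by (auto simp: P_def V_def W_def l_def split: prod.splits)
  have init: "V 0 = x" "W 0 = y"
    using f(1)[of 0] by (auto simp: P_def V_def W_def split: prod.splits)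
  have step: "\<exists>d\<in>D1. V (Suc n) = b * V n + d" "\<exists>e\<in>D2. W (Suc n) = b * W n + e" for n
    using f(2)[of n] by (auto simp: Q_def V_def W_def split: prod.splits)
  obtain d where d: "\<forall>n\<ge>1. d n \<in> D1" "\<And>n. digit_prefix b d (m + n) = V n"
    using prefix_sequence_digits[OF b digits_nonempty(1), of V m] init x step by blast
  obtain e where e: "\<forall>n\<ge>1. e n \<in> D2" "\<And>n. digit_prefix b e (m + n) = W n"
    using prefix_sequence_digits[OF b digits_nonempty(2), of W m] init x step by blast
  have d': "\<forall>n\<ge>1. d n \<in> {0..b-1}" and e': "\<forall>n\<ge>1. e n \<in> {0..b-1}" using d e D by blast+
  let ?q = "\<lambda>n. real_of_int b ^ (n + m)"
  have "(\<lambda>n. V n / ?q n + T (n + m) / ?q n - W n / ?q n) \<longlonglongrightarrow> digit_value b d + t - digit_value b e"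
    using LIMSEQ_ignore_initial_segment[OF digit_value_tendsto[OF b d'], of m]
      LIMSEQ_ignore_initial_segment[OF digit_value_tendsto[OF b e'], of m]
      LIMSEQ_ignore_initial_segment[OF T_tendsto, of m] d(2) e(2)
    by (intro tendsto_intros) (simp_all add: add.commute[of _ m])
  moreover have "V n / ?q n + T (n + m) / ?q n - W n / ?q n = k - l n / ?q n" for n
  proof -
    have "V n + T (n + m) - W n = k * b ^ (n + m) - l n"
      using PVW(2)[of n, unfolded add.commute[of m n]] by linarith
    then have "real_of_int (V n + T (n + m) - W n) = real_of_int (k * b ^ (n + m) - l n)" by (simp only:)
    then have "(V n + T (n + m) - W n) / ?q n = (k * ?q n - l n) / ?q n" by simp
    then show ?thesis using b by (simp add: add_divide_distrib diff_divide_distrib)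
  qed
  moreover have "(\<lambda>n. k - l n / ?q n) \<longlonglongrightarrow> real_of_int k - 0"
  proof (intro tendsto_intros)
    from LIMSEQ_ignore_initial_segment[OF inverse_power_tendsto[OF b]]
    have "(\<lambda>n. 1 / ?q n) \<longlonglongrightarrow> 0" .
    then show "(\<lambda>n. l n / ?q n) \<longlonglongrightarrow> 0"
    proof (rule Lim_null_comparison[rotated])
      show "\<forall>\<^sub>F n in sequentially. norm (l n / ?q n) \<le> 1 / ?q n"
      proof (intro always_eventually allI)
        fix n
        have "\<bar>real_of_int (l n)\<bar> \<le> 1" using PVW(1)[of n] by auto
        then show "norm (l n / ?q n) \<le> 1 / ?q n"
          using bpos(3)[of "n + m"] by (simp add: abs_divide divide_right_mono)
      qed
    qed
  qed
  ultimately have "digit_value b d + t - digit_value b e = real_of_int k - 0"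
    by (simp only: LIMSEQ_unique)
  then have "to_circle (digit_value b d + t) = to_circle (digit_value b e)"
    unfolding to_circle_eq_iff by simp
  moreover have "to_circle (digit_value b d) \<in> digit_set b D1" "to_circle (digit_value b e) \<in> digit_set b D2"
    using d(1) e(1) by (auto simp: digit_set_eq)
  ultimately have "to_circle (digit_value b e) \<in> X"
    unfolding X_def to_circle_add[symmetric] by (metis IntI image_eqI)
  moreover have "to_circle (digit_value b e) \<in> digit_arc b m y"
    using digit_value_bounds[OF b e', of m] e(2)[of 0] init(2) bpos(3)[of m]
    unfolding digit_arc_def by (intro imageI) (simp add: pos_divide_le_eq pos_le_divide_eq mult.commute)
  ultimately show ?thesis by blast
qed

lemma X_nonempty: "X \<noteq> {}"
proof -
  have "T 0 = 0" using t by (simp add: T_def floor_eq_iff)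
  then have "0 \<in> R 0" by (auto simp: matching_def)
  then show ?thesis using matching_realized by blast
qed

lemma card_R_pos: "card (R n) > 0"
proof -
  obtain x where "x \<in> X" using X_nonempty by blast
  then have "R n \<noteq> {}" using X_subset_arcs[of x n] by blast
  then show ?thesis using finite_R by (simp add: card_gt_0_iff)
qed

lemma T_range: "0 \<le> T n" "T n < b ^ n"
proof -
  show "0 \<le> T n" unfolding T_def using bpos(3)[of n] t by simp
  have "of_int b ^ n * t < of_int (b ^ n)" using bpos(3)[of n] t by simp
  then show "T n < b ^ n" unfolding T_def by (simp add: floor_less_iff)
qed

lemma dist_arc_le:
  assumes "x \<in> digit_arc b n y" "x' \<in> digit_arc b n y"
  shows "dist x x' \<le> 1 / real_of_int b ^ n"
proof -
  obtain u v where u: "x = to_circle u" "u \<in> {of_int y / of_int b ^ n..of_int (y + 1) / of_int b ^ n}"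
    and v: "x' = to_circle v" "v \<in> {of_int y / of_int b ^ n..of_int (y + 1) / of_int b ^ n}"
    using assms by (auto simp: digit_arc_def)
  have "dist x x' \<le> \<bar>u - v\<bar>" unfolding u v using dist_to_circle_le[of u v] by (simp add: dist_real_def)
  also have "\<dots> \<le> of_int (y + 1) / of_int b ^ n - of_int y / of_int b ^ n" using u(2) v(2) by auto
  finally show ?thesis by (simp add: add_divide_distrib)
qed

text \<open>The arcs of level \<open>n\<close> form a cover of cost at most
  \<open>card (R n)\<close> times \<open>b\<close> to the power \<open>- n * s\<close>, which tends
  to 0 when \<open>s * ln b\<close> exceeds the growth rate.\<close>

lemma hausdorff_measure_X_zero:
  assumes s: "s > \<Lambda> / ln b" "s > 0"
  shows "hausdorff_measure s X = 0"
proof -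
  have lnb: "ln (real_of_int b) > 0" using b by simp
  have prem: "hausdorff_premeasure s \<delta> X = 0" if \<delta>: "\<delta> > 0" for \<delta>
  proof -
    have le: "hausdorff_premeasure s \<delta> X \<le> ennreal (card (R n) * (1 / real_of_int b ^ n) powr s)"
      if n: "1 / real_of_int b ^ n \<le> \<delta>" for n
    proof -
      obtain h where h: "bij_betw h {0..<card (R n)} (R n)" using ex_bij_betw_nat_finite[OF finite_R] by blast
      define U where "U i = (if i < card (R n) then digit_arc b n (h i) else {})" for i
      have "X \<subseteq> (\<Union>i. U i)"
      proof
        fix x assume "x \<in> X"
        then obtain y where y: "y \<in> R n" "x \<in> digit_arc b n y" using X_subset_arcs by blast
        have "y \<in> h ` {0..<card (R n)}" using y(1) bij_betw_imp_surj_on[OF h] by simp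
        then obtain i where "i < card (R n)" "y = h i" by auto
        with y(2) show "x \<in> (\<Union>i. U i)" by (auto simp: U_def)
      qed
      moreover have diam: "diameter (U i) \<le> 1 / real_of_int b ^ n" for i
        unfolding U_def using bpos(3)[of n] dist_arc_le by (intro diameter_le_dist) (auto split: if_splits)
      moreover have "bounded (U i)" for i
        unfolding U_def bounded_two_points using dist_arc_le by (intro exI[of _ "1 / real_of_int b ^ n"]) auto
      ultimately have "hausdorff_premeasure s \<delta> X \<le> (\<Sum>i. hausdorff_gauge s (U i))"
        unfolding hausdorff_premeasure_def using n by (intro Inf_lower) (auto intro: order_trans)
      also have "\<dots> = (\<Sum>i<card (R n). hausdorff_gauge s (U i))"
        by (rule suminf_finite) (auto simp: U_def hausdorff_gauge_def)
      also have "\<dots> \<le> (\<Sum>i<card (R n). ennreal ((1 / real_of_int b ^ n) powr s))"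
      proof (rule sum_mono)
        fix i
        have "diameter (U i) powr s \<le> (1 / real_of_int b ^ n) powr s"
          using s(2) diam diameter_ge_0 \<open>bounded (U i)\<close> by (intro powr_mono2) auto
        then show "hausdorff_gauge s (U i) \<le> ennreal ((1 / real_of_int b ^ n) powr s)"
          using s(2) by (auto simp: hausdorff_gauge_def intro: ennreal_leI)
      qed
      also have "\<dots> = ennreal (card (R n) * (1 / real_of_int b ^ n) powr s)"
        by (simp add: ennreal_of_nat_eq_real_of_nat ennreal_mult)
      finally show ?thesis .
    qed
    have lim0: "(\<lambda>n. card (R n) * (1 / real_of_int b ^ n) powr s) \<longlonglongrightarrow> 0"
    proof -
      have eq: "exp (n * (ln (card (R n)) / n - s * ln b)) = card (R n) * (1 / real_of_int b ^ n) powr s" if "n > 0" for n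
      proof -
        have "(1 / real_of_int b ^ n) powr s = exp (- (n * (s * ln b)))"
          using bpos(3)[of n] b by (simp add: powr_def ln_div ln_realpow mult_ac)
        moreover have "n * (ln (card (R n)) / n - s * ln b) = ln (card (R n)) + - (n * (s * ln b))"
          using that by (simp add: right_diff_distrib)
        ultimately show ?thesis
          using card_R_pos[of n] by (simp only: exp_add) simp
      qed
      have "\<Lambda> - s * ln b < 0" using s(1) lnb by (simp add: pos_divide_less_eq)
      moreover have "(\<lambda>n. ln (card (R n)) / n - s * ln b) \<longlonglongrightarrow> \<Lambda> - s * ln b"
        using growth unfolding T_def by (intro tendsto_intros)
      ultimately have "LIM n sequentially. (ln (card (R n)) / n - s * ln b) * real n :> at_bot"
        by (intro filterlim_tendsto_neg_mult_at_bot filterlim_real_sequentially)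
      then have "(\<lambda>n. exp ((ln (card (R n)) / n - s * ln b) * real n)) \<longlonglongrightarrow> 0"
        by (rule filterlim_compose[OF exp_at_bot])
      then show ?thesis
      proof (rule Lim_transform_eventually)
        show "\<forall>\<^sub>F n in sequentially. exp ((ln (card (R n)) / n - s * ln b) * real n) =
            card (R n) * (1 / real_of_int b ^ n) powr s"
          using eventually_gt_at_top[of 0] by eventually_elim (simp add: eq mult.commute)
      qed
    qed
    have lim: "(\<lambda>n. ennreal (card (R n) * (1 / real_of_int b ^ n) powr s)) \<longlonglongrightarrow> 0"
      using tendsto_ennrealI[OF lim0] by simp
    have "\<forall>\<^sub>F n in sequentially. 1 / real_of_int b ^ n < \<delta>"
      using order_tendstoD(2)[OF inverse_power_tendsto[OF b] \<delta>] .
    then have "\<forall>\<^sub>F n in sequentially. hausdorff_premeasure s \<delta> X \<le> ennreal (card (R n) * (1 / real_of_int b ^ n) powr s)"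
      by eventually_elim (intro le less_imp_le)
    from tendsto_lowerbound[OF lim this] show ?thesis by simp
  qed
  show ?thesis
    unfolding hausdorff_measure_def using prem by (simp add: SUP_eq_iff bot_ennreal)
qed

text \<open>The exponent 0 is admissible in the definition of the dimension but lies outside the
  counting argument for positive exponents. Here each nonempty set of a cover costs 1.\<close>

lemma hausdorff_measure_0_X: "hausdorff_measure 0 X \<noteq> 0"
proof -
  obtain x where x: "x \<in> X" using X_nonempty by blast
  have "1 \<le> hausdorff_premeasure 0 1 X"
    unfolding hausdorff_premeasure_def
  proof (rule Inf_greatest, clarify)
    fix U :: "nat \<Rightarrow> circle set" assume "X \<subseteq> (\<Union>n. U n)"
    then obtain n where "U n \<noteq> {}" using x by blast
    then have "(1 :: ennreal) = hausdorff_gauge 0 (U n)" by (simp add: hausdorff_gauge_def)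
    also have "\<dots> \<le> (\<Sum>n. hausdorff_gauge 0 (U n))"
      using sum_le_suminf[of "\<lambda>n. hausdorff_gauge 0 (U n)" "{n}"] by simp
    finally show "1 \<le> (\<Sum>n. hausdorff_gauge 0 (U n))" .
  qed
  also have "\<dots> \<le> hausdorff_measure 0 X"
    unfolding hausdorff_measure_def by (rule SUP_upper) simp
  finally show ?thesis by auto
qed

section \<open>Lower bound for the dimension by counting cylinders\<close>

lemma card_R_submult: "card (matching b D1 D2 k S') * card (R n) \<le> 16 * card (R (n + k))"
  if "0 \<le> S'" "S' < b ^ k" "T (n + k) = b ^ k * T n + S'" for S'
  using supmult[OF T_range that(1,2), of n] that(3) by simp

text \<open>A set of diameter less than \<open>b\<^sup>-\<^sup>n\<close> meets at most three cylinders of length \<open>n\<close>, whence \<open>48 = 3 * 16\<close>.\<close>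

lemma card_matching_near:
  assumes nm: "n \<le> m" and S: "S \<subseteq> R m"
    and near: "\<And>y y'. y \<in> S \<Longrightarrow> y' \<in> S \<Longrightarrow> \<exists>x\<in>digit_arc b m y. \<exists>x'\<in>digit_arc b m y'. dist x x' < 1 / real_of_int b ^ n"
  shows "card S * card (R n) \<le> 48 * card (R m)"
proof -
  define k where "k = m - n"
  have m: "m = n + k" using nm by (simp add: k_def)
  obtain S' where S': "0 \<le> S'" "S' < b ^ k" "T (n + k) = b ^ k * T n + S'" using T_add by blast
  have bk: "b ^ k > 0" and bn: "b ^ n > 0" using bpos by auto
  have range: "0 \<le> y div b ^ k" "y div b ^ k < b ^ n" if "y \<in> S" for y
  proof -
    have y: "0 \<le> y" "y < b ^ (n + k)"
      using prefixes_bounds[OF bpos(1) D(2)] S that unfolding matching_def m by auto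
    show "0 \<le> y div b ^ k" using y bk by (simp add: pos_imp_zdiv_nonneg_iff)
    have "b ^ k * (y div b ^ k) \<le> y" using bk by (simp add: minus_mod_eq_mult_div[symmetric])
    then have "b ^ k * (y div b ^ k) < b ^ k * b ^ n" using y by (simp add: power_add mult.commute)
    then show "y div b ^ k < b ^ n" using bk by simp
  qed
  have fibre: "card {y \<in> S. y div b ^ k = w} \<le> card (matching b D1 D2 k S')" for w
  proof (rule card_inj_on_le[where f = "\<lambda>y. y mod b ^ k"])
    show "inj_on (\<lambda>y. y mod b ^ k) {y \<in> S. y div b ^ k = w}"
    proof (rule inj_onI)
      fix y y' assume "y \<in> {y \<in> S. y div b ^ k = w}" "y' \<in> {y \<in> S. y div b ^ k = w}" "y mod b ^ k = y' mod b ^ k"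
      then show "y = y'" using mult_div_mod_eq[of "b ^ k" y] mult_div_mod_eq[of "b ^ k" y'] by simp
    qed
    show "(\<lambda>y. y mod b ^ k) ` {y \<in> S. y div b ^ k = w} \<subseteq> matching b D1 D2 k S'"
    proof (rule image_subsetI)
      fix y assume "y \<in> {y \<in> S. y div b ^ k = w}"
      then have "y \<in> matching b D1 D2 (n + k) (b ^ k * T n + S')" using S S'(3) m by auto
      then show "y mod b ^ k \<in> matching b D1 D2 k S'"
        by (rule matching_mod[OF bpos(1) D S'(1,2)])
    qed
  qed (rule matching_finite[OF finite_digits(2)])
  \<comment> \<open>The index of a level-\<open>n\<close> cylinder is at most \<open>b ^ n\<close>
    times a point of it and differs from that by at most 1. Nearby points change this multiple by
    less than 1 modulo \<open>b ^ n\<close>, so the indices differ by less than 2.\<close>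
  have close: "\<exists>z. \<bar>y div b ^ k - y' div b ^ k - z * b ^ n\<bar> < 2" if yy: "y \<in> S" "y' \<in> S" for y y'
  proof -
    have frac: "\<exists>v. x = to_circle v \<and> of_int (y div b ^ k) \<le> of_int b ^ n * v \<and> of_int b ^ n * v \<le> of_int (y div b ^ k) + 1"
      if arc: "x \<in> digit_arc b m y" for x y
    proof -
      obtain v where v: "x = to_circle v" "of_int y / of_int b ^ m \<le> v" "v \<le> of_int (y + 1) / of_int b ^ m"
        using arc by (auto simp: digit_arc_def)
      have "of_int y \<le> of_int b ^ k * (of_int b ^ n * v)" "of_int b ^ k * (of_int b ^ n * v) \<le> of_int (y + 1)"
        using v(2,3) bpos(3)[of m] unfolding m by (simp_all add: pos_divide_le_eq pos_le_divide_eq power_add mult_ac)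
      moreover have "b ^ k * (y div b ^ k) \<le> y" "y + 1 \<le> b ^ k * (y div b ^ k + 1)"
        using bk pos_mod_bound[OF bk, of y] mult_div_mod_eq[of "b ^ k" y] pos_mod_sign[OF bk, of y]
        by (simp_all only: distrib_left)
      then have "real_of_int (b ^ k * (y div b ^ k)) \<le> of_int y" "real_of_int (y + 1) \<le> of_int (b ^ k * (y div b ^ k + 1))"
        by (simp_all only: of_int_le_iff)
      ultimately have "of_int b ^ k * of_int (y div b ^ k) \<le> of_int b ^ k * (of_int b ^ n * v)"
        "of_int b ^ k * (of_int b ^ n * v) \<le> of_int b ^ k * (of_int (y div b ^ k) + 1)"
        by simp_all
      then have "of_int (y div b ^ k) \<le> of_int b ^ n * v" "of_int b ^ n * v \<le> of_int (y div b ^ k) + 1"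
        using bpos(3)[of k] by (simp_all only: mult_le_cancel_left_pos)
      then show ?thesis using v(1) by blast
    qed
    obtain x x' where x: "x \<in> digit_arc b m y" "x' \<in> digit_arc b m y'" "dist x x' < 1 / real_of_int b ^ n"
      using near[OF yy] by blast
    obtain v v' where v: "x = to_circle v" "of_int (y div b ^ k) \<le> of_int b ^ n * v" "of_int b ^ n * v \<le> of_int (y div b ^ k) + 1"
      and v': "x' = to_circle v'" "of_int (y' div b ^ k) \<le> of_int b ^ n * v'" "of_int b ^ n * v' \<le> of_int (y' div b ^ k) + 1"
      using frac[OF x(1)] frac[OF x(2)] by blast
    have "infdist (v - v') \<int> < 1 / real_of_int b ^ n" using x(3) unfolding v v' by (simp add: dist_circle.abs_eq)
    moreover have "(\<int> :: real set) \<noteq> {}" using Ints_0 by blast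
    then obtain c where "c \<in> \<int>" "infdist (v - v') \<int> = dist (v - v') c"
      using infdist_attains_inf[OF closed_Ints] by blast
    moreover from \<open>c \<in> \<int>\<close> obtain z where "c = of_int z" by (auto elim: Ints_cases)
    ultimately have "\<bar>v - v' - of_int z\<bar> < 1 / real_of_int b ^ n" by (simp add: dist_real_def)
    then have "of_int b ^ n * \<bar>v - v' - of_int z\<bar> < 1"
      using bpos(3)[of n] by (simp add: pos_less_divide_eq mult.commute)
    moreover have "of_int b ^ n * \<bar>v - v' - of_int z\<bar> = \<bar>of_int b ^ n * v - of_int b ^ n * v' - of_int z * of_int b ^ n\<bar>"
      using bpos(3)[of n] by (simp add: abs_mult_pos' algebra_simps)
    ultimately have "\<bar>real_of_int (y div b ^ k) - of_int (y' div b ^ k) - of_int z * of_int b ^ n\<bar> < 2"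
      using v(2,3) v'(2,3) by linarith
    then have "real_of_int \<bar>y div b ^ k - y' div b ^ k - z * b ^ n\<bar> < of_int 2" by simp
    then show ?thesis unfolding of_int_less_iff by blast
  qed
  have "card ((\<lambda>y. y div b ^ k) ` S) \<le> 3"
  proof (cases "S = {}")
    case False
    then obtain y0 where y0: "y0 \<in> S" by blast
    let ?w = "y0 div b ^ k"
    \<comment> \<open>Neighbours are taken modulo \<open>b ^ n\<close> because the first and the
      last arc touch on the circle.\<close>
    have "(\<lambda>y. y div b ^ k) ` S \<subseteq> (\<lambda>i. (?w + i) mod b ^ n) ` {- 1, 0, 1}"
    proof (rule image_subsetI)
      fix y assume y: "y \<in> S"
      obtain z where z: "\<bar>y div b ^ k - ?w - z * b ^ n\<bar> < 2" using close[OF y y0] by blast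
      define i where "i = y div b ^ k - ?w - z * b ^ n"
      have "(?w + i) mod b ^ n = (y div b ^ k - z * b ^ n) mod b ^ n" by (simp add: i_def)
      also have "\<dots> = (y div b ^ k) mod b ^ n" by (simp add: mod_diff_eq[symmetric])
      also have "\<dots> = y div b ^ k" using range[OF y] by simp
      finally have "y div b ^ k = (?w + i) mod b ^ n" by simp
      moreover have "i \<in> {- 1, 0, 1}" using z by (auto simp: i_def)
      ultimately show "y div b ^ k \<in> (\<lambda>i. (?w + i) mod b ^ n) ` {- 1, 0, 1}" by (rule image_eqI)
    qed
    then have "card ((\<lambda>y. y div b ^ k) ` S) \<le> card ((\<lambda>i. (?w + i) mod b ^ n) ` {- 1, 0, 1})"
      by (intro card_mono) auto
    also have "\<dots> \<le> card {- 1, 0, 1 :: int}" by (rule card_image_le) simp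
    finally show ?thesis by simp
  qed simp
  moreover have "card S \<le> card ((\<lambda>y. y div b ^ k) ` S) * card (matching b D1 D2 k S')"
  proof -
    have fin: "finite S" using S finite_R finite_subset by blast
    have "S = (\<Union>w\<in>(\<lambda>y. y div b ^ k) ` S. {y \<in> S. y div b ^ k = w})" by auto
    then have "card S \<le> (\<Sum>w\<in>(\<lambda>y. y div b ^ k) ` S. card {y \<in> S. y div b ^ k = w})"
      using card_UN_le[of "(\<lambda>y. y div b ^ k) ` S" "\<lambda>w. {y \<in> S. y div b ^ k = w}"] fin by simp
    also have "\<dots> \<le> (\<Sum>w\<in>(\<lambda>y. y div b ^ k) ` S. card (matching b D1 D2 k S'))"
      by (rule sum_mono) (rule fibre)
    finally show ?thesis by simp
  qed
  ultimately have "card S \<le> 3 * card (matching b D1 D2 k S')"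
    by (meson mult_le_mono1 order_trans)
  then have "card S * card (R n) \<le> 3 * (card (matching b D1 D2 k S') * card (R n))"
    using mult_le_mono1[of "card S" "3 * card (matching b D1 D2 k S')" "card (R n)"] by (simp only: mult.assoc)
  also have "\<dots> \<le> 3 * (16 * card (R (n + k)))"
    by (intro mult_le_mono2 card_R_submult S')
  finally show ?thesis by (simp add: m)
qed

lemma card_R_lower_bound:
  assumes "s < \<Lambda> / ln b"
  shows "\<exists>C::real. C \<ge> 1 \<and> (\<forall>n. (real_of_int b ^ n) powr s \<le> C * card (R n))"
proof -
  have lnb: "ln (real_of_int b) > 0" using b by simp
  have "s * ln b < \<Lambda>" using assms lnb by (simp add: pos_less_divide_eq)
  then have "\<forall>\<^sub>F n in sequentially. s * ln b < ln (card (R n)) / n"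
    using growth unfolding T_def by (intro order_tendstoD(1))
  then obtain N where N: "\<And>n. n \<ge> N \<Longrightarrow> s * ln b < ln (card (R n)) / n"
    by (auto simp: eventually_sequentially)
  define C where "C = 1 + (\<Sum>n\<le>N. (real_of_int b ^ n) powr s)"
  have C: "C \<ge> 1" by (simp add: C_def sum_nonneg)
  have "(real_of_int b ^ n) powr s \<le> C * card (R n)" for n
  proof -
    have r: "real (card (R n)) \<ge> 1" using card_R_pos[of n] by simp
    show ?thesis
    proof (cases "n \<le> N")
      case True
      then have "(real_of_int b ^ n) powr s \<le> (\<Sum>n\<le>N. (real_of_int b ^ n) powr s)"
        by (intro member_le_sum) auto
      also have "\<dots> \<le> C * 1" by (simp add: C_def)
      also have "\<dots> \<le> C * card (R n)" using r C by (intro mult_left_mono) auto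
      finally show ?thesis .
    next
      case False
      then have "n * (s * ln b) < ln (card (R n))" using N[of n] by (simp add: pos_less_divide_eq mult.commute)
      moreover have "(real_of_int b ^ n) powr s = exp (n * (s * ln b))"
        using b by (simp add: powr_def ln_realpow mult_ac)
      ultimately have "(real_of_int b ^ n) powr s \<le> exp (ln (card (R n)))" by simp
      also have "\<dots> = 1 * real (card (R n))" using r by simp
      also have "\<dots> \<le> C * card (R n)" using C by (intro mult_right_mono) auto
      finally show ?thesis .
    qed
  qed
  then show ?thesis using C by blast
qed

text \<open>This replaces the Frostman condition of a measure: with one representative
  \<open>\<xi> y\<close> per cylinder of level \<open>m\<close>, the proportion of representatives
  in a set of size \<open>r\<close> is at most a constant times \<open>r powr s\<close>, uniformly
  in \<open>m\<close>.\<close>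

lemma card_matching_in_set:
  fixes C s r :: real
  assumes C: "C \<ge> 1" "\<And>n. (real_of_int b ^ n) powr s \<le> C * card (R n)" and s: "s > 0"
    and V: "\<And>x y. x \<in> V \<Longrightarrow> y \<in> V \<Longrightarrow> dist x y < r" and r: "1 / real_of_int b ^ m \<le> r"
    and \<xi>: "\<And>y. y \<in> R m \<Longrightarrow> \<xi> y \<in> digit_arc b m y"
  shows "card {y \<in> R m. \<xi> y \<in> V} \<le> 48 * C * b powr s * r powr s * card (R m)"
proof -
  let ?S = "{y \<in> R m. \<xi> y \<in> V}"
  have bs: "real_of_int b powr s \<ge> 1" using b s by (simp add: ge_one_powr_ge_zero)
  have r0: "r > 0" using r bpos(3)[of m] by (meson less_le_trans zero_less_divide_1_iff)
  show ?thesis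
  proof (cases "r \<ge> 1")
    case True
    have "1 * 1 \<le> b powr s * r powr s"
      using True s bs by (intro mult_mono) (auto simp: ge_one_powr_ge_zero)
    then have "1 * 1 \<le> (48 * C) * (b powr s * r powr s)"
      using C(1) by (intro mult_mono) auto
    then have "1 * real (card (R m)) \<le> (48 * C) * (b powr s * r powr s) * card (R m)"
      by (intro mult_right_mono) auto
    moreover have "card ?S \<le> card (R m)" by (intro card_mono finite_R) auto
    ultimately show ?thesis by (simp add: mult.assoc)
  next
    case False
    \<comment> \<open>With \<open>k = Suc n\<close> the size satisfies
      \<open>1 / b ^ Suc n \<le> r < 1 / b ^ n\<close>. The upper bound feeds the count of
      neighbouring cylinders, and \<open>b powr s\<close> pays for the quotient of the two
      bounds.\<close>
    define k where "k = (LEAST k. 1 / real_of_int b ^ k \<le> r)"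
    have k: "1 / real_of_int b ^ k \<le> r" "k \<le> m"
      unfolding k_def by (rule LeastI[of "\<lambda>k. 1 / real_of_int b ^ k \<le> r", OF r],
        rule Least_le[of "\<lambda>k. 1 / real_of_int b ^ k \<le> r", OF r])
    have "k \<noteq> 0" using k(1) False by (intro notI) simp
    then obtain n where n: "k = Suc n" by (cases k) auto
    have "\<not> 1 / real_of_int b ^ n \<le> r"
      using not_less_Least[of n "\<lambda>k. 1 / real_of_int b ^ k \<le> r"] n by (simp add: k_def)
    then have rn: "r < 1 / real_of_int b ^ n" by simp
    have nat_near: "card ?S * card (R n) \<le> 48 * card (R m)"
    proof (rule card_matching_near)
      show "n \<le> m" using k(2) n by simp
      fix y y' assume "y \<in> ?S" "y' \<in> ?S"
      then show "\<exists>x\<in>digit_arc b m y. \<exists>x'\<in>digit_arc b m y'. dist x x' < 1 / real_of_int b ^ n"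
        using \<xi> V rn by (intro bexI[of _ "\<xi> y"] bexI[of _ "\<xi> y'"]) (auto intro: less_trans)
    qed auto
    have "real (card ?S * card (R n)) \<le> real (48 * card (R m))"
      using nat_near by (simp only: of_nat_le_iff)
    then have near: "real (card ?S) * real (card (R n)) \<le> 48 * real (card (R m))"
      by simp
    have p: "(real_of_int b ^ n) powr s > 0" using b by simp
    have "card ?S * (real_of_int b ^ n) powr s \<le> card ?S * (C * card (R n))"
      using C(2) by (intro mult_left_mono) auto
    also have "\<dots> = C * (real (card ?S) * card (R n))" by simp
    also have "\<dots> \<le> C * (48 * card (R m))" using near C(1) by (intro mult_left_mono) auto
    finally have "card ?S \<le> 48 * C * card (R m) / (real_of_int b ^ n) powr s"
      using p by (simp add: pos_le_divide_eq mult_ac)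
    also have "\<dots> = 48 * C * b powr s * (1 / real_of_int b ^ k) powr s * card (R m)"
      using bpos(2) bpos(3)[of n] by (simp add: n powr_divide powr_mult)
    also have "\<dots> \<le> 48 * C * b powr s * r powr s * card (R m)"
      using k(1) s C(1) bpos(3)[of k] by (intro mult_right_mono mult_left_mono powr_mono2) auto
    finally show ?thesis .
  qed
qed

text \<open>A cheap cover is thickened to an open one and reduced to finitely many sets. At a level
  finer than all of them, the sets together would contain fewer representatives than there are
  cylinders, although every representative is covered.\<close>

lemma hausdorff_measure_X_pos:
  assumes s: "0 < s" "s < \<Lambda> / ln b"
  shows "hausdorff_measure s X \<noteq> 0"
proof -
  obtain C :: real where C: "C \<ge> 1" "\<And>n. (real_of_int b ^ n) powr s \<le> C * card (R n)"
    using card_R_lower_bound[OF s(2)] by blast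
  define K where "K = 48 * C * b powr s"
  have K: "K > 0" using C(1) bpos(2) by (simp add: K_def)
  \<comment> \<open>Chosen so that \<open>K * 3 powr s * (c + c) = 1\<close>: one \<open>c\<close>
    bounds the given cover, the other the cost of thickening.\<close>
  define c where "c = 1 / (2 * K * 3 powr s)"
  have c: "c > 0" using K by (simp add: c_def)
  have cover: "ennreal c \<le> (\<Sum>n. hausdorff_gauge s (U n))"
    if U: "X \<subseteq> (\<Union>n. U n)" "\<And>n. bounded (U n)" for U :: "nat \<Rightarrow> circle set"
  proof (rule ccontr)
    define a where "a n = (if U n = {} then 0 else diameter (U n) powr s)" for n
    have a: "hausdorff_gauge s (U n) = ennreal (a n)" "a n \<ge> 0" for n
      using s(1) by (auto simp: hausdorff_gauge_def a_def)
    assume "\<not> ?thesis"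
    then have less: "(\<Sum>n. ennreal (a n)) < ennreal c" unfolding a(1) by simp
    then have "(\<Sum>n. ennreal (a n)) \<noteq> top" by (metis ennreal_less_top less_trans less_irrefl)
    then have sm: "summable a" using a(2) by (intro summable_suminf_not_top) auto
    have "ennreal (suminf a) < ennreal c"
      using less suminf_ennreal_eq[OF a(2) summable_sums[OF sm]] by simp
    then have sum_a: "suminf a < c" using suminf_nonneg[OF sm] a(2) by (simp add: ennreal_less_iff)
    \<comment> \<open>A minimal thickness, needed for sets of diameter 0; the powers
      \<open>\<eta> n powr s\<close> add up to \<open>c\<close>.\<close>
    define \<eta> where "\<eta> n = (c / 2 ^ Suc n) powr (1 / s)" for n
    have \<eta>: "\<eta> n > 0" "\<eta> n powr s = c / 2 ^ Suc n" for n
      using c s(1) by (auto simp: \<eta>_def powr_powr)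
    \<comment> \<open>The factor 3 leaves one third for the set itself and one third for the
      thickening at each of two points.\<close>
    define r where "r n = 3 * max (diameter (U n)) (\<eta> n)" for n
    have r: "r n > 0" for n using \<eta>(1)[of n] by (simp add: r_def)
    define V where "V n = (\<Union>x\<in>U n. ball x (r n / 3))" for n
    have V: "dist x y < r n" if xy: "x \<in> V n" "y \<in> V n" for x y n
    proof -
      obtain u v where u: "u \<in> U n" "dist u x < r n / 3" and v: "v \<in> U n" "dist v y < r n / 3"
        using xy by (auto simp: V_def)
      have "dist u v \<le> r n / 3" using diameter_bounded_bound[OF U(2) u(1) v(1)] by (simp add: r_def)
      moreover have "dist x y \<le> dist u x + dist u v + dist v y"
        using dist_triangle[of x y u] dist_triangle[of u y v] by (simp add: dist_commute)
      ultimately show ?thesis using u v by linarith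
    qed
    have "X \<subseteq> (\<Union>n\<in>UNIV. V n)"
    proof
      fix x assume "x \<in> X"
      then obtain n where "x \<in> U n" using U(1) by blast
      then have "x \<in> V n" using r[of n] by (auto simp: V_def intro!: bexI[of _ x])
      then show "x \<in> (\<Union>n\<in>UNIV. V n)" by blast
    qed
    moreover have "open (V n)" for n by (auto simp: V_def)
    ultimately obtain F where F: "finite F" "X \<subseteq> (\<Union>n\<in>F. V n)"
      using compactE_image[OF compact_X, of UNIV V] by (metis subset_UNIV)
    \<comment> \<open>A common level \<open>m\<close> exists because only finitely many sets remain
      and every \<open>r n\<close> is positive; this is where compactness and thickening
      enter.\<close>
    have "\<exists>m. \<forall>n\<in>F. 1 / real_of_int b ^ m \<le> r n"
    proof -
      have "\<forall>n\<in>F. \<forall>\<^sub>F m in sequentially. 1 / real_of_int b ^ m < r n"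
        using r by (intro ballI order_tendstoD(2)[OF inverse_power_tendsto[OF b]])
      then have "\<forall>\<^sub>F m in sequentially. \<forall>n\<in>F. 1 / real_of_int b ^ m < r n"
        by (rule eventually_ball_finite[OF F(1)])
      then show ?thesis by (auto simp: eventually_sequentially intro: less_imp_le)
    qed
    then obtain m where m: "\<And>n. n \<in> F \<Longrightarrow> 1 / real_of_int b ^ m \<le> r n" by blast
    have "\<forall>y\<in>R m. \<exists>x. x \<in> X \<and> x \<in> digit_arc b m y" using matching_realized by blast
    from bchoice[OF this] obtain \<xi> where \<xi>: "\<And>y. y \<in> R m \<Longrightarrow> \<xi> y \<in> X"
      "\<And>y. y \<in> R m \<Longrightarrow> \<xi> y \<in> digit_arc b m y" by blast
    have "card {y \<in> R m. \<xi> y \<in> V n} \<le> K * 3 powr s * (a n + c / 2 ^ Suc n) * card (R m)" if "n \<in> F" for n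
    proof (cases "U n = {}")
      case True
      then show ?thesis using K c a(2)[of n] by (simp add: V_def)
    next
      case False
      have "card {y \<in> R m. \<xi> y \<in> V n} \<le> K * r n powr s * card (R m)"
        unfolding K_def by (rule card_matching_in_set[OF C s(1) V m[OF that] \<xi>(2)])
      also have "r n powr s \<le> 3 powr s * (a n + c / 2 ^ Suc n)"
      proof -
        have "r n powr s = 3 powr s * max (diameter (U n)) (\<eta> n) powr s"
          unfolding r_def using \<eta>(1)[of n] by (simp add: powr_mult)
        also have "max (diameter (U n)) (\<eta> n) powr s \<le> diameter (U n) powr s + \<eta> n powr s"
          by (simp add: max_def)
        finally show ?thesis using False \<eta>(2)[of n] by (simp add: a_def mult_left_mono)
      qed
      finally show ?thesis using K by (simp add: mult_left_mono mult_right_mono mult.assoc)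
    qed
    then have "(\<Sum>n\<in>F. real (card {y \<in> R m. \<xi> y \<in> V n})) \<le> (\<Sum>n\<in>F. K * 3 powr s * (a n + c / 2 ^ Suc n) * card (R m))"
      by (rule sum_mono)
    also have "\<dots> = K * 3 powr s * (\<Sum>n\<in>F. a n + c / 2 ^ Suc n) * card (R m)"
      by (simp add: sum_distrib_left sum_distrib_right)
    also have "\<dots> < K * 3 powr s * (c + c) * card (R m)"
    proof -
      have "(\<Sum>n\<in>F. a n) \<le> suminf a" by (rule sum_le_suminf[OF sm F(1)]) (simp add: a(2))
      moreover have "(\<Sum>n\<in>F. c / 2 ^ Suc n) \<le> c"
      proof -
        have sums: "(\<lambda>n. c * (1 / 2) ^ Suc n) sums (c * 1)" by (rule sums_mult[OF power_half_series])
        have "(\<Sum>n\<in>F. c * (1 / 2) ^ Suc n) \<le> suminf (\<lambda>n. c * (1 / 2) ^ Suc n)"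
          using c by (intro sum_le_suminf sums_summable[OF sums] F(1)) auto
        also have "\<dots> = c" using sums_unique[OF sums] by simp
        finally show ?thesis by (simp add: power_one_over)
      qed
      ultimately have "(\<Sum>n\<in>F. a n + c / 2 ^ Suc n) < c + c"
        using sum_a by (simp add: sum.distrib)
      then show ?thesis
        using K card_R_pos[of m] by (intro mult_strict_right_mono mult_strict_left_mono) auto
    qed
    also have "K * 3 powr s * (c + c) = 1" using K by (simp add: c_def)
    finally have "(\<Sum>n\<in>F. real (card {y \<in> R m. \<xi> y \<in> V n})) < card (R m)" by simp
    moreover have "card (R m) \<le> (\<Sum>n\<in>F. card {y \<in> R m. \<xi> y \<in> V n})"
    proof -
      have "R m \<subseteq> (\<Union>n\<in>F. {y \<in> R m. \<xi> y \<in> V n})" using \<xi>(1) F(2) by blast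
      then have "card (R m) \<le> card (\<Union>n\<in>F. {y \<in> R m. \<xi> y \<in> V n})"
        using F(1) finite_R by (intro card_mono) auto
      also have "\<dots> \<le> (\<Sum>n\<in>F. card {y \<in> R m. \<xi> y \<in> V n})" by (rule card_UN_le[OF F(1)])
      finally show ?thesis .
    qed
    then have "real (card (R m)) \<le> (\<Sum>n\<in>F. real (card {y \<in> R m. \<xi> y \<in> V n}))"
      by (simp flip: of_nat_sum)
    ultimately show False by simp
  qed
  have "ennreal c \<le> hausdorff_premeasure s 1 X"
    unfolding hausdorff_premeasure_def using cover by (intro Inf_greatest) auto
  also have "\<dots> \<le> hausdorff_measure s X"
    unfolding hausdorff_measure_def by (rule SUP_upper) simp
  finally show ?thesis using c by auto
qed

theorem hausdorff_dim_X: "hausdorff_dim X = ereal (\<Lambda> / ln b)"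
proof -
  have lnb: "ln (real_of_int b) > 0" using b by simp
  have "\<Lambda> \<ge> 0"
  proof (rule tendsto_lowerbound[OF growth])
    show "\<forall>\<^sub>F n in sequentially. 0 \<le> ln (card (matching b D1 D2 n \<lfloor>of_int b ^ n * t\<rfloor>)) / n"
      using card_R_pos unfolding T_def by (intro always_eventually allI) (simp add: Suc_le_eq)
  qed simp
  then have d: "\<Lambda> / ln b \<ge> 0" using lnb by simp
  show ?thesis
  proof (rule antisym)
    show "hausdorff_dim X \<le> ereal (\<Lambda> / ln b)"
    proof (rule ereal_le_epsilon2)
      fix e :: real assume "e > 0"
      then have "hausdorff_measure (\<Lambda> / ln b + e) X = 0"
        using d by (intro hausdorff_measure_X_zero) auto
      then show "hausdorff_dim X \<le> ereal (\<Lambda> / ln b) + ereal e"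
        unfolding hausdorff_dim_def using d \<open>e > 0\<close> by (intro INF_lower2[of "\<Lambda> / ln b + e"]) auto
    qed
    show "ereal (\<Lambda> / ln b) \<le> hausdorff_dim X"
      unfolding hausdorff_dim_def
    proof (rule INF_greatest)
      fix s assume "s \<in> {s. 0 \<le> s \<and> hausdorff_measure s X = 0}"
      then have s: "0 \<le> s" "hausdorff_measure s X = 0" by auto
      then have "s \<noteq> 0" using hausdorff_measure_0_X by auto
      then have "\<not> s < \<Lambda> / ln b" using hausdorff_measure_X_pos[of s] s by auto
      then show "ereal (\<Lambda> / ln b) \<le> ereal s" by simp
    qed
  qed
qed

end

section \<open>The dimension formula\<close>

text \<open>The exceptional set on the circle need not be measurable, so a Borel null set on the
  line is pulled back along the inverse \<open>h\<close> of \<open>to_circle\<close> on the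
  half-open unit interval. It remains to see that \<open>h\<close> is measurable despite its jump at
  0.\<close>

lemma AE_circle_lebesgueI:
  assumes "AE t :: real in lborel. 0 \<le> t \<longrightarrow> t < 1 \<longrightarrow> Q (to_circle t)"
  shows "AE c in circle_lebesgue. Q c"
proof -
  obtain N where N: "{t :: real. \<not> (0 \<le> t \<longrightarrow> t < 1 \<longrightarrow> Q (to_circle t))} \<subseteq> N"
    "emeasure lborel N = 0" "N \<in> sets lborel"
    using AE_E[OF assms] by auto
  define h where "h c = (THE x. 0 \<le> x \<and> x < 1 \<and> to_circle x = c)" for c
  have h_eq: "h (to_circle x) = x" if "0 \<le> x" "x < 1" for x
    unfolding h_def
  proof (rule the_equality)
    fix y assume y: "0 \<le> y \<and> y < 1 \<and> to_circle y = to_circle x"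
    then obtain k where "y - x = of_int k" by (auto simp: to_circle_eq_iff elim: Ints_cases)
    then have "- 1 < real_of_int k" "real_of_int k < 1" using y that by auto
    then have "k = 0" by linarith
    then show "y = x" using \<open>y - x = of_int k\<close> by simp
  qed (use that in auto)
  have h: "0 \<le> h c" "h c < 1" "to_circle (h c) = c" for c
  proof -
    obtain x where x: "c = to_circle x"
      using circle.abs_induct[of "\<lambda>c. \<exists>x. c = to_circle x" c] by blast
    have "to_circle (frac x) = c" unfolding x to_circle_eq_iff by (simp add: frac_def)
    then have "h c = frac x" using h_eq[of "frac x"] frac_ge_0[of x] frac_lt_1[of x] by simp
    then show "0 \<le> h c" "h c < 1" "to_circle (h c) = c"
      using \<open>to_circle (frac x) = c\<close> frac_lt_1[of x] by auto
  qed
  have meas: "h \<in> borel_measurable borel"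
    unfolding borel_measurable_iff_ge
  proof
    fix a :: real
    show "{c \<in> space borel. a \<le> h c} \<in> sets borel"
    proof (cases "a \<le> 0 \<or> 1 < a")
      case True
      then consider "\<And>c. a \<le> h c" | "\<And>c. \<not> a \<le> h c"
        using h(1,2) by (meson not_le order_trans less_trans)
      then show ?thesis by cases simp_all
    next
      case False
      \<comment> \<open>For \<open>0 < a \<le> 1\<close> the superlevel set is a compact arc without
        its end point at 1, which is identified with 0.\<close>
      have "{c \<in> space borel. a \<le> h c} = to_circle ` {a..1} - {to_circle 0}"
      proof (intro equalityI subsetI)
        fix c assume "c \<in> {c \<in> space borel. a \<le> h c}"
        then have "h c \<in> {a..1}" using h(2)[of c] by simp
        then have "c \<in> to_circle ` {a..1}" by (rule image_eqI[of c to_circle "h c", OF h(3)[symmetric]])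
        moreover have "c \<noteq> to_circle 0" using \<open>h c \<in> {a..1}\<close> False h_eq[of 0] by auto
        ultimately show "c \<in> to_circle ` {a..1} - {to_circle 0}" by simp
      next
        fix c assume "c \<in> to_circle ` {a..1} - {to_circle 0}"
        then obtain y where y: "a \<le> y" "y \<le> 1" "c = to_circle y" "to_circle y \<noteq> to_circle 0" by auto
        have "y \<noteq> 1" using y(4) by (auto simp: to_circle_eq_iff)
        then have "h c = y" unfolding y(3) using y(1,2) False by (intro h_eq) auto
        then show "c \<in> {c \<in> space borel. a \<le> h c}" using y(1) by simp
      qed
      moreover have "closed (to_circle ` {a..1})"
        by (intro compact_imp_closed compact_continuous_image continuous_on_to_circle) simp
      ultimately show ?thesis by auto
    qed
  qed
  have N': "h -` N \<in> sets borel"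
    using measurable_sets[OF meas, of N] N(3) by simp
  have "emeasure circle_lebesgue (h -` N) =
      emeasure (restrict_space lborel {0..<1}) (to_circle -` (h -` N) \<inter> {0..<1})"
    unfolding circle_lebesgue_def
    by (subst emeasure_distr[OF measurable_to_circle N']) (simp add: space_restrict_space)
  also have "to_circle -` (h -` N) \<inter> {0..<1} = N \<inter> {0..<1}"
    using h_eq by auto
  also have "emeasure (restrict_space lborel {0..<1}) (N \<inter> {0..<1}) = emeasure lborel (N \<inter> {0..<1})"
    by (rule emeasure_restrict_space) auto
  also have "\<dots> = 0"
    using emeasure_mono[of "N \<inter> {0..<1}" N lborel] N(2,3) by simp
  finally have null: "emeasure circle_lebesgue (h -` N) = 0" .
  show ?thesis
  proof (rule AE_I[OF _ null])
    show "h -` N \<in> sets circle_lebesgue" using N' by (simp add: circle_lebesgue_def)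
    show "{c \<in> space circle_lebesgue. \<not> Q c} \<subseteq> h -` N"
    proof
      fix c assume "c \<in> {c \<in> space circle_lebesgue. \<not> Q c}"
      then have "\<not> Q (to_circle (h c))" using h(3)[of c] by simp
      then show "c \<in> h -` N" using N(1) h(1,2)[of c] by blast
    qed
  qed
qed

text \<open>In the coordinates given by this matrix the positive quadrant is the cone \<open>1/3 < y/x < 3\<close>, which
  every digit matrix of a non-degenerate pair maps into itself.\<close>

definition cone_basis :: "real^2^2"
  where "cone_basis = vector [vector [3, - 1], vector [- 1, 3]]"

definition cone_basis_inv :: "real^2^2"
  where "cone_basis_inv = vector [vector [3 / 8, 1 / 8], vector [1 / 8, 3 / 8]]"

lemma cone_basis_inv: "cone_basis ** cone_basis_inv = mat 1" "cone_basis_inv ** cone_basis = mat 1"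
  by (simp_all add: vec_eq_iff forall_2 matrix_mult_2_nth cone_basis_def cone_basis_inv_def mat_def)

lemma invertible_cone_basis: "invertible cone_basis"
  using cone_basis_inv unfolding invertible_def by blast

lemma matrix_inv_cone_basis: "matrix_inv cone_basis = cone_basis_inv"
proof -
  have inv: "cone_basis ** matrix_inv cone_basis = mat 1 \<and> matrix_inv cone_basis ** cone_basis = mat 1"
    unfolding matrix_inv_def by (rule someI[of _ cone_basis_inv]) (simp add: cone_basis_inv)
  have "matrix_inv cone_basis = matrix_inv cone_basis ** cone_basis ** cone_basis_inv"
    by (simp add: cone_basis_inv matrix_mul_assoc[symmetric])
  then show ?thesis using inv by simp
qed

definition cone_conj :: "real^2^2 \<Rightarrow> real^2^2"
  where "cone_conj M = cone_basis ** M ** matrix_inv cone_basis"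

lemma cone_conj_nth:
  "cone_conj M $ 1 $ 1 = (9 * M $ 1 $ 1 + 3 * M $ 1 $ 2 - 3 * M $ 2 $ 1 - M $ 2 $ 2) / 8"
  "cone_conj M $ 1 $ 2 = (3 * M $ 1 $ 1 + 9 * M $ 1 $ 2 - M $ 2 $ 1 - 3 * M $ 2 $ 2) / 8"
  "cone_conj M $ 2 $ 1 = (9 * M $ 2 $ 1 + 3 * M $ 2 $ 2 - 3 * M $ 1 $ 1 - M $ 1 $ 2) / 8"
  "cone_conj M $ 2 $ 2 = (3 * M $ 2 $ 1 + 9 * M $ 2 $ 2 - M $ 1 $ 1 - 3 * M $ 1 $ 2) / 8"
  unfolding cone_conj_def matrix_inv_cone_basis
  by (simp_all add: matrix_mult_2_nth cone_basis_def cone_basis_inv_def field_simps)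

lemma det_cone_conj: "det (cone_conj M) = det M"
  by (simp add: det_2 cone_conj_nth field_simps)

lemma F_map_cone_conj_nth:
  "F_map (cone_conj M) $ 1 $ 1 = (M $ 1 $ 1 - M $ 1 $ 2 - M $ 2 $ 1 + M $ 2 $ 2) / 2"
  "F_map (cone_conj M) $ 1 $ 2 = M $ 1 $ 1 + M $ 1 $ 2 - M $ 2 $ 1 - M $ 2 $ 2"
  "F_map (cone_conj M) $ 2 $ 1 = (M $ 1 $ 1 - M $ 1 $ 2 + M $ 2 $ 1 - M $ 2 $ 2) / 4"
  "F_map (cone_conj M) $ 2 $ 2 = (M $ 1 $ 1 + M $ 1 $ 2 + M $ 2 $ 1 + M $ 2 $ 2) / 2"
  unfolding F_map_nth cone_conj_nth by (simp_all add: field_simps)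

text \<open>\<^term>\<open>F_map M\<close> is the conjugate of \<open>M\<close> by \<open>C = ((1, -1), (1, 1))\<close>, and \<open>Q\<close> is \<^term>\<open>cone_basis\<close> times \<open>C\<^sup>-\<^sup>1\<close>.\<close>

lemma cone_conj_eq_F_map_conj:
  defines "Q \<equiv> vector [vector [2, 1], vector [- 2, 1]] :: real^2^2"
    and "Q' \<equiv> vector [vector [1 / 4, - 1 / 4], vector [1 / 2, 1 / 2]] :: real^2^2"
  shows "Q ** F_map M ** Q' = cone_conj M" "Q' ** Q = mat 1"
proof -
  show "Q ** F_map M ** Q' = cone_conj M"
    unfolding vec_eq_iff forall_2 cone_conj_nth matrix_mult_2_nth F_map_nth
    by (simp add: Q_def Q'_def field_simps)
  show "Q' ** Q = mat 1"
    by (simp add: vec_eq_iff forall_2 matrix_mult_2_nth Q_def Q'_def mat_def)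
qed

section \<open>Non-degenerate pairs: cocycle, near-multiplicativity and dimension\<close>

locale reflected_digits =
  fixes b u :: int and D1 D2 :: "int set"
  assumes b: "b \<ge> 5" and u: "1 \<le> u" "u \<le> b - 2"
    and D1: "D1 = {0..b-1} - {b - 1 - u}" and D2: "D2 = {0..b-1} - {u}"
begin

abbreviation A where "A \<equiv> digit_matrix b D1 D2"
abbreviation g where "g i \<equiv> mob_act (F_map (cone_conj (A i)))"
abbreviation l where "l i \<equiv> log_cocycle (F_map (cone_conj (A i)))"

lemma D_sub: "D1 \<subseteq> {0..b-1}" "D2 \<subseteq> {0..b-1}"
  by (auto simp: D1 D2)

lemma A_eq:
  assumes "i \<in> {0..b-1}"
  shows "A i = vector
    [vector [of_int (low_count b (b - 1 - u) u i), of_int (high_count b (b - 1 - u) u i)],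
     vector [of_int (low_count b (b - 1 - u) u (i + 1)), of_int (high_count b (b - 1 - u) u (i + 1))]]"
  unfolding D1 D2 using b u assms by (intro digit_matrix_counts) auto

lemma positive_cone_conj:
  assumes "i \<in> {0..b-1}"
  shows "positive_matrix (cone_conj (A i))"
proof -
  have i: "0 \<le> i" "i \<le> b - 1" using assms by auto
  have pos: "0 < real_of_int x" if "x > 0" for x using that by simp
  note cone = cone_counts_reflected[OF b u i, THEN pos]
  show ?thesis
    unfolding positive_matrix_def forall_2 cone_conj_nth A_eq[OF assms]
    using cone by simp
qed

lemma det_A:
  assumes "i \<in> {0..b-1}"
  shows "det (A i) \<noteq> 0"
proof -
  have "invertible (A i)"
    using invertible_digit_matrix_iff[of i b "b - 1 - u" u] nonsingular_counts_reflected[of b u i] assms b u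
    unfolding D1 D2 by auto
  then show ?thesis by (simp add: invertible_det_nz)
qed

lemma no_heteroclinic: "\<not> heteroclinic_connection2 {0..b-1} (\<lambda>i. mobius (F_map (A i)))"
  by (rule no_heteroclinic_connection2[OF cone_conj_eq_F_map_conj(2)], unfold cone_conj_eq_F_map_conj(1) det_F_map)
    (rule positive_cone_conj det_A, assumption)+

lemma g_bound: "i \<in> {0..b-1} \<Longrightarrow> \<bar>x\<bar> \<le> 1 \<Longrightarrow> \<bar>g i x\<bar> < 1"
  using F_map_positive(3)[OF positive_cone_conj] by blast

lemma walk_bound: "\<bar>walk b g n S\<bar> < 1"
proof (induction n arbitrary: S)
  case (Suc n)
  have "S mod b \<in> {0..b-1}" using b by (simp add: pos_mod_bound[of b S])
  then show ?case using g_bound Suc[of "S div b"] by simp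
qed simp

text \<open>The pair \<open>(x, y)\<close> is the image of (1, 1) under the prefix product. Its sum
  grows by the denominator of each Moebius step, and its direction is
  \<open>(x - y) / (x + y) = walk / 2\<close>. The factor 1/2 is the aperture of the cone: the
  endpoints 1 and -1 correspond to \<open>y / x = 1 / 3\<close> and \<open>y / x = 3\<close>. The
  start (1, 1) explains the factor 2 and the starting point 0 of the walk.\<close>

lemma prefix_vector:
  fixes n S
  defines "x \<equiv> prefix_matrix b D1 D2 n S $ 1 $ 1 + prefix_matrix b D1 D2 n S $ 1 $ 2"
    and "y \<equiv> prefix_matrix b D1 D2 n S $ 2 $ 1 + prefix_matrix b D1 D2 n S $ 2 $ 2"
  assumes "0 \<le> S" "S < b ^ n"
  shows "x + y = 2 * exp (walk_sum b g l n S) \<and> x - y = (x + y) * walk b g n S / 2"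
  using assms(3,4) unfolding x_def y_def
proof (induction n arbitrary: S)
  case 0
  then have "S = 0" by simp
  then show ?case by (simp add: prefix_matrix_0 mat_def)
next
  case (Suc n)
  have bpos: "b > 0" using b by simp
  define i S' where "i = S mod b" and "S' = S div b"
  define M where "M = prefix_matrix b D1 D2 n S'"
  define x y z where "x = M $ 1 $ 1 + M $ 1 $ 2" and "y = M $ 2 $ 1 + M $ 2 $ 2" and "z = walk b g n S'"
  have i: "i \<in> {0..b-1}" using b by (simp add: i_def pos_mod_bound[of b S])
  have "b * S' \<le> S" using bpos by (simp add: S'_def minus_mod_eq_mult_div[symmetric])
  then have "b * S' < b * b ^ n" using Suc.prems by simp
  then have S': "0 \<le> S'" "S' < b ^ n" using bpos Suc.prems by (simp_all add: S'_def pos_imp_zdiv_nonneg_iff)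
  have IH: "x + y = 2 * exp (walk_sum b g l n S')" "x - y = (x + y) * z / 2"
    using Suc.IH[OF S'] unfolding x_def y_def z_def M_def by blast+
  let ?A = "A i" and ?F = "F_map (cone_conj (A i))"
  define den num where "den = ?F $ 2 $ 1 * z + ?F $ 2 $ 2" and "num = ?F $ 1 $ 1 * z + ?F $ 1 $ 2"
  have den: "den > 0"
    unfolding den_def z_def using walk_bound[of n S'] by (intro F_map_positive positive_cone_conj i) simp
  define x' y' where "x' = ?A $ 1 $ 1 * x + ?A $ 1 $ 2 * y" and "y' = ?A $ 2 $ 1 * x + ?A $ 2 $ 2 * y"
  define s where "s = x + y"
  have xy: "x = s * (2 + z) / 4" "y = s * (2 - z) / 4"
    using IH(2) by (simp_all add: s_def field_simps)
  have sum: "x' + y' = (x + y) * den"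
    unfolding s_def[symmetric] x'_def y'_def den_def F_map_cone_conj_nth unfolding xy
    by (simp add: field_simps)
  have diff: "x' - y' = (x + y) * num / 2"
    unfolding s_def[symmetric] x'_def y'_def num_def F_map_cone_conj_nth unfolding xy
    by (simp add: field_simps)
  have M': "prefix_matrix b D1 D2 (Suc n) S = ?A ** M"
    unfolding M_def i_def S'_def by (rule prefix_matrix_Suc[OF bpos D_sub])
  have rows: "prefix_matrix b D1 D2 (Suc n) S $ 1 $ 1 + prefix_matrix b D1 D2 (Suc n) S $ 1 $ 2 = x'"
    "prefix_matrix b D1 D2 (Suc n) S $ 2 $ 1 + prefix_matrix b D1 D2 (Suc n) S $ 2 $ 2 = y'"
    unfolding M' matrix_mult_2_nth x'_def y'_def x_def y_def by (simp_all add: algebra_simps)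
  have "exp (walk_sum b g l (Suc n) S) = den * exp (walk_sum b g l n S')"
    using den by (simp add: exp_add log_cocycle_def den_def z_def i_def S'_def)
  then have 1: "x' + y' = 2 * exp (walk_sum b g l (Suc n) S)" unfolding sum IH(1) by simp
  have "walk b g (Suc n) S = num / den"
    by (simp add: mob_act_def num_def den_def z_def i_def S'_def)
  then have "x' - y' = (x' + y') * walk b g (Suc n) S / 2" unfolding sum diff using den by simp
  with 1 show ?case unfolding rows by blast
qed

lemma entry_sum_prefix:
  assumes "0 \<le> S" "S < b ^ n"
  shows "entry_sum (prefix_matrix b D1 D2 n S) = 2 * exp (walk_sum b g l n S)"
  using prefix_vector[OF assms] by (simp add: entry_sum_def)

text \<open>As the walk stays in the unit interval, each row sum of the right factor is at least a
  quarter of the total. Nonnegative column sums of the left factor therefore lose at most a factor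
  4.\<close>

lemma entry_sum_supmult:
  assumes S: "0 \<le> S" "S < b ^ n" and S': "0 \<le> S'" "S' < b ^ k"
  shows "entry_sum (prefix_matrix b D1 D2 k S') * entry_sum (prefix_matrix b D1 D2 n S) \<le>
    4 * entry_sum (prefix_matrix b D1 D2 (n + k) (b ^ k * S + S'))"
proof -
  let ?M = "prefix_matrix b D1 D2 n S" and ?K = "prefix_matrix b D1 D2 k S'"
  define x y where "x = ?M $ 1 $ 1 + ?M $ 1 $ 2" and "y = ?M $ 2 $ 1 + ?M $ 2 $ 2"
  define p q where "p = ?K $ 1 $ 1 + ?K $ 2 $ 1" and "q = ?K $ 1 $ 2 + ?K $ 2 $ 2"
  have bpos: "b > 0" using b by simp
  have pq: "p \<ge> 0" "q \<ge> 0" by (simp_all add: p_def q_def prefix_matrix_def digit_matrix_def)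
  have v: "x + y = 2 * exp (walk_sum b g l n S)" "x - y = (x + y) * walk b g n S / 2"
    using prefix_vector[OF S] unfolding x_def y_def by blast+
  have pos: "x + y > 0" unfolding v(1) by simp
  have "\<bar>(x + y) * walk b g n S\<bar> \<le> (x + y) * 1"
    unfolding abs_mult using walk_bound[of n S] pos by (intro mult_mono) auto
  then have xy: "x + y \<le> 4 * x" "x + y \<le> 4 * y" using v(2) by auto
  have "entry_sum ?K * entry_sum ?M = p * (x + y) + q * (x + y)"
    by (simp add: entry_sum_def p_def q_def x_def y_def algebra_simps)
  also have "\<dots> \<le> p * (4 * x) + q * (4 * y)"
    using pq xy by (intro add_mono mult_left_mono)
  also have "\<dots> = 4 * entry_sum (?K ** ?M)"
    by (simp add: entry_sum_def matrix_mult_2_nth p_def q_def x_def y_def algebra_simps)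
  also have "?K ** ?M = prefix_matrix b D1 D2 (n + k) (b ^ k * S + S')"
    by (rule prefix_matrix_add[OF bpos D_sub S', symmetric])
  finally show ?thesis .
qed

lemma finite_D: "finite D1" "finite D2"
  by (auto simp: D1 D2)

text \<open>The constant is 4 * 4: one factor from the entry sums of a product, the other from
  returning from entry sums to cardinalities.\<close>

lemma card_matching_supmult:
  assumes S: "0 \<le> S" "S < b ^ n" and S': "0 \<le> S'" "S' < b ^ k"
  shows "card (matching b D1 D2 k S') * card (matching b D1 D2 n S) \<le>
    16 * card (matching b D1 D2 (n + k) (b ^ k * S + S'))"
proof -
  have "real (card (matching b D1 D2 k S')) * card (matching b D1 D2 n S) \<le>
      entry_sum (prefix_matrix b D1 D2 k S') * entry_sum (prefix_matrix b D1 D2 n S)"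
    by (intro mult_mono card_matching_le finite_D order_trans[OF of_nat_0_le_iff card_matching_le]) simp
  also have "\<dots> \<le> 4 * entry_sum (prefix_matrix b D1 D2 (n + k) (b ^ k * S + S'))"
    by (rule entry_sum_supmult[OF assms])
  also have "\<dots> \<le> 4 * (4 * real (card (matching b D1 D2 (n + k) (b ^ k * S + S'))))"
    using entry_sum_le_card_matching[OF finite_D(2)] by (intro mult_left_mono) auto
  finally have "real (card (matching b D1 D2 k S') * card (matching b D1 D2 n S)) \<le>
      real (16 * card (matching b D1 D2 (n + k) (b ^ k * S + S')))" by simp
  then show ?thesis by (simp only: of_nat_le_iff)
qed

text \<open>If no digit could produce the outgoing carry \<open>c\<close>, column \<open>c\<close>
  of the digit matrix would vanish, contrary to non-singularity.\<close>

lemma digit_extension: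
  assumes i: "i \<in> {0..b-1}" and c: "c \<in> {0, 1}"
  shows "\<exists>d\<in>D1. \<exists>j\<in>{0, 1}. d + i + j - c * b \<in> D2"
proof (rule ccontr)
  assume no: "\<not> ?thesis"
  have "digit_count b D1 D2 i j c = 0" if "j \<in> {0, 1}" for j
  proof -
    have "{d \<in> D1. d + i + j - c * b \<in> D2} = {}" using no that by blast
    then show ?thesis unfolding digit_count_alt by (simp only: card.empty)
  qed
  then have "det (A i) = 0" using c by (auto simp: det_2 digit_matrix_nth)
  then show False using det_A[OF i] by simp
qed

text \<open>The number of cylinders lies between \<open>exp (walk_sum)\<close> divided by 2 and
  twice \<open>exp (walk_sum)\<close>; the errors \<open>ln 2 / n\<close> vanish in the growth rate.
  Irrationality excludes all \<open>b\<close>-adic rational translations.\<close>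

lemma dimension_eq:
  assumes t: "0 \<le> t" "t < 1" "t \<notin> \<rat>"
    and lim: "(\<lambda>n. walk_sum b g l n \<lfloor>of_int b ^ n * t\<rfloor> / n) \<longlonglongrightarrow> \<Lambda>"
  shows "hausdorff_dim ((\<lambda>x. x + to_circle t) ` digit_set b D1 \<inter> digit_set b D2) = ereal (\<Lambda> / ln b)"
proof -
  have bp: "real_of_int b ^ n > 0" for n using b by simp
  have "t \<noteq> 0" using t(3) by auto
  have nonadic: "of_int b ^ n * t \<notin> \<int>" for n
  proof
    assume "of_int b ^ n * t \<in> \<int>"
    then have "of_int b ^ n * t / of_int b ^ n \<in> \<rat>"
      by (intro Rats_divide Rats_power Rats_of_int) (auto elim: Ints_cases)
    then show False using bp[of n] t(3) b by simp
  qed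
  let ?S = "\<lambda>n. \<lfloor>of_int b ^ n * t\<rfloor>" and ?R = "\<lambda>n. matching b D1 D2 n \<lfloor>of_int b ^ n * t\<rfloor>"
  have range: "0 \<le> ?S n" "?S n < b ^ n" for n
  proof -
    show "0 \<le> ?S n" using bp[of n] t by simp
    have "of_int b ^ n * t < of_int (b ^ n)" using bp[of n] t by simp
    then show "?S n < b ^ n" by (simp add: floor_less_iff)
  qed
  have growth: "(\<lambda>n. ln (card (?R n)) / n) \<longlonglongrightarrow> \<Lambda>"
  proof (rule tendsto_sandwich)
    have "real (card (?R n)) \<le> 2 * exp (walk_sum b g l n (?S n))"
      "2 * exp (walk_sum b g l n (?S n)) \<le> 4 * real (card (?R n))" for n
      using card_matching_le[OF finite_D(1), of b D2 n "?S n"]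
        entry_sum_le_card_matching[OF finite_D(2), of b D1 n "?S n"] entry_sum_prefix[OF range] by auto
    note bounds = this
    have pos: "real (card (?R n)) > 0" for n
      using bounds(2)[of n] exp_gt_zero[of "walk_sum b g l n (?S n)"] by linarith
    have up: "ln (card (?R n)) \<le> walk_sum b g l n (?S n) + ln 2" for n
    proof -
      have "ln (card (?R n)) \<le> ln (2 * exp (walk_sum b g l n (?S n)))"
        using pos[of n] bounds(1)[of n] by (subst ln_le_cancel_iff) auto
      then show ?thesis by (simp add: ln_mult)
    qed
    have low: "walk_sum b g l n (?S n) - ln 2 \<le> ln (card (?R n))" for n
    proof -
      have "exp (walk_sum b g l n (?S n)) / 2 \<le> card (?R n)" using bounds(2)[of n] by simp
      then have "ln (exp (walk_sum b g l n (?S n)) / 2) \<le> ln (card (?R n))"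
        using pos[of n] by (subst ln_le_cancel_iff) auto
      then show ?thesis by (simp add: ln_div)
    qed
    show "\<forall>\<^sub>F n in sequentially. walk_sum b g l n (?S n) / n - ln 2 / n \<le> ln (card (?R n)) / n"
      using low by (intro always_eventually allI) (simp add: divide_right_mono flip: diff_divide_distrib)
    show "\<forall>\<^sub>F n in sequentially. ln (card (?R n)) / n \<le> walk_sum b g l n (?S n) / n + ln 2 / n"
      using up by (intro always_eventually allI) (simp add: divide_right_mono flip: add_divide_distrib)
    show "(\<lambda>n. walk_sum b g l n (?S n) / n - ln 2 / n) \<longlonglongrightarrow> \<Lambda>"
      using tendsto_diff[OF lim lim_const_over_n[of "ln 2"]] by simp
    show "(\<lambda>n. walk_sum b g l n (?S n) / n + ln 2 / n) \<longlonglongrightarrow> \<Lambda>"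
      using tendsto_add[OF lim lim_const_over_n[of "ln 2"]] by simp
  qed
  interpret digit_translate_growth b D1 D2 t \<Lambda>
    by unfold_locales
      (use b t \<open>t \<noteq> 0\<close> nonadic D_sub digit_extension card_matching_supmult growth in \<open>auto simp del: atLeastAtMost_iff\<close>)
  show ?thesis using hausdorff_dim_X unfolding X_def .
qed

lemma log_cocycle_bounded: "\<exists>K. \<forall>i\<in>{0..b-1}. \<forall>x. \<bar>x\<bar> \<le> 1 \<longrightarrow> \<bar>l i x\<bar> \<le> K"
proof -
  have "\<forall>i\<in>{0..b-1}. \<exists>K. \<forall>x. \<bar>x\<bar> \<le> 1 \<longrightarrow> \<bar>l i x\<bar> \<le> K"
  proof
    fix i assume i: "i \<in> {0..b-1}"
    obtain K where K: "K \<ge> 0" "\<And>x y. \<bar>x\<bar> \<le> 1 \<Longrightarrow> \<bar>y\<bar> \<le> 1 \<Longrightarrow> \<bar>l i x - l i y\<bar> \<le> K * \<bar>x - y\<bar>"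
      using log_cocycle_lipschitz[OF positive_cone_conj[OF i]] by blast
    have "\<bar>l i x\<bar> \<le> \<bar>l i 0\<bar> + K" if "\<bar>x\<bar> \<le> 1" for x
    proof -
      have "K * \<bar>x - 0\<bar> \<le> K * 1" using K(1) that by (intro mult_left_mono) auto
      then show ?thesis using K(2)[OF that, of 0] by simp
    qed
    then show "\<exists>K. \<forall>x. \<bar>x\<bar> \<le> 1 \<longrightarrow> \<bar>l i x\<bar> \<le> K" by blast
  qed
  from bchoice[OF this] obtain K where K: "\<And>i x. i \<in> {0..b-1} \<Longrightarrow> \<bar>x\<bar> \<le> 1 \<Longrightarrow> \<bar>l i x\<bar> \<le> K i" by blast
  have "\<bar>l i x\<bar> \<le> Max (K ` {0..b-1})" if "i \<in> {0..b-1}" "\<bar>x\<bar> \<le> 1" for i x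
    using K[OF that] that(1) by (intro order_trans[OF _ Max_ge]) auto
  then show ?thesis by blast
qed

lemma dimension_formula:
  defines "B \<equiv> \<lambda>i. cone_conj (A i)" and "w \<equiv> \<lambda>i :: int. 1 / real_of_int b"
  shows "summable (\<lambda>n. (T_op {0..b-1} w B ^^ n) (v_vec {0..b-1} w B) 0)"
    and "AE t in circle_lebesgue. \<exists>d :: real.
      hausdorff_dim ((\<lambda>x. x + t) ` digit_set b D1 \<inter> digit_set b D2) = ereal d \<and>
      complex_of_real d = 1 / complex_of_real (ln (real_of_int b)) *
        (\<Sum>n. (T_op {0..b-1} w B ^^ n) (v_vec {0..b-1} w B) 0)" (is ?AE)
proof -
  let ?I = "{0..b-1}"
  let ?\<psi> = "\<lambda>x. \<Sum>i\<in>?I. w i * log_cocycle (F_map (B i)) x"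
  have pos: "\<And>i. i \<in> ?I \<Longrightarrow> positive_matrix (B i)" unfolding B_def by (rule positive_cone_conj)
  have det: "\<And>i. i \<in> ?I \<Longrightarrow> det (B i) \<noteq> 0" unfolding B_def det_cone_conj by (rule det_A)
  have w: "\<And>i. i \<in> ?I \<Longrightarrow> w i \<ge> 0" "(\<Sum>i\<in>?I. w i) = 1" using b by (simp_all add: w_def)
  obtain \<rho> \<Lambda> where \<rho>: "0 \<le> \<rho>" "\<rho> < 1" "\<And>i x. i \<in> ?I \<Longrightarrow> \<bar>x\<bar> \<le> 1 \<Longrightarrow> \<bar>mob_act (F_map (B i)) x\<bar> \<le> \<rho>"
    and \<Lambda>: "(\<lambda>n. (transfer_op ?I w (\<lambda>i. mob_act (F_map (B i))) ^^ n) ?\<psi> 0) \<longlonglongrightarrow> \<Lambda>"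
    "\<And>\<epsilon>. \<epsilon> > 0 \<Longrightarrow> \<exists>n. \<forall>x. \<bar>x\<bar> \<le> \<rho> \<longrightarrow>
      \<bar>(transfer_op ?I w (\<lambda>i. mob_act (F_map (B i))) ^^ n) ?\<psi> x - \<Lambda>\<bar> \<le> \<epsilon>"
    by (rule transfer_op_limit[OF _ pos w]) auto
  have "(\<lambda>n. \<Sum>m<Suc n. (T_op ?I w B ^^ m) (v_vec ?I w B) 0) \<longlonglongrightarrow> complex_of_real \<Lambda>"
  proof -
    have "(\<Sum>m<Suc n. (T_op ?I w B ^^ m) (v_vec ?I w B) 0) =
        of_real ((transfer_op ?I w (\<lambda>i. mob_act (F_map (B i))) ^^ n) ?\<psi> 0)" for n
      by (rule sum_T_op_power_v_vec) (fact pos det w(2))+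
    then show ?thesis using tendsto_of_real[OF \<Lambda>(1)] by (simp only:)
  qed
  then have sums: "(\<lambda>n. (T_op ?I w B ^^ n) (v_vec ?I w B) 0) sums complex_of_real \<Lambda>"
    unfolding sums_def by (rule LIMSEQ_imp_Suc)
  then show "summable (\<lambda>n. (T_op ?I w B ^^ n) (v_vec ?I w B) 0)" by (rule sums_summable)
  obtain K where K: "\<And>i x. i \<in> ?I \<Longrightarrow> \<bar>x\<bar> \<le> 1 \<Longrightarrow> \<bar>l i x\<bar> \<le> K" using log_cocycle_bounded by blast
  have "AE t :: real in lborel. 0 \<le> t \<longrightarrow> t < 1 \<longrightarrow>
      (\<lambda>n. walk_sum b g l n \<lfloor>of_int b ^ n * t\<rfloor> / n) \<longlonglongrightarrow> \<Lambda>"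
    by (rule walk_sum_average_AE[where K = K, OF _ \<rho>(1) _ _ \<Lambda>(2)[unfolded w_def B_def]])
      (use b \<rho> K in \<open>auto simp: B_def simp del: atLeastAtMost_iff\<close>)
  moreover have "AE t :: real in lborel. t \<notin> \<rat>"
    by (rule AE_not_in) (rule countable_imp_null_set_lborel[OF countable_rat])
  ultimately have "AE t :: real in lborel. 0 \<le> t \<longrightarrow> t < 1 \<longrightarrow>
      hausdorff_dim ((\<lambda>x. x + to_circle t) ` digit_set b D1 \<inter> digit_set b D2) = ereal (\<Lambda> / ln b)"
    by eventually_elim (auto intro: dimension_eq)
  then have "AE t in circle_lebesgue.
      hausdorff_dim ((\<lambda>x. x + t) ` digit_set b D1 \<inter> digit_set b D2) = ereal (\<Lambda> / ln b)"
    by (rule AE_circle_lebesgueI)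
  moreover have "complex_of_real (\<Lambda> / ln b) = 1 / complex_of_real (ln (real_of_int b)) *
      (\<Sum>n. (T_op ?I w B ^^ n) (v_vec ?I w B) 0)"
    using sums_unique[OF sums] by simp
  ultimately show ?AE
    by (auto elim!: eventually_mono)
qed

end

lemma degenerate_iff:
  fixes b \<tau> u :: int
  assumes "b \<ge> 5" "\<tau> \<in> {0..b-1}" "u \<in> {0..b-1}"
  shows "\<not> degenerate b ({0..b-1} - {\<tau>}) ({0..b-1} - {u}) \<longleftrightarrow> {\<tau>, u} \<inter> {0, b-1} = {} \<and> \<tau> + u = b - 1"
proof
  assume "\<not> degenerate b ({0..b-1} - {\<tau>}) ({0..b-1} - {u})"
  then show "{\<tau>, u} \<inter> {0, b-1} = {} \<and> \<tau> + u = b - 1"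
    using singular_digit_matrix_if[OF assms] invertible_digit_matrix_iff[OF _ assms(2,3)]
    unfolding degenerate_def by blast
next
  assume *: "{\<tau>, u} \<inter> {0, b-1} = {} \<and> \<tau> + u = b - 1"
  then have \<tau>: "\<tau> = b - 1 - u" and u: "1 \<le> u" "u \<le> b - 2" using assms by auto
  interpret reflected_digits b u "{0..b-1} - {\<tau>}" "{0..b-1} - {u}"
    by unfold_locales (use assms(1) u \<tau> in auto)
  show "\<not> degenerate b ({0..b-1} - {\<tau>}) ({0..b-1} - {u})"
    unfolding degenerate_def using det_A by (auto simp: invertible_det_nz simp del: atLeastAtMost_iff)
qed

theorem proposition1p9:
  fixes b \<tau> u :: int and D1 D2 :: "int set" and A :: "int \<Rightarrow> real^2^2"
  assumes "b \<ge> 5" and "\<tau> \<in> {0..b-1}" and "u \<in> {0..b-1}"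
    and "D1 = {0..b-1} - {\<tau>}" and "D2 = {0..b-1} - {u}"
    and "A = digit_matrix b D1 D2"
  shows "(\<not> degenerate b D1 D2 \<longleftrightarrow> {\<tau>, u} \<inter> {0, b-1} = {} \<and> \<tau> + u = b - 1) \<and>
    (\<not> degenerate b D1 D2 \<longrightarrow>
      \<not> heteroclinic_connection2 {0..b-1} (\<lambda>i. mobius (F_map (A i))) \<and>
      (\<exists>(P :: real^2^2) (B :: int \<Rightarrow> real^2^2) (T :: (nat \<Rightarrow> complex) \<Rightarrow> nat \<Rightarrow> complex) v.
        invertible P \<and>
        (\<forall>i\<in>{0..b-1}. B i = P ** A i ** matrix_inv P \<and> positive_matrix (B i)) \<and>
        T = T_op {0..b-1} (\<lambda>i. 1 / real_of_int b) B \<and>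
        v = v_vec {0..b-1} (\<lambda>i. 1 / real_of_int b) B \<and>
        summable (\<lambda>n. (T ^^ n) v 0) \<and>
        (AE t in circle_lebesgue. \<exists>d :: real.
          hausdorff_dim ((\<lambda>x. x + t) ` digit_set b D1 \<inter> digit_set b D2) = ereal d \<and>
          complex_of_real d = 1 / complex_of_real (ln (real_of_int b)) * (\<Sum>n. (T ^^ n) v 0))))"
proof (intro conjI impI)
  show iff: "\<not> degenerate b D1 D2 \<longleftrightarrow> {\<tau>, u} \<inter> {0, b-1} = {} \<and> \<tau> + u = b - 1"
    using degenerate_iff assms by simp
  assume "\<not> degenerate b D1 D2"
  then have "\<tau> = b - 1 - u" "1 \<le> u" "u \<le> b - 2" using iff assms(1-3) by auto
  then interpret reflected_digits b u D1 D2
    by unfold_locales (use assms in auto)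
  show "\<not> heteroclinic_connection2 {0..b-1} (\<lambda>i. mobius (F_map (A i)))"
    unfolding assms(6) by (rule no_heteroclinic)
  let ?B = "\<lambda>i. cone_conj (digit_matrix b D1 D2 i)" and ?w = "\<lambda>i :: int. 1 / real_of_int b"
  show "\<exists>(P :: real^2^2) (B :: int \<Rightarrow> real^2^2) (T :: (nat \<Rightarrow> complex) \<Rightarrow> nat \<Rightarrow> complex) v.
      invertible P \<and>
      (\<forall>i\<in>{0..b-1}. B i = P ** A i ** matrix_inv P \<and> positive_matrix (B i)) \<and>
      T = T_op {0..b-1} (\<lambda>i. 1 / real_of_int b) B \<and>
      v = v_vec {0..b-1} (\<lambda>i. 1 / real_of_int b) B \<and>
      summable (\<lambda>n. (T ^^ n) v 0) \<and>
      (AE t in circle_lebesgue. \<exists>d :: real.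
        hausdorff_dim ((\<lambda>x. x + t) ` digit_set b D1 \<inter> digit_set b D2) = ereal d \<and>
        complex_of_real d = 1 / complex_of_real (ln (real_of_int b)) * (\<Sum>n. (T ^^ n) v 0))"
  proof (intro exI conjI)
    show "invertible cone_basis" by (rule invertible_cone_basis)
    show "\<forall>i\<in>{0..b-1}. ?B i = cone_basis ** A i ** matrix_inv cone_basis \<and> positive_matrix (?B i)"
      using positive_cone_conj unfolding assms(6) cone_conj_def by blast
    show "T_op {0..b-1} ?w ?B = T_op {0..b-1} ?w ?B" "v_vec {0..b-1} ?w ?B = v_vec {0..b-1} ?w ?B"
      by (rule refl)+
  qed (rule dimension_formula)+
qed

end
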